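(* Let $\Omega\subset\mathbb{R}^n$ be a domain, $P\in L^\infty(\Omega)$, $x_0\in\Omega$, $0<r_1<r_2<d(x_0,\partial\Omega)$ and $B_j=B(x_0,r_j)$ for $j=1,2$. Then there exist $\kappa\in(0,1)$ and a constant $C(P)>0$ such that for all $u\in L^2(\Omega)$ $$\|u\|_{L^2(B_2)}\le C(P)\left(\|u\|_{L^2(B_1)}+\|-\Delta u+Pu\|_{H^{-2}(\Omega)}\right)^{\kappa}\left(\|u\|_{L^2(\Omega)}+\|-\Delta u+Pu\|_{H^{-2}(\Omega)}\right)^{1-\kappa}.$$ Furthermore, if $P\ge 0$ on $\Omega$, then one may take $C(P)=\exp\left(C\kappa^{1-\epsilon}\left(\|P\|_{L^\infty(\Omega)}^{2/3}+1\right)\right)$, where $\epsilon\in(0,1)$ is arbitrary and $C>0$ depends on $\epsilon$ and the geometry ($\Omega,x_0,r_1,r_2$), but not on $P$ or $u$.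
   Context: $B(x_0,r)$ is the open ball of radius $r$ centred at $x_0$; $d(x_0,\partial\Omega)$ is the distance from $x_0$ to the boundary of $\Omega$. $P$ is a real-valued potential. $H^{-2}(\Omega)$ is the dual of $H^2_0(\Omega)$, and $-\Delta u+Pu$ is understood in the distributional sense, i.e. as the functional $v\mapsto\int_\Omega u(-\Delta v+Pv)\,dx$ on $H^2_0(\Omega)$. The exponent $\kappa$ depends only on the geometry ($\Omega,x_0,r_1,r_2$), not on $P$, $u$ or $\epsilon$; $C(P)$ is independent of $u$. *)

theory Defs
  imports "HOL-Probability.Essential_Supremum"
begin

text \<open>
  Euclidean space is a type \<open>'a :: euclidean_space\<close>, and partial derivatives are taken along its
  standard basis \<open>Basis\<close>. Functions on \<open>\<Omega>\<close> are total functions on \<open>'a\<close> whose values outside \<open>\<Omega>\<close>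
  are irrelevant. The scalars range over the class
  \<open>{real_normed_field, euclidean_space}\<close>, which has \<open>real\<close> and \<open>complex\<close> as instances, so that
  the real and the complex spaces are treated together.
\<close>

section \<open>Lebesgue spaces\<close>

definition L2 :: "'a::euclidean_space set \<Rightarrow> ('a \<Rightarrow> 'b::euclidean_space) set" where
  "L2 \<Omega> = {u. u \<in> borel_measurable (lebesgue_on \<Omega>) \<and>
              integrable (lebesgue_on \<Omega>) (\<lambda>x. (norm (u x))\<^sup>2)}"

definition L2_norm :: "'a::euclidean_space set \<Rightarrow> ('a \<Rightarrow> 'b::euclidean_space) \<Rightarrow> real" where
  "L2_norm \<Omega> u = sqrt (LINT x|lebesgue_on \<Omega>. (norm (u x))\<^sup>2)"

definition Linf :: "'a::euclidean_space set \<Rightarrow> ('a \<Rightarrow> real) set" where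
  "Linf \<Omega> = {P. P \<in> borel_measurable (lebesgue_on \<Omega>) \<and>
                esssup (lebesgue_on \<Omega>) (\<lambda>x. ereal \<bar>P x\<bar>) < \<infinity>}"

definition Linf_norm :: "'a::euclidean_space set \<Rightarrow> ('a \<Rightarrow> real) \<Rightarrow> real" where
  "Linf_norm \<Omega> P = real_of_ereal (esssup (lebesgue_on \<Omega>) (\<lambda>x. ereal \<bar>P x\<bar>))"

section \<open>Test functions and weak derivatives\<close>

definition partial_deriv ::
    "'a::euclidean_space \<Rightarrow> ('a \<Rightarrow> 'b::euclidean_space) \<Rightarrow> 'a \<Rightarrow> 'b" where
  "partial_deriv i f x = frechet_derivative f (at x) i"

fun C_k :: "nat \<Rightarrow> ('a::euclidean_space \<Rightarrow> 'b::euclidean_space) \<Rightarrow> bool" where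
  "C_k 0 f \<longleftrightarrow> continuous_on UNIV f"
| "C_k (Suc k) f \<longleftrightarrow> (\<forall>x. f differentiable (at x)) \<and> (\<forall>i\<in>Basis. C_k k (partial_deriv i f))"

definition test_functions ::
    "'a::euclidean_space set \<Rightarrow> ('a \<Rightarrow> 'b::euclidean_space) set" where
  "test_functions \<Omega> = {\<phi>. (\<forall>k. C_k k \<phi>) \<and>
     compact (closure {x. \<phi> x \<noteq> 0}) \<and> closure {x. \<phi> x \<noteq> 0} \<subseteq> \<Omega>}"

definition locally_integrable ::
    "'a::euclidean_space set \<Rightarrow> ('a \<Rightarrow> 'b::euclidean_space) \<Rightarrow> bool" where
  "locally_integrable \<Omega> v \<longleftrightarrow> (\<forall>K. compact K \<and> K \<subseteq> \<Omega> \<longrightarrow> v absolutely_integrable_on K)"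

definition has_weak_partial ::
    "'a::euclidean_space set \<Rightarrow> 'a \<Rightarrow> ('a \<Rightarrow> 'b::euclidean_space) \<Rightarrow> ('a \<Rightarrow> 'b) \<Rightarrow> bool" where
  "has_weak_partial \<Omega> i v g \<longleftrightarrow> locally_integrable \<Omega> v \<and> locally_integrable \<Omega> g \<and>
     (\<forall>\<phi>\<in>test_functions \<Omega>.
        (LINT x|lebesgue_on \<Omega>. partial_deriv i \<phi> x *\<^sub>R v x) =
        - (LINT x|lebesgue_on \<Omega>. (\<phi> x :: real) *\<^sub>R g x))"

text \<open>A choice of weak derivative; for open \<open>\<Omega>\<close> it is unique almost everywhere on \<open>\<Omega>\<close>.\<close>

definition weak_partial ::
    "'a::euclidean_space set \<Rightarrow> 'a \<Rightarrow> ('a \<Rightarrow> 'b::euclidean_space) \<Rightarrow> 'a \<Rightarrow> 'b" where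
  "weak_partial \<Omega> i v = (SOME g. has_weak_partial \<Omega> i v g)"

definition weak_laplacian ::
    "'a::euclidean_space set \<Rightarrow> ('a \<Rightarrow> 'b::euclidean_space) \<Rightarrow> 'a \<Rightarrow> 'b" where
  "weak_laplacian \<Omega> v x = (\<Sum>i\<in>Basis. weak_partial \<Omega> i (weak_partial \<Omega> i v) x)"

section \<open>Sobolev spaces of order two and minus two\<close>

definition H2 :: "'a::euclidean_space set \<Rightarrow> ('a \<Rightarrow> 'b::euclidean_space) set" where
  "H2 \<Omega> = {v \<in> L2 \<Omega>. \<forall>i\<in>Basis. \<exists>g\<in>L2 \<Omega>. has_weak_partial \<Omega> i v g \<and>
             (\<forall>j\<in>Basis. \<exists>h\<in>L2 \<Omega>. has_weak_partial \<Omega> j g h)}"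

definition H2_norm :: "'a::euclidean_space set \<Rightarrow> ('a \<Rightarrow> 'b::euclidean_space) \<Rightarrow> real" where
  "H2_norm \<Omega> v = sqrt ((L2_norm \<Omega> v)\<^sup>2
     + (\<Sum>i\<in>Basis. (L2_norm \<Omega> (weak_partial \<Omega> i v))\<^sup>2)
     + (\<Sum>i\<in>Basis. \<Sum>j\<in>Basis. (L2_norm \<Omega> (weak_partial \<Omega> j (weak_partial \<Omega> i v)))\<^sup>2))"

definition H2_0 :: "'a::euclidean_space set \<Rightarrow> ('a \<Rightarrow> 'b::euclidean_space) set" where
  "H2_0 \<Omega> = {v \<in> H2 \<Omega>. \<exists>\<phi>. (\<forall>k::nat. \<phi> k \<in> test_functions \<Omega>) \<and>
               (\<lambda>k. H2_norm \<Omega> (\<lambda>x. \<phi> k x - v x)) \<longlonglongrightarrow> 0}"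

text \<open>The operator norm of a functional on \<open>H2_0 \<Omega>\<close>. The supremum is taken in the reals, hence is
  meaningful for bounded functionals only; \<open>schroedinger \<Omega> P u\<close> below is bounded for
  \<open>u \<in> L2 \<Omega>\<close> and \<open>P \<in> Linf \<Omega>\<close>.\<close>

definition Hm2_norm ::
    "'a::euclidean_space set \<Rightarrow> (('a \<Rightarrow> 'b::euclidean_space) \<Rightarrow> 'b) \<Rightarrow> real" where
  "Hm2_norm \<Omega> F = (SUP v\<in>{v \<in> H2_0 \<Omega>. H2_norm \<Omega> v \<le> 1}. norm (F v))"

text \<open>The distribution \<open>- \<Delta>u + P u\<close> as a functional of \<open>v \<in> H2_0 \<Omega>\<close>; the pairing is bilinear, without
  conjugation, also for complex scalars.\<close>

definition schroedinger ::
    "'a::euclidean_space set \<Rightarrow> ('a \<Rightarrow> real) \<Rightarrow>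
     ('a \<Rightarrow> 'b::{real_normed_field,euclidean_space}) \<Rightarrow> ('a \<Rightarrow> 'b) \<Rightarrow> 'b" where
  "schroedinger \<Omega> P u v =
     (LINT x|lebesgue_on \<Omega>. u x * (- weak_laplacian \<Omega> v x + P x *\<^sub>R v x))"

section \<open>Distance to the boundary\<close>

text \<open>Extended-real valued, so that it is \<open>\<infinity>\<close> when the boundary is empty, i.e. for the whole
  space (\<open>infdist\<close> would give \<open>0\<close>).\<close>

definition boundary_dist :: "'a::euclidean_space set \<Rightarrow> 'a \<Rightarrow> ereal" where
  "boundary_dist \<Omega> x = (INF y\<in>frontier \<Omega>. ereal (dist x y))"

end

theory Submission
  imports Defs
begin

text \<open>
  A Carleman estimate with the radial weight \<open>exp (\<tau> exp (- l |x - x0|\<^sup>2))\<close> gains \<open>\<tau>\<^sup>3\<close> over the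
  Laplacian in the squared weighted \<open>L\<^sup>2\<close> norm, so that the potential is absorbed once \<open>\<tau>\<close> is at least
  a multiple of \<open>1 + \<parallel>P\<parallel>\<^sup>2\<^sup>/\<^sup>3\<close>; together with cutoffs and Caccioppoli's inequality this gives
  the three balls inequality for C2 functions. For \<open>u\<close> in \<open>L\<^sup>2\<close> with \<open>- \<Delta>u + P u = F\<close> in \<open>H\<^sup>-\<^sup>2\<close> one
  minimises \<open>\<parallel>\<Delta>v\<parallel>\<^sup>2 / 2 + F v\<close> over test functions of a ball; with \<open>w = \<Delta>v\<close> for an almost minimiser,
  \<open>\<parallel>w\<parallel>\<close> is bounded by the \<open>H\<^sup>-\<^sup>2\<close> norm and \<open>\<Delta>(u - w)\<close> is \<open>P u\<close> up to an arbitrarily small error.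
  Mollifying \<open>u - w\<close> reduces everything to the smooth case. As \<open>\<kappa>\<close> is determined by the geometry
  alone, the factor \<open>\<kappa>\<close> to the power \<open>1 - \<epsilon>\<close> is absorbed in the constant.
\<close>

text \<open>The potential enters only through the excess \<open>max 0 (|Delta Z| - M * |Z|)\<close>.
  Mollification does not commute with multiplication by a merely bounded \<open>P\<close>, so the
  smooth functions satisfy no equation with a potential; an excess, however, is stable under small
  L2 errors. The power 2/3 is dictated by the Carleman gain: the cube of \<open>\<tau>\<close> has
  to beat the square of \<open>M\<close>. Passing from \<open>Z\<close> back to \<open>u\<close>
  costs a factor of order 1 plus the square of \<open>M\<close>, which is at most a multiple of
  \<open>exp \<tau>\<close>; this is why the small data are weighted with
  \<open>exp (3 * \<tau>)\<close> and not with \<open>exp (2 * \<tau>)\<close>. The large term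
  decays like \<open>exp (- 2 * a * \<tau>)\<close>, with a gap \<open>a\<close> fixed by the radii,
  and balancing the two exponentials gives \<open>\<kappa> = 2 * a / (3 + 2 * a)\<close>. As
  \<open>P\<close> and the test functions are real, the estimates are proved for real functions, and
  a real or complex \<open>u\<close> is treated coordinate by coordinate.\<close>

section \<open>Directional derivatives and integration by parts\<close>

text \<open>A relation with an explicit derivative rather than an operator, so that the rules below
  compute derivative expressions structurally. Only restrictions of \<open>f\<close> to lines in
  direction \<open>i\<close> are differentiated, which makes the real mean value theorem and the
  real product rule directly applicable.\<close>

definition dd :: "'a::euclidean_space \<Rightarrow> ('a \<Rightarrow> real) \<Rightarrow> ('a \<Rightarrow> real) \<Rightarrow> bool" where
  "dd i f f' \<longleftrightarrow> (\<forall>x. ((\<lambda>t. f (x + t *\<^sub>R i)) has_real_derivative f' x) (at 0))"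

lemma ddD: "dd i f f' \<Longrightarrow> ((\<lambda>t. f (x + t *\<^sub>R i)) has_real_derivative f' x) (at 0)"
  by (simp add: dd_def)

lemma dd_at:
  assumes "dd i f f'"
  shows "((\<lambda>t. f (x + t *\<^sub>R i)) has_real_derivative f' (x + t *\<^sub>R i)) (at t)"
proof -
  have "((\<lambda>s. f (x + (s + t) *\<^sub>R i)) has_real_derivative f' (x + t *\<^sub>R i)) (at 0)"
    using ddD[OF assms, of "x + t *\<^sub>R i"] by (simp add: algebra_simps)
  then show ?thesis
    using DERIV_shift[of "\<lambda>t. f (x + t *\<^sub>R i)" "f' (x + t *\<^sub>R i)" 0 t] by simp
qed

lemma dd_unique: "dd i f g \<Longrightarrow> dd i f h \<Longrightarrow> g = h"
  by (auto simp: dd_def fun_eq_iff intro: DERIV_unique)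

lemma dd_const: "dd i (\<lambda>x. c) (\<lambda>x. 0)"
  by (simp add: dd_def)

lemma dd_inner: "dd i (\<lambda>x. (x - c) \<bullet> j) (\<lambda>x. i \<bullet> j)"
  unfolding dd_def by (auto intro!: derivative_eq_intros simp: inner_add_left inner_diff_left)

lemma dd_add: "dd i f f' \<Longrightarrow> dd i g g' \<Longrightarrow> dd i (\<lambda>x. f x + g x) (\<lambda>x. f' x + g' x)"
  unfolding dd_def by (auto intro!: derivative_eq_intros)

lemma dd_diff: "dd i f f' \<Longrightarrow> dd i g g' \<Longrightarrow> dd i (\<lambda>x. f x - g x) (\<lambda>x. f' x - g' x)"
  unfolding dd_def by (auto intro!: derivative_eq_intros)

lemma dd_mult: "dd i f f' \<Longrightarrow> dd i g g' \<Longrightarrow> dd i (\<lambda>x. f x * g x) (\<lambda>x. f' x * g x + f x * g' x)"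
  unfolding dd_def by (auto intro!: derivative_eq_intros)

lemma dd_cmult: "dd i f f' \<Longrightarrow> dd i (\<lambda>x. c * f x) (\<lambda>x. c * f' x)"
  unfolding dd_def by (auto intro!: derivative_eq_intros)

lemma dd_minus: "dd i f f' \<Longrightarrow> dd i (\<lambda>x. - f x) (\<lambda>x. - f' x)"
  unfolding dd_def by (auto intro!: derivative_eq_intros)

lemma dd_exp: "dd i f f' \<Longrightarrow> dd i (\<lambda>x. exp (f x)) (\<lambda>x. exp (f x) * f' x)"
  unfolding dd_def by (auto intro!: derivative_eq_intros)

lemma dd_sum: "(\<And>j. j \<in> J \<Longrightarrow> dd i (f j) (f' j)) \<Longrightarrow> dd i (\<lambda>x. \<Sum>j\<in>J. f j x) (\<lambda>x. \<Sum>j\<in>J. f' j x)"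
  unfolding dd_def by (auto intro!: DERIV_sum)

lemma dd_const_open:
  assumes "dd i f f'" "open U" "\<And>y. y \<in> U \<Longrightarrow> f y = k" "x \<in> U"
  shows "f' x = 0"
proof -
  have "((\<lambda>t. x + t *\<^sub>R i) \<longlongrightarrow> x + 0 *\<^sub>R i) (nhds (0::real))"
    by (intro tendsto_intros filterlim_ident)
  then have "\<forall>\<^sub>F t in nhds 0. x + t *\<^sub>R i \<in> U"
    using assms by (intro topological_tendstoD) auto
  then have "\<forall>\<^sub>F t in nhds 0. f (x + t *\<^sub>R i) = k"
    by eventually_elim (use assms(3) in auto)
  then have "((\<lambda>t. f (x + t *\<^sub>R i)) has_real_derivative f' x) (at 0) \<longleftrightarrow>
      ((\<lambda>t. k) has_real_derivative f' x) (at 0)"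
    by (intro DERIV_cong_ev) auto
  with ddD[OF assms(1), of x] have "((\<lambda>t. k) has_real_derivative f' x) (at 0)" by simp
  then show ?thesis using DERIV_unique DERIV_const by blast
qed

lemma dd_zero_outside:
  assumes "dd i f f'" "\<And>x. x \<notin> cball c R \<Longrightarrow> f x = 0" "x \<notin> cball c R"
  shows "f' x = 0"
  by (rule dd_const_open[OF assms(1), of "- cball c R" 0]) (use assms in auto)

section \<open>Integrals of compactly supported functions and their derivatives\<close>

lemma compact_support_bounded:
  fixes f :: "'a::euclidean_space \<Rightarrow> real"
  assumes "continuous_on UNIV f" "\<And>x. x \<notin> cball c R \<Longrightarrow> f x = 0"
  obtains B where "B \<ge> 0" "\<And>x. \<bar>f x\<bar> \<le> B"
proof -
  have "compact (f ` cball c R)"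
    by (intro compact_continuous_image continuous_on_subset[OF assms(1)]) auto
  then obtain B where B: "\<And>x. x \<in> cball c R \<Longrightarrow> \<bar>f x\<bar> \<le> B"
    by (meson compact_imp_bounded bounded_real imageI)
  have "\<bar>f x\<bar> \<le> max B 0" for x
    using B[of x] assms(2)[of x] by (cases "x \<in> cball c R") auto
  then show ?thesis using that[of "max B 0"] by auto
qed

lemma integrable_compact_support:
  fixes f :: "'a::euclidean_space \<Rightarrow> real"
  assumes "continuous_on UNIV f" "\<And>x. x \<notin> cball c R \<Longrightarrow> f x = 0"
  shows "integrable lborel f"
proof -
  have "integrable lborel (\<lambda>x. indicator (cball c R) x *\<^sub>R f x)"
    by (intro borel_integrable_compact continuous_on_subset[OF assms(1)]) auto
  moreover have "(\<lambda>x. indicator (cball c R) x *\<^sub>R f x) = f"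
    using assms(2) by (auto simp: fun_eq_iff indicator_def)
  ultimately show ?thesis by simp
qed

lemma lborel_integral_translate:
  fixes f :: "'a::euclidean_space \<Rightarrow> real"
  assumes [measurable]: "f \<in> borel_measurable borel"
  shows "(LINT x|lborel. f (x + c)) = (LINT x|lborel. f x)"
proof -
  have "(LINT x|lborel. f x) = (LINT x|distr lborel borel ((+) c). f x)"
    by (simp add: lborel_distr_plus)
  also have "\<dots> = (LINT x|lborel. f (c + x))"
    by (subst integral_distr) auto
  finally show ?thesis by (simp add: add.commute)
qed

lemma lborel_integrable_translate:
  fixes f :: "'a::euclidean_space \<Rightarrow> real"
  assumes "integrable lborel f"
  shows "integrable lborel (\<lambda>x. f (x + c))"
proof -
  have "integrable (distr lborel borel ((+) c)) f"
    using assms by (simp add: lborel_distr_plus)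
  then have "integrable lborel (\<lambda>x. f (c + x))"
    by (subst (asm) integrable_distr_eq) (use assms in auto)
  then show ?thesis by (simp add: add.commute)
qed

lemma dd_increment_le:
  assumes d: "dd i g g'" and B: "\<And>x. \<bar>g' x\<bar> \<le> B" and h: "h \<ge> 0"
  shows "\<bar>g (x + h *\<^sub>R i) - g x\<bar> \<le> B * h"
proof (cases "h = 0")
  case False
  with h have "0 < h" by simp
  have "\<exists>z. 0 < z \<and> z < h \<and> g (x + h *\<^sub>R i) - g (x + 0 *\<^sub>R i) = (h - 0) * g' (x + z *\<^sub>R i)"
    by (rule MVT2[OF \<open>0 < h\<close>]) (use dd_at[OF d] in auto)
  then obtain z where "g (x + h *\<^sub>R i) - g x = h * g' (x + z *\<^sub>R i)" by auto
  then show ?thesis using B[of "x + z *\<^sub>R i"] \<open>0 < h\<close> by (simp add: abs_mult)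
qed simp

text \<open>Each difference quotient of \<open>g\<close> along \<open>i\<close> has integral zero
  because \<open>lborel\<close> is translation invariant, and dominated convergence carries this to
  the derivative. This replaces Fubini and the fundamental theorem of calculus.\<close>

lemma integral_dd_eq_0:
  fixes g :: "'a::euclidean_space \<Rightarrow> real"
  assumes d: "dd i g g'" and cg: "continuous_on UNIV g" and cg': "continuous_on UNIV g'"
    and supp: "\<And>x. x \<notin> cball c R \<Longrightarrow> g x = 0"
  shows "(LINT x|lborel. g' x) = 0"
proof -
  have supp': "g' x = 0" if "x \<notin> cball c R" for x
    using dd_zero_outside[OF d supp that] .
  obtain B where B0: "B \<ge> 0" and B: "\<And>x. \<bar>g' x\<bar> \<le> B"
    using compact_support_bounded[OF cg' supp'] by blast
  have [measurable]: "g \<in> borel_measurable borel" "g' \<in> borel_measurable borel"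
    using cg cg' by (auto intro: borel_measurable_continuous_onI)
  define h where "h n = 1 / real (Suc n)" for n
  have hpos: "h n > 0" and h1: "h n \<le> 1" for n by (auto simp: h_def)
  have hlim: "h \<longlonglongrightarrow> 0" unfolding h_def by (rule LIMSEQ_inverse_real_of_nat[unfolded inverse_eq_divide]) 
  define q where "q n x = (g (x + h n *\<^sub>R i) - g x) / h n" for n x
  have [measurable]: "q n \<in> borel_measurable borel" for n
    unfolding q_def by measurable
  have lim: "(\<lambda>n. q n x) \<longlonglongrightarrow> g' x" for x
  proof -
    have "((\<lambda>t. (g (x + t *\<^sub>R i) - g x) / t) \<longlongrightarrow> g' x) (at 0)"
      using ddD[OF d, of x] by (simp add: DERIV_def)
    moreover have "filterlim h (at 0) sequentially"
      unfolding filterlim_at using hlim hpos by (auto simp: less_imp_neq[THEN not_sym])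
    ultimately show ?thesis unfolding q_def by (rule filterlim_compose)
  qed
  \<comment> \<open>The steps \<open>h n\<close> are at most 1, so all quotients vanish outside the
    ball enlarged by \<open>norm i\<close>; with the mean value bound this gives one integrable
    majorant.\<close>
  have qB: "\<bar>q n x\<bar> \<le> B * indicator (cball c (R + norm i)) x" for n x
  proof (cases "x \<in> cball c (R + norm i)")
    case True
    have "\<bar>q n x\<bar> \<le> B * h n / h n"
      unfolding q_def abs_divide using dd_increment_le[OF d B, of "h n" x] hpos[of n]
      by (simp add: field_simps)
    then show ?thesis using True hpos[of n] by simp
  next
    case False
    then have n: "dist c x > R + norm i" by simp
    have "dist c x \<le> dist c (x + h n *\<^sub>R i) + norm (h n *\<^sub>R i)"
      using norm_triangle_ineq4[of "c - x - h n *\<^sub>R i" "- (h n *\<^sub>R i)"]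
      by (simp add: dist_norm algebra_simps)
    moreover have "norm (h n *\<^sub>R i) \<le> norm i"
      using h1[of n] hpos[of n] by (simp add: mult_left_le_one_le)
    ultimately have "x + h n *\<^sub>R i \<notin> cball c R" using n by simp
    moreover have "x \<notin> cball c R" using n norm_ge_zero[of i] by (smt (verit) mem_cball)
    ultimately show ?thesis using supp False by (simp add: q_def)
  qed
  have "(\<lambda>n. LINT x|lborel. q n x) \<longlonglongrightarrow> (LINT x|lborel. g' x)"
  proof (rule integral_dominated_convergence[where w="\<lambda>x. B * indicator (cball c (R + norm i)) x"])
    show "integrable lborel (\<lambda>x. B * indicator (cball c (R + norm i)) x)"
      by (intro integrable_mult_right integrable_real_indicator) (auto intro!: emeasure_bounded_finite[unfolded infinity_ennreal_def])
  qed (use lim qB in auto)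
  moreover have "(LINT x|lborel. q n x) = 0" for n
  proof -
    have ig: "integrable lborel g" by (rule integrable_compact_support[OF cg supp])
    show ?thesis
      unfolding q_def
      using lborel_integral_translate[of g "h n *\<^sub>R i"] lborel_integrable_translate[OF ig, of "h n *\<^sub>R i"] ig
      by simp
  qed
  ultimately show ?thesis by (simp add: LIMSEQ_const_iff)
qed

section \<open>Symmetry of mixed derivatives\<close>

text \<open>The second difference over a parallelogram is the increment of a function of one
  variable whose derivative is again an increment, so the mean value theorem applies twice. The
  expression is symmetric in \<open>i\<close> and \<open>j\<close>, which is what
  \<open>dd_commute\<close> exploits.\<close>

lemma double_mean_value:
  assumes i: "dd i f fi" and ij: "dd j fi fij" and h: "h > 0"
  shows "\<exists>s t. 0 < s \<and> s < h \<and> 0 < t \<and> t < h \<and>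
    f (x + h *\<^sub>R i + h *\<^sub>R j) - f (x + h *\<^sub>R i) - f (x + h *\<^sub>R j) + f x
      = h * h * fij (x + s *\<^sub>R i + t *\<^sub>R j)"
proof -
  let ?p = "\<lambda>t. f (x + h *\<^sub>R j + t *\<^sub>R i) - f (x + t *\<^sub>R i)"
  have "\<exists>s. 0 < s \<and> s < h \<and> ?p h - ?p 0 = (h - 0) * (fi (x + h *\<^sub>R j + s *\<^sub>R i) - fi (x + s *\<^sub>R i))"
    by (rule MVT2[OF h]) (intro DERIV_diff dd_at[OF i])
  then obtain s where s: "0 < s" "s < h"
    "?p h - ?p 0 = h * (fi (x + h *\<^sub>R j + s *\<^sub>R i) - fi (x + s *\<^sub>R i))" by auto
  have "\<exists>t. 0 < t \<and> t < h \<and> fi (x + s *\<^sub>R i + h *\<^sub>R j) - fi (x + s *\<^sub>R i + 0 *\<^sub>R j)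
      = (h - 0) * fij (x + s *\<^sub>R i + t *\<^sub>R j)"
    by (rule MVT2[OF h]) (rule dd_at[OF ij])
  then obtain t where t: "0 < t" "t < h"
    "fi (x + s *\<^sub>R i + h *\<^sub>R j) - fi (x + s *\<^sub>R i) = h * fij (x + s *\<^sub>R i + t *\<^sub>R j)" by auto
  have "x + h *\<^sub>R j + s *\<^sub>R i = x + s *\<^sub>R i + h *\<^sub>R j" "x + h *\<^sub>R j + h *\<^sub>R i = x + h *\<^sub>R i + h *\<^sub>R j"
    by (simp_all add: algebra_simps)
  with s t show ?thesis
    by (intro exI[of _ s] exI[of _ t]) (simp add: algebra_simps)
qed

lemma dd_commute:
  assumes "dd i f fi" "dd j f fj" "dd j fi fij" "dd i fj fji"
    and cont: "continuous_on UNIV fij" "continuous_on UNIV fji"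
  shows "fij x = fji x"
proof (rule ccontr)
  assume ne: "fij x \<noteq> fji x"
  define e where "e = \<bar>fij x - fji x\<bar> / 2"
  have e: "e > 0" using ne by (simp add: e_def)
  have "isCont fij x" "isCont fji x"
    using cont by (simp_all add: continuous_on_eq_continuous_at)
  then obtain d1 d2 where d: "d1 > 0" "d2 > 0"
    "\<And>y. dist y x < d1 \<Longrightarrow> dist (fij y) (fij x) < e" "\<And>y. dist y x < d2 \<Longrightarrow> dist (fji y) (fji x) < e"
    using e unfolding continuous_at_eps_delta by metis
  \<comment> \<open>With this step size all intermediate points are within \<open>min d1 d2\<close>
    of \<open>x\<close>, where \<open>fij\<close> and \<open>fji\<close> differ from their values at
    \<open>x\<close> by less than half the supposed gap. The common second difference forces them to
    share a value there, which is impossible.\<close>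
  define h where "h = min d1 d2 / (norm i + norm j + 1)"
  have pos: "norm i + norm j + 1 > 0" by (smt (verit) norm_ge_zero)
  then have h: "h > 0" using d by (simp add: h_def)
  have close: "dist (x + s *\<^sub>R i + t *\<^sub>R j) x < min d1 d2" if "0 < s" "s < h" "0 < t" "t < h" for s t
  proof -
    have "dist (x + s *\<^sub>R i + t *\<^sub>R j) x \<le> s * norm i + t * norm j"
      using norm_triangle_ineq[of "s *\<^sub>R i" "t *\<^sub>R j"] that by (simp add: dist_norm add.assoc)
    also have "\<dots> \<le> h * norm i + h * norm j"
      using that by (intro add_mono mult_right_mono) auto
    also have "\<dots> < h * (norm i + norm j + 1)" using h by (simp add: algebra_simps)
    also have "\<dots> = min d1 d2" using pos by (simp add: h_def)
    finally show ?thesis .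
  qed
  obtain s t where 1: "0 < s" "s < h" "0 < t" "t < h"
    "f (x + h *\<^sub>R i + h *\<^sub>R j) - f (x + h *\<^sub>R i) - f (x + h *\<^sub>R j) + f x
      = h * h * fij (x + s *\<^sub>R i + t *\<^sub>R j)"
    using double_mean_value[OF assms(1,3) h] by metis
  obtain s' t' where 2: "0 < s'" "s' < h" "0 < t'" "t' < h"
    "f (x + h *\<^sub>R j + h *\<^sub>R i) - f (x + h *\<^sub>R j) - f (x + h *\<^sub>R i) + f x
      = h * h * fji (x + s' *\<^sub>R j + t' *\<^sub>R i)"
    using double_mean_value[OF assms(2,4) h] by metis
  have "x + h *\<^sub>R j + h *\<^sub>R i = x + h *\<^sub>R i + h *\<^sub>R j" "x + s' *\<^sub>R j + t' *\<^sub>R i = x + t' *\<^sub>R i + s' *\<^sub>R j"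
    by (simp_all add: algebra_simps)
  with 1(5) 2(5) have "h * h * fij (x + s *\<^sub>R i + t *\<^sub>R j) = h * h * fji (x + t' *\<^sub>R i + s' *\<^sub>R j)"
    by (simp only:)
  then have "fij (x + s *\<^sub>R i + t *\<^sub>R j) = fji (x + t' *\<^sub>R i + s' *\<^sub>R j)" using h by simp
  moreover have "dist (fij (x + s *\<^sub>R i + t *\<^sub>R j)) (fij x) < e" "dist (fji (x + t' *\<^sub>R i + s' *\<^sub>R j)) (fji x) < e"
    using close 1 2 by (auto intro!: d)
  ultimately show False unfolding dist_real_def e_def by (smt (verit) field_sum_of_halves)
qed

section \<open>Functions of class C2\<close>

text \<open>The derivatives are data: \<open>f2 i j\<close> differentiates along \<open>i\<close>
  first and then along \<open>j\<close>, and only basis directions are constrained. Closure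
  properties can thus be stated with explicit formulas.\<close>

definition C2 :: "('a::euclidean_space \<Rightarrow> real) \<Rightarrow> ('a \<Rightarrow> 'a \<Rightarrow> real) \<Rightarrow> ('a \<Rightarrow> 'a \<Rightarrow> 'a \<Rightarrow> real) \<Rightarrow> bool" where
  "C2 f f1 f2 \<longleftrightarrow> continuous_on UNIV f \<and>
     (\<forall>i\<in>Basis. dd i f (f1 i) \<and> continuous_on UNIV (f1 i) \<and>
       (\<forall>j\<in>Basis. dd j (f1 i) (f2 i j) \<and> continuous_on UNIV (f2 i j)))"

lemma C2D:
  assumes "C2 f f1 f2"
  shows "continuous_on UNIV f"
    and "i \<in> Basis \<Longrightarrow> dd i f (f1 i)" and "i \<in> Basis \<Longrightarrow> continuous_on UNIV (f1 i)"
    and "i \<in> Basis \<Longrightarrow> j \<in> Basis \<Longrightarrow> dd j (f1 i) (f2 i j)"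
    and "i \<in> Basis \<Longrightarrow> j \<in> Basis \<Longrightarrow> continuous_on UNIV (f2 i j)"
  using assms by (auto simp: C2_def)

lemma C2_commute: "C2 f f1 f2 \<Longrightarrow> i \<in> Basis \<Longrightarrow> j \<in> Basis \<Longrightarrow> f2 i j x = f2 j i x"
  by (rule dd_commute[of i f "f1 i" j "f1 j"]) (auto simp: C2D)

lemma C2_const_open:
  assumes "C2 f f1 f2" "open U" "\<And>y. y \<in> U \<Longrightarrow> f y = k" "x \<in> U" "i \<in> Basis"
  shows "f1 i x = 0" "j \<in> Basis \<Longrightarrow> f2 i j x = 0"
proof -
  have 1: "f1 i x = 0" if "x \<in> U" for x
    using dd_const_open[OF C2D(2)[OF assms(1,5)] assms(2,3) that] .
  then show "f1 i x = 0" using assms by simp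
  show "f2 i j x = 0" if "j \<in> Basis"
    using dd_const_open[OF C2D(4)[OF assms(1,5) that] assms(2) 1 assms(4)] .
qed

lemma C2_zero_outside:
  assumes "C2 f f1 f2" "\<And>x. x \<notin> cball c R \<Longrightarrow> f x = 0" "x \<notin> cball c R" "i \<in> Basis"
  shows "f1 i x = 0" "j \<in> Basis \<Longrightarrow> f2 i j x = 0"
proof -
  have U: "open (- cball c R)" "\<And>y. y \<in> - cball c R \<Longrightarrow> f y = 0" "x \<in> - cball c R"
    using assms by auto
  show "f1 i x = 0" "j \<in> Basis \<Longrightarrow> f2 i j x = 0"
    using C2_const_open[OF assms(1) U assms(4)] by blast+
qed

lemma C2_const: "C2 (\<lambda>x. c) (\<lambda>i x. 0) (\<lambda>i j x. 0)"
  by (auto simp: C2_def dd_const)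

lemma C2_add: "C2 f f1 f2 \<Longrightarrow> C2 g g1 g2 \<Longrightarrow>
    C2 (\<lambda>x. f x + g x) (\<lambda>i x. f1 i x + g1 i x) (\<lambda>i j x. f2 i j x + g2 i j x)"
  by (auto simp: C2_def dd_add intro!: continuous_intros)

lemma C2_cmult: "C2 f f1 f2 \<Longrightarrow> C2 (\<lambda>x. c * f x) (\<lambda>i x. c * f1 i x) (\<lambda>i j x. c * f2 i j x)"
  by (auto simp: C2_def dd_cmult intro!: continuous_intros)

lemma C2_mult:
  assumes "C2 f f1 f2" "C2 g g1 g2"
  shows "C2 (\<lambda>x. f x * g x) (\<lambda>i x. f1 i x * g x + f x * g1 i x)
     (\<lambda>i j x. f2 i j x * g x + f1 i x * g1 j x + (f1 j x * g1 i x + f x * g2 i j x))"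
  unfolding C2_def
  using C2D[OF assms(1)] C2D[OF assms(2)]
  by (intro conjI ballI dd_add dd_mult) (auto intro!: continuous_intros)

lemma C2_exp:
  assumes "C2 f f1 f2"
  shows "C2 (\<lambda>x. exp (f x)) (\<lambda>i x. exp (f x) * f1 i x)
     (\<lambda>i j x. exp (f x) * f1 j x * f1 i x + exp (f x) * f2 i j x)"
  unfolding C2_def
  using C2D[OF assms(1)]
  by (intro conjI ballI dd_add dd_mult dd_exp) (auto intro!: continuous_intros)

lemma C2_sqdist: "C2 (\<lambda>x. (x - c) \<bullet> (x - c)) (\<lambda>i x. 2 * ((x - c) \<bullet> i)) (\<lambda>i j x. 2 * (j \<bullet> i))"
proof -
  have "dd i (\<lambda>x. (x - c) \<bullet> (x - c)) (\<lambda>x. 2 * ((x - c) \<bullet> i))" for i :: 'a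
    unfolding dd_def
    by (auto intro!: derivative_eq_intros simp: inner_add_left inner_add_right inner_diff_left inner_diff_right inner_commute)
  then show ?thesis
    by (auto simp: C2_def intro!: continuous_intros dd_cmult dd_inner)
qed

text \<open>The divergence theorem for a compactly supported field with components
  \<open>g i\<close>.\<close>

lemma integral_sum_dd_eq_0:
  fixes g :: "'a::euclidean_space \<Rightarrow> 'a \<Rightarrow> real"
  assumes "\<And>i. i \<in> Basis \<Longrightarrow> dd i (g i) (g' i)" "\<And>i. i \<in> Basis \<Longrightarrow> continuous_on UNIV (g i)"
    "\<And>i. i \<in> Basis \<Longrightarrow> continuous_on UNIV (g' i)"
    and "\<And>i x. i \<in> Basis \<Longrightarrow> x \<notin> cball c R \<Longrightarrow> g i x = 0"
  shows "(LINT x|lborel. (\<Sum>i\<in>Basis. g' i x)) = 0" "integrable lborel (\<lambda>x. \<Sum>i\<in>Basis. g' i x)"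
proof -
  have i: "integrable lborel (g' i)" if "i \<in> Basis" for i
    using assms that by (intro integrable_compact_support dd_zero_outside[of i "g i" "g' i" c R]) auto
  have "(LINT x|lborel. (\<Sum>i\<in>Basis. g' i x)) = (\<Sum>i\<in>Basis. LINT x|lborel. g' i x)"
    using i by (intro Bochner_Integration.integral_sum) auto
  also have "\<dots> = 0"
    using integral_dd_eq_0[OF assms(1,2,3,4)] by (intro sum.neutral ballI) auto
  finally show "(LINT x|lborel. (\<Sum>i\<in>Basis. g' i x)) = 0" .
  show "integrable lborel (\<lambda>x. \<Sum>i\<in>Basis. g' i x)"
    using i by (intro Bochner_Integration.integrable_sum) auto
qed

section \<open>Integrated identity for the conjugated Laplacian\<close>

text \<open>For \<open>f = exp (\<tau> * \<phi>) * w\<close> the conjugated Laplacian splits into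
  the symmetric part \<open>L + \<tau>\<^sup>2 * m * f\<close> and the antisymmetric part
  \<open>- \<tau> * (2 * N + L\<phi> * f)\<close>. The cross term of their square is computed here
  with \<open>q\<close> in place of \<open>L\<phi>\<close>. This freedom adds a multiple of
  \<open>q - L\<phi>\<close> to the gradient term and later repairs the lack of convexity of the
  weight.\<close>

lemma carleman_identity:
  fixes f \<phi> q :: "'a::euclidean_space \<Rightarrow> real" and \<tau> :: real
  assumes f: "C2 f f1 f2" and \<phi>: "C2 \<phi> \<phi>1 \<phi>2" and q: "C2 q q1 q2"
    and supp: "\<And>x. x \<notin> cball c R \<Longrightarrow> f x = 0"
  defines "m \<equiv> \<lambda>x. \<Sum>i\<in>Basis. (\<phi>1 i x)\<^sup>2"
    and "L \<equiv> \<lambda>x. \<Sum>i\<in>Basis. f2 i i x"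
    and "L\<phi> \<equiv> \<lambda>x. \<Sum>i\<in>Basis. \<phi>2 i i x"
    and "Lq \<equiv> \<lambda>x. \<Sum>i\<in>Basis. q2 i i x"
    and "N \<equiv> \<lambda>x. \<Sum>i\<in>Basis. \<phi>1 i x * f1 i x"
    and "G \<equiv> \<lambda>x. \<Sum>i\<in>Basis. (f1 i x)\<^sup>2"
    and "H \<equiv> \<lambda>x. \<Sum>i\<in>Basis. \<Sum>j\<in>Basis. \<phi>2 i j x * f1 i x * f1 j x"
    and "K \<equiv> \<lambda>x. \<Sum>i\<in>Basis. \<Sum>j\<in>Basis. \<phi>2 i j x * \<phi>1 i x * \<phi>1 j x"
  shows "(LINT x|lborel. 2 * (L x + \<tau>\<^sup>2 * m x * f x) * (- \<tau> * (2 * N x + q x * f x))) =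
    (LINT x|lborel. \<tau> * (4 * H x + 2 * (q x - L\<phi> x) * G x)
       + (\<tau> ^ 3 * (4 * K x - 2 * (q x - L\<phi> x) * m x) - \<tau> * Lq x) * (f x)\<^sup>2)"
proof -
  note fD = C2D[OF f] and \<phi>D = C2D[OF \<phi>] and qD = C2D[OF q]
  note f0 = C2_zero_outside[OF f supp]
  note [continuous_intros] = fD(1,3,5) \<phi>D(1,3,5) qD(1,3,5)
  \<comment> \<open>Three integrations by parts in one field: the first two terms handle
    \<open>L * N\<close>, the next two handle \<open>q * f * L\<close>, and the last one handles
    \<open>m * f * N\<close>. \<open>V' i\<close> is the derivative of \<open>V i\<close> along
    \<open>i\<close>.\<close>
  define V where "V = (\<lambda>i x. -4 * \<tau> * (f1 i x * N x) + 2 * \<tau> * (\<phi>1 i x * G x)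
     - 2 * \<tau> * (q x * (f x * f1 i x)) + \<tau> * (q1 i x * (f x * f x)) - 2 * \<tau> ^ 3 * ((m x * \<phi>1 i x) * (f x * f x)))"
  define V' where "V' = (\<lambda>i x. -4 * \<tau> * (f2 i i x * N x + f1 i x * (\<Sum>j\<in>Basis. \<phi>2 j i x * f1 j x + \<phi>1 j x * f2 j i x))
     + 2 * \<tau> * (\<phi>2 i i x * G x + \<phi>1 i x * (\<Sum>j\<in>Basis. f2 j i x * f1 j x + f1 j x * f2 j i x))
     - 2 * \<tau> * (q1 i x * (f x * f1 i x) + q x * (f1 i x * f1 i x + f x * f2 i i x))
     + \<tau> * (q2 i i x * (f x * f x) + q1 i x * (f1 i x * f x + f x * f1 i x))
     - 2 * \<tau> ^ 3 * (((\<Sum>j\<in>Basis. \<phi>2 j i x * \<phi>1 j x + \<phi>1 j x * \<phi>2 j i x) * \<phi>1 i x + m x * \<phi>2 i i x) * (f x * f x)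
         + (m x * \<phi>1 i x) * (f1 i x * f x + f x * f1 i x)))"
  have dd: "dd i (V i) (V' i)" if "i \<in> Basis" for i
    unfolding V_def V'_def N_def G_def m_def power2_eq_square
    using that by (intro dd_add dd_diff dd_cmult dd_mult dd_sum fD \<phi>D qD)
  have cV: "continuous_on UNIV (V i)" "continuous_on UNIV (V' i)" if "i \<in> Basis" for i
    unfolding V_def V'_def N_def G_def m_def
    using that by (auto intro!: continuous_intros)
  have sV: "V i x = 0" if "i \<in> Basis" "x \<notin> cball c R" for i x
    using that f0(1) supp by (auto simp: V_def N_def G_def)
  have fsym: "f2 i j x = f2 j i x" if "i \<in> Basis" "j \<in> Basis" for i j x
    using C2_commute[OF f that] .
  have point: "2 * (L x + \<tau>\<^sup>2 * m x * f x) * (- \<tau> * (2 * N x + q x * f x)) =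
     (\<tau> * (4 * H x + 2 * (q x - L\<phi> x) * G x)
       + (\<tau> ^ 3 * (4 * K x - 2 * (q x - L\<phi> x) * m x) - \<tau> * Lq x) * (f x)\<^sup>2) + (\<Sum>i\<in>Basis. V' i x)" for x
  proof -
    \<comment> \<open>\<open>Q\<close> and \<open>T\<close> have no counterpart in the claim and
      must cancel. \<open>Q\<close>, the second derivatives of \<open>f\<close> contracted with both
      gradients, appears with the coefficients \<open>- 4 * \<tau>\<close> and
      \<open>4 * \<tau>\<close>; \<open>T\<close> cancels in the same way.\<close>
    define Q where "Q = (\<Sum>i\<in>Basis. \<Sum>j\<in>Basis. f1 i x * \<phi>1 j x * f2 j i x)"
    define T where "T = (\<Sum>i\<in>Basis. q1 i x * f1 i x)"
    have a: "(\<Sum>i\<in>Basis. f2 i i x * N x + f1 i x * (\<Sum>j\<in>Basis. \<phi>2 j i x * f1 j x + \<phi>1 j x * f2 j i x)) = L x * N x + H x + Q"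
    proof -
      have "(\<Sum>i\<in>Basis. \<Sum>j\<in>Basis. f1 i x * \<phi>2 j i x * f1 j x) = H x"
        unfolding H_def by (subst sum.swap) (simp add: ac_simps)
      then show ?thesis
        by (simp add: L_def Q_def sum.distrib sum_distrib_left sum_distrib_right distrib_left mult.assoc)
    qed
    have b: "(\<Sum>i\<in>Basis. \<phi>2 i i x * G x + \<phi>1 i x * (\<Sum>j\<in>Basis. f2 j i x * f1 j x + f1 j x * f2 j i x)) = L\<phi> x * G x + 2 * Q"
    proof -
      have "(\<Sum>i\<in>Basis. \<Sum>j\<in>Basis. \<phi>1 i x * (f1 j x * f2 j i x)) = Q"
        unfolding Q_def by (subst sum.swap) (auto intro!: sum.cong simp: fsym ac_simps)
      then show ?thesis
        by (simp add: L\<phi>_def sum.distrib sum_distrib_left[symmetric] sum_distrib_right distrib_left ac_simps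
            mult_2[symmetric])
    qed
    have c: "(\<Sum>i\<in>Basis. q1 i x * (f x * f1 i x) + q x * (f1 i x * f1 i x + f x * f2 i i x)) = f x * T + q x * G x + q x * f x * L x"
      by (simp add: T_def G_def L_def sum.distrib sum_distrib_left sum_distrib_right distrib_left ac_simps power2_eq_square)
    have d: "(\<Sum>i\<in>Basis. q2 i i x * (f x * f x) + q1 i x * (f1 i x * f x + f x * f1 i x)) = Lq x * (f x)\<^sup>2 + 2 * f x * T"
      by (simp add: T_def Lq_def sum.distrib sum_distrib_left sum_distrib_right distrib_left ac_simps power2_eq_square)
    have e: "(\<Sum>i\<in>Basis. ((\<Sum>j\<in>Basis. \<phi>2 j i x * \<phi>1 j x + \<phi>1 j x * \<phi>2 j i x) * \<phi>1 i x + m x * \<phi>2 i i x) * (f x * f x)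
         + (m x * \<phi>1 i x) * (f1 i x * f x + f x * f1 i x)) = (2 * K x + m x * L\<phi> x) * (f x)\<^sup>2 + 2 * m x * f x * N x"
    proof -
      have "(\<Sum>i\<in>Basis. (\<Sum>j\<in>Basis. \<phi>2 j i x * \<phi>1 j x + \<phi>1 j x * \<phi>2 j i x) * \<phi>1 i x) = 2 * K x"
        unfolding K_def sum_distrib_right sum_distrib_left by (subst sum.swap) (simp add: ac_simps)
      moreover have "(\<Sum>i\<in>Basis. ((\<Sum>j\<in>Basis. \<phi>2 j i x * \<phi>1 j x + \<phi>1 j x * \<phi>2 j i x) * \<phi>1 i x + m x * \<phi>2 i i x) * (f x * f x)
         + (m x * \<phi>1 i x) * (f1 i x * f x + f x * f1 i x)) =
         ((\<Sum>i\<in>Basis. (\<Sum>j\<in>Basis. \<phi>2 j i x * \<phi>1 j x + \<phi>1 j x * \<phi>2 j i x) * \<phi>1 i x) + m x * L\<phi> x) * (f x)\<^sup>2 + 2 * m x * f x * N x"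
        unfolding N_def L\<phi>_def distrib_right sum.distrib
        by (simp add: sum_distrib_left sum_distrib_right sum.distrib[symmetric] power2_eq_square algebra_simps)
      ultimately show ?thesis by simp
    qed
    have "(\<Sum>i\<in>Basis. V' i x) = -4 * \<tau> * (L x * N x + H x + Q) + 2 * \<tau> * (L\<phi> x * G x + 2 * Q)
       - 2 * \<tau> * (f x * T + q x * G x + q x * f x * L x) + \<tau> * (Lq x * (f x)\<^sup>2 + 2 * f x * T)
       - 2 * \<tau> ^ 3 * ((2 * K x + m x * L\<phi> x) * (f x)\<^sup>2 + 2 * m x * f x * N x)"
      unfolding a[symmetric] b[symmetric] c[symmetric] d[symmetric] e[symmetric]
      unfolding V'_def sum.distrib sum_subtractf sum_distrib_left[symmetric] by simp
    then show ?thesis by (simp add: algebra_simps power2_eq_square power3_eq_cube)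
  qed
  have ci: "integrable lborel (\<lambda>x. \<tau> * (4 * H x + 2 * (q x - L\<phi> x) * G x)
       + (\<tau> ^ 3 * (4 * K x - 2 * (q x - L\<phi> x) * m x) - \<tau> * Lq x) * (f x)\<^sup>2)"
  proof (rule integrable_compact_support[where c=c and R=R])
    show "continuous_on UNIV (\<lambda>x. \<tau> * (4 * H x + 2 * (q x - L\<phi> x) * G x)
       + (\<tau> ^ 3 * (4 * K x - 2 * (q x - L\<phi> x) * m x) - \<tau> * Lq x) * (f x)\<^sup>2)"
      unfolding H_def L\<phi>_def G_def K_def m_def Lq_def by (auto intro!: continuous_intros)
  qed (use f0 supp in \<open>auto simp: H_def G_def\<close>)
  show ?thesis
    unfolding point
    using Bochner_Integration.integral_add[OF ci integral_sum_dd_eq_0(2)[of V V' c R, OF dd cV sV]]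
      integral_sum_dd_eq_0(1)[of V V' c R, OF dd cV sV] by simp
qed

section \<open>A Carleman estimate\<close>

definition gauss :: "real \<Rightarrow> 'a::euclidean_space \<Rightarrow> 'a \<Rightarrow> real" where
  "gauss l c x = exp (- l * ((x - c) \<bullet> (x - c)))"

lemma C2_cong:
  assumes "C2 f f1 f2" "\<And>x. f x = g x" "\<And>i x. f1 i x = g1 i x" "\<And>i j x. f2 i j x = g2 i j x"
  shows "C2 g g1 g2"
proof -
  have "f = g" "f1 = g1" "f2 = g2" using assms by (auto simp: fun_eq_iff)
  with assms(1) show ?thesis by simp
qed

lemma C2_gauss:
  "C2 (gauss l c) (\<lambda>i x. - 2 * l * ((x - c) \<bullet> i) * gauss l c x)
     (\<lambda>i j x. (4 * l\<^sup>2 * ((x - c) \<bullet> i) * ((x - c) \<bullet> j) - 2 * l * (i \<bullet> j)) * gauss l c x)"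
proof -
  have "C2 (gauss l c) (\<lambda>i x. gauss l c x * (- l * (2 * ((x - c) \<bullet> i))))
    (\<lambda>i j x. gauss l c x * (- l * (2 * ((x - c) \<bullet> j))) * (- l * (2 * ((x - c) \<bullet> i)))
       + gauss l c x * (- l * (2 * (j \<bullet> i))))"
    using C2_exp[OF C2_cmult[OF C2_sqdist[of c], of "- l"]] unfolding gauss_def[abs_def] .
  then show ?thesis
    by (rule C2_cong) (simp_all add: algebra_simps power2_eq_square inner_commute)
qed

lemma sum_Basis_inner_mult:
  fixes g :: "'a::euclidean_space \<Rightarrow> real"
  shows "i \<in> Basis \<Longrightarrow> (\<Sum>j\<in>Basis. (i \<bullet> j) * g j) = g i"
  by (subst sum.remove[of _ i]) (auto simp: inner_Basis intro!: sum.neutral split: if_splits)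

lemma gauss_hessian:
  fixes a :: "'a::euclidean_space \<Rightarrow> real"
  shows "(\<Sum>i\<in>Basis. \<Sum>j\<in>Basis. ((4 * l\<^sup>2 * ((x - c) \<bullet> i) * ((x - c) \<bullet> j) - 2 * l * (i \<bullet> j)) * gauss l c x) * a i * a j)
    = 4 * l\<^sup>2 * gauss l c x * (\<Sum>i\<in>Basis. ((x - c) \<bullet> i) * a i)\<^sup>2 - 2 * l * gauss l c x * (\<Sum>i\<in>Basis. (a i)\<^sup>2)"
proof -
  have "(\<Sum>i\<in>Basis. \<Sum>j\<in>Basis. ((4 * l\<^sup>2 * ((x - c) \<bullet> i) * ((x - c) \<bullet> j) - 2 * l * (i \<bullet> j)) * gauss l c x) * a i * a j)
    = (\<Sum>i\<in>Basis. 4 * l\<^sup>2 * gauss l c x * (((x - c) \<bullet> i) * a i) * (\<Sum>j\<in>Basis. ((x - c) \<bullet> j) * a j)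
         - 2 * l * gauss l c x * a i * (\<Sum>j\<in>Basis. (i \<bullet> j) * a j))"
    by (intro sum.cong refl) (simp add: sum_distrib_left sum_subtractf[symmetric] algebra_simps)
  also have "\<dots> = (\<Sum>i\<in>Basis. 4 * l\<^sup>2 * gauss l c x * (((x - c) \<bullet> i) * a i) * (\<Sum>j\<in>Basis. ((x - c) \<bullet> j) * a j)
         - 2 * l * gauss l c x * (a i)\<^sup>2)"
    by (intro sum.cong refl) (simp add: sum_Basis_inner_mult power2_eq_square)
  also have "\<dots> = 4 * l\<^sup>2 * gauss l c x * (\<Sum>i\<in>Basis. ((x - c) \<bullet> i) * a i)\<^sup>2 - 2 * l * gauss l c x * (\<Sum>i\<in>Basis. (a i)\<^sup>2)"
    by (simp add: sum_subtractf sum_distrib_left sum_distrib_right power2_eq_square ac_simps)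
  finally show ?thesis .
qed

text \<open>The weight is not convex: its Hessian is \<open>- 2 l gauss\<close> in the tangential directions. Adding
  \<open>4 l gauss\<close> to the zeroth-order term of the antisymmetric part of the conjugated Laplacian
  compensates exactly for this.\<close>

theorem carleman_estimate:
  fixes c :: "'a::euclidean_space" and \<rho> R :: real
  assumes \<rho>: "0 < \<rho>" and R: "\<rho> \<le> R"
  obtains d \<tau>0 where "d > 0" "\<tau>0 \<ge> 1"
    "\<And>\<tau> w w1 w2. \<tau> \<ge> \<tau>0 \<Longrightarrow> C2 w w1 w2 \<Longrightarrow> (\<And>x. x \<notin> cball c R \<Longrightarrow> w x = 0) \<Longrightarrow>
       (\<And>x. x \<in> ball c \<rho> \<Longrightarrow> w x = 0) \<Longrightarrow>
       d * \<tau> ^ 3 * (LINT x|lborel. exp (2 * \<tau> * gauss (2 / \<rho>\<^sup>2) c x) * (w x)\<^sup>2)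
         \<le> (LINT x|lborel. exp (2 * \<tau> * gauss (2 / \<rho>\<^sup>2) c x) * (\<Sum>i\<in>Basis. w2 i i x)\<^sup>2)"
proof -
  \<comment> \<open>This choice makes \<open>l * s x \<ge> 2\<close> outside
    \<open>ball c \<rho>\<close>, so that the factor \<open>l * s x - 1\<close> of the cubic
    coefficient \<open>D\<close> is at least 1 wherever \<open>w\<close> can be nonzero.\<close>
  define l where "l = 2 / \<rho>\<^sup>2"
  define s where "s x = (x - c) \<bullet> (x - c)" for x
  define \<phi> where "\<phi> = gauss l c"
  define n where "n = real DIM('a)"
  have l: "l > 0" using \<rho> by (simp add: l_def)
  have \<phi>pos: "\<phi> x > 0" for x by (simp add: \<phi>_def gauss_def)
  have \<phi>le: "\<phi> x \<le> 1" for x using l by (simp add: \<phi>_def gauss_def)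
  define \<phi>1 where "\<phi>1 = (\<lambda>i x. - 2 * l * ((x - c) \<bullet> i) * \<phi> x)"
  define \<phi>2 where "\<phi>2 = (\<lambda>i j x. (4 * l\<^sup>2 * ((x - c) \<bullet> i) * ((x - c) \<bullet> j) - 2 * l * (i \<bullet> j)) * \<phi> x)"
  have \<phi>C2: "C2 \<phi> \<phi>1 \<phi>2" unfolding \<phi>_def \<phi>1_def \<phi>2_def by (rule C2_gauss)
  \<comment> \<open>The bracket without its last summand belongs to the Laplacian of
    \<open>\<phi>\<close>, with \<open>n\<close> the dimension.\<close>
  define q where "q x = (4 * l\<^sup>2 * s x - 2 * l * n + 4 * l) * \<phi> x" for x
  have "\<exists>q1 q2. C2 q q1 q2"
    using C2_mult[OF C2_add[OF C2_cmult[OF C2_sqdist[of c], of "4 * l\<^sup>2"] C2_const[of "- 2 * l * n + 4 * l"]] \<phi>C2]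
    unfolding q_def[abs_def] s_def by (auto simp: algebra_simps)
  then obtain q1 q2 where qC2: "C2 q q1 q2" by blast
  define Lq where "Lq x = (\<Sum>i\<in>Basis. q2 i i x)" for x
  have cLq: "continuous_on UNIV Lq"
    unfolding Lq_def by (intro continuous_on_sum C2D(5)[OF qC2])
  then have "compact (Lq ` cball c R)"
    by (intro compact_continuous_image) (auto intro: continuous_on_subset)
  then obtain B where B: "\<And>x. x \<in> cball c R \<Longrightarrow> \<bar>Lq x\<bar> \<le> B"
    by (meson compact_imp_bounded bounded_real imageI)
  have "c \<in> cball c R" using \<rho> R by simp
  from B[OF this] have B0: "B \<ge> 0" by linarith
  \<comment> \<open>A lower bound of \<open>D\<close> on the shell between \<open>\<rho>\<close> and
    \<open>R\<close>: there \<open>s x \<ge> \<rho>\<^sup>2\<close>,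
    \<open>l * s x - 1 \<ge> 1\<close>, and the weight is at least its value at radius
    \<open>R\<close>.\<close>
  define d where "d = 64 * l ^ 3 * \<rho>\<^sup>2 * (exp (- l * R\<^sup>2)) ^ 3"
  have d: "d > 0" using l \<rho> by (simp add: d_def)
  \<comment> \<open>Large enough for the errors of order at most \<open>\<tau>\<^sup>2\<close>,
    namely \<open>B\<close> from the Laplacian of \<open>q\<close> and \<open>16 * l\<^sup>2\<close>
    from putting \<open>q\<close> in place of the Laplacian of \<open>\<phi>\<close>, to consume at
    most half of \<open>d * \<tau> ^ 3\<close>.\<close>
  define \<tau>0 where "\<tau>0 = max 1 (2 * (B + 16 * l\<^sup>2) / d)"
  have main: "d / 2 * \<tau> ^ 3 * (LINT x|lborel. exp (2 * \<tau> * \<phi> x) * (w x)\<^sup>2)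
         \<le> (LINT x|lborel. exp (2 * \<tau> * \<phi> x) * (\<Sum>i\<in>Basis. w2 i i x)\<^sup>2)"
    if \<tau>: "\<tau> \<ge> \<tau>0" and w: "C2 w w1 w2" and supp: "\<And>x. x \<notin> cball c R \<Longrightarrow> w x = 0"
      and supp': "\<And>x. x \<in> ball c \<rho> \<Longrightarrow> w x = 0" for \<tau> w w1 w2
  proof -
    have \<tau>1: "\<tau> \<ge> 1" and \<tau>2: "\<tau> \<ge> 2 * (B + 16 * l\<^sup>2) / d" using \<tau> by (auto simp: \<tau>0_def)
    define E where "E x = exp (\<tau> * \<phi> x)" for x
    define f where "f x = E x * w x" for x
    define f1 where "f1 i x = E x * (\<tau> * \<phi>1 i x) * w x + E x * w1 i x" for i x
    define f2 where "f2 i j x = (E x * (\<tau> * \<phi>1 j x) * (\<tau> * \<phi>1 i x) + E x * (\<tau> * \<phi>2 i j x)) * w x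
      + E x * (\<tau> * \<phi>1 i x) * w1 j x + (E x * (\<tau> * \<phi>1 j x) * w1 i x + E x * w2 i j x)" for i j x
    have f: "C2 f f1 f2"
      using C2_mult[OF C2_exp[OF C2_cmult[OF \<phi>C2, of \<tau>]] w]
      unfolding f_def[abs_def] f1_def[abs_def] f2_def[abs_def] E_def .
    have fsupp: "f x = 0" if "x \<notin> cball c R" for x using supp[OF that] by (simp add: f_def)
    note [continuous_intros] = C2D(1,3,5)[OF f] C2D(1,3,5)[OF \<phi>C2] C2D(1,3,5)[OF qC2] C2D(1,3,5)[OF w]
    have f0: "f1 i x = 0" "j \<in> Basis \<Longrightarrow> f2 i j x = 0" if "x \<notin> cball c R" "i \<in> Basis" for i j x
      using C2_zero_outside[OF f, of c R] fsupp that by blast+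
    have w0: "w1 i x = 0" "j \<in> Basis \<Longrightarrow> w2 i j x = 0" if "x \<notin> cball c R" "i \<in> Basis" for i j x
      using C2_zero_outside[OF w, of c R] supp that by blast+
    define m where "m x = (\<Sum>i\<in>Basis. (\<phi>1 i x)\<^sup>2)" for x
    define L where "L x = (\<Sum>i\<in>Basis. f2 i i x)" for x
    define L\<phi> where "L\<phi> x = (\<Sum>i\<in>Basis. \<phi>2 i i x)" for x
    define N where "N x = (\<Sum>i\<in>Basis. \<phi>1 i x * f1 i x)" for x
    define G where "G x = (\<Sum>i\<in>Basis. (f1 i x)\<^sup>2)" for x
    define H where "H x = (\<Sum>i\<in>Basis. \<Sum>j\<in>Basis. \<phi>2 i j x * f1 i x * f1 j x)" for x
    define K where "K x = (\<Sum>i\<in>Basis. \<Sum>j\<in>Basis. \<phi>2 i j x * \<phi>1 i x * \<phi>1 j x)" for x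
    define D where "D x = 64 * l ^ 3 * s x * (l * s x - 1) * (\<phi> x) ^ 3" for x
    define lap where "lap x = (\<Sum>i\<in>Basis. w2 i i x)" for x
    note defs = m_def L_def L\<phi>_def N_def G_def H_def K_def
    have cont [continuous_intros]: "continuous_on UNIV m" "continuous_on UNIV L" "continuous_on UNIV L\<phi>" "continuous_on UNIV N"
      "continuous_on UNIV G" "continuous_on UNIV H" "continuous_on UNIV K" "continuous_on UNIV lap" "continuous_on UNIV E" "continuous_on UNIV s"
      unfolding defs lap_def E_def s_def by (auto intro!: continuous_intros)
    have ssum: "(\<Sum>i\<in>Basis. ((x - c) \<bullet> i)\<^sup>2) = s x" for x
      unfolding s_def euclidean_inner[of "x - c" "x - c"] by (simp add: power2_eq_square)
    have m_eq: "m x = 4 * l\<^sup>2 * s x * (\<phi> x)\<^sup>2" for x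
      unfolding m_def \<phi>1_def ssum[symmetric] by (simp add: sum_distrib_left sum_distrib_right power_mult_distrib ac_simps)
    have L\<phi>_eq: "L\<phi> x = (4 * l\<^sup>2 * s x - 2 * l * n) * \<phi> x" for x
    proof -
      have "L\<phi> x = (\<Sum>i\<in>Basis. (4 * l\<^sup>2 * ((x - c) \<bullet> i)\<^sup>2 - 2 * l) * \<phi> x)"
        unfolding L\<phi>_def \<phi>2_def by (intro sum.cong) (auto simp: power2_eq_square)
      then show ?thesis unfolding n_def ssum[symmetric]
        by (simp add: sum_distrib_left sum_distrib_right sum_subtractf algebra_simps)
    qed
    have q_eq: "q x - L\<phi> x = 4 * l * \<phi> x" for x
      unfolding q_def L\<phi>_eq by (simp add: algebra_simps)
    have H_ge: "4 * H x + 2 * (q x - L\<phi> x) * G x \<ge> 0" for x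
    proof -
      have "H x = 4 * l\<^sup>2 * \<phi> x * (\<Sum>i\<in>Basis. ((x - c) \<bullet> i) * f1 i x)\<^sup>2 - 2 * l * \<phi> x * G x"
        unfolding H_def \<phi>2_def G_def \<phi>_def by (rule gauss_hessian)
      then have "4 * H x + 2 * (q x - L\<phi> x) * G x = 16 * l\<^sup>2 * \<phi> x * (\<Sum>i\<in>Basis. ((x - c) \<bullet> i) * f1 i x)\<^sup>2"
        unfolding q_eq by (simp add: algebra_simps)
      also have "\<dots> \<ge> 0" using \<phi>pos[of x] by simp
      finally show ?thesis .
    qed
    have K_eq: "4 * K x - 2 * (q x - L\<phi> x) * m x = D x" for x
    proof -
      have "(\<Sum>i\<in>Basis. ((x - c) \<bullet> i) * \<phi>1 i x) = - 2 * l * s x * \<phi> x"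
        unfolding \<phi>1_def ssum[symmetric] by (simp add: sum_distrib_left sum_distrib_right power2_eq_square ac_simps)
      moreover have "K x = 4 * l\<^sup>2 * \<phi> x * (\<Sum>i\<in>Basis. ((x - c) \<bullet> i) * \<phi>1 i x)\<^sup>2 - 2 * l * \<phi> x * m x"
        unfolding K_def m_def unfolding \<phi>2_def \<phi>_def by (rule gauss_hessian)
      ultimately have "K x = 4 * l\<^sup>2 * \<phi> x * (- 2 * l * s x * \<phi> x)\<^sup>2 - 2 * l * \<phi> x * m x" by simp
      then show ?thesis unfolding q_eq m_eq D_def
        by (simp add: algebra_simps power2_eq_square power3_eq_cube)
    qed
    have lap_eq: "E x * lap x = (L x + \<tau>\<^sup>2 * m x * f x) + (- 2 * \<tau> * N x - \<tau> * L\<phi> x * f x)" for x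
    proof -
      have "E x * w2 i i x = f2 i i x - 2 * \<tau> * (\<phi>1 i x * f1 i x) + (\<tau>\<^sup>2 * (\<phi>1 i x)\<^sup>2 - \<tau> * \<phi>2 i i x) * f x" for i
        unfolding f2_def f1_def f_def by (simp add: algebra_simps power2_eq_square)
      then have "E x * lap x = (\<Sum>i\<in>Basis. f2 i i x - 2 * \<tau> * (\<phi>1 i x * f1 i x) + (\<tau>\<^sup>2 * (\<phi>1 i x)\<^sup>2 - \<tau> * \<phi>2 i i x) * f x)"
        unfolding lap_def sum_distrib_left by simp
      also have "\<dots> = (L x + \<tau>\<^sup>2 * m x * f x) + (- 2 * \<tau> * N x - \<tau> * L\<phi> x * f x)"
        by (simp add: defs sum.distrib sum_subtractf sum_distrib_left sum_distrib_right left_diff_distrib sum_negf)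
      finally show ?thesis .
    qed
    have E2: "exp (2 * \<tau> * \<phi> x) = (E x)\<^sup>2" for x
      unfolding E_def by (simp add: exp_double[symmetric] mult.assoc)
    \<comment> \<open>\<open>A\<close> is the true antisymmetric part and \<open>C\<close> the
      surplus due to \<open>q\<close>, so the identity controls \<open>2 * S * (A - C)\<close>. The
      square \<open>(S + A)\<^sup>2\<close> exceeds \<open>2 * S * (A - C) - C\<^sup>2\<close> by
      \<open>A\<^sup>2 + (S + C)\<^sup>2\<close>, hence the surplus costs only
      \<open>C\<^sup>2\<close>, one power of \<open>\<tau>\<close> below the gain.\<close>
    have low: "2 * (L x + \<tau>\<^sup>2 * m x * f x) * (- \<tau> * (2 * N x + q x * f x)) - 16 * l\<^sup>2 * \<tau>\<^sup>2 * (f x)\<^sup>2 \<le> (E x)\<^sup>2 * (lap x)\<^sup>2" for x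
    proof -
      define S where "S = L x + \<tau>\<^sup>2 * m x * f x"
      define A where "A = - 2 * \<tau> * N x - \<tau> * L\<phi> x * f x"
      define C where "C = \<tau> * (4 * l * \<phi> x) * f x"
      have "- \<tau> * (2 * N x + q x * f x) = A - C"
        using q_eq[of x] unfolding A_def C_def by (simp add: algebra_simps)
      moreover have "2 * S * (A - C) - C\<^sup>2 \<le> (S + A)\<^sup>2"
      proof -
        have "(S + A)\<^sup>2 - (2 * S * (A - C) - C\<^sup>2) = A\<^sup>2 + (S + C)\<^sup>2" by (simp add: power2_eq_square algebra_simps)
        also have "\<dots> \<ge> 0" by simp
        finally show ?thesis by simp
      qed
      moreover have "C\<^sup>2 \<le> 16 * l\<^sup>2 * \<tau>\<^sup>2 * (f x)\<^sup>2"
      proof -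
        have "(\<phi> x)\<^sup>2 \<le> 1" using \<phi>pos[of x] \<phi>le[of x] by (simp add: power_le_one)
        then have "(16 * l\<^sup>2 * \<tau>\<^sup>2 * (f x)\<^sup>2) * (\<phi> x)\<^sup>2 \<le> (16 * l\<^sup>2 * \<tau>\<^sup>2 * (f x)\<^sup>2) * 1"
          by (intro mult_left_mono) auto
        then show ?thesis unfolding C_def by (simp add: power_mult_distrib ac_simps)
      qed
      moreover have "(E x)\<^sup>2 * (lap x)\<^sup>2 = (S + A)\<^sup>2"
        using lap_eq[of x] unfolding S_def A_def by (metis power_mult_distrib)
      ultimately show ?thesis unfolding S_def by simp
    qed
    have up: "d / 2 * \<tau> ^ 3 * (f x)\<^sup>2 \<le> (\<tau> * (4 * H x + 2 * (q x - L\<phi> x) * G x)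
       + (\<tau> ^ 3 * (4 * K x - 2 * (q x - L\<phi> x) * m x) - \<tau> * Lq x) * (f x)\<^sup>2) - 16 * l\<^sup>2 * \<tau>\<^sup>2 * (f x)\<^sup>2" for x
    proof -
      have "d / 2 * \<tau> ^ 3 * (f x)\<^sup>2 \<le> (\<tau> ^ 3 * D x - \<tau> * Lq x - 16 * l\<^sup>2 * \<tau>\<^sup>2) * (f x)\<^sup>2"
      proof (cases "f x = 0")
        case False
        then have x: "x \<in> cball c R" "x \<notin> ball c \<rho>" using fsupp supp' by (auto simp: f_def)
        have sx: "s x = (dist c x)\<^sup>2" unfolding s_def by (metis dist_norm dist_commute power2_norm_eq_inner)
        have s1: "\<rho>\<^sup>2 \<le> s x" "s x \<le> R\<^sup>2"
          unfolding sx using x \<rho> by (auto intro!: power_mono)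
        have ls: "l * s x \<ge> 2"
        proof -
          have "2 = l * \<rho>\<^sup>2" using \<rho> by (simp add: l_def)
          also have "\<dots> \<le> l * s x" using s1 l by simp
          finally show ?thesis .
        qed
        have "exp (- l * R\<^sup>2) \<le> \<phi> x" using s1 l by (simp add: \<phi>_def gauss_def s_def)
        then have e3: "(exp (- l * R\<^sup>2)) ^ 3 \<le> (\<phi> x) ^ 3" by (intro power_mono) auto
        have "0 \<le> s x" by (simp add: s_def)
        have "\<rho>\<^sup>2 * 1 \<le> s x * (l * s x - 1)" using s1 ls \<rho> by (intro mult_mono) (auto simp: s_def)
        from this e3 have "(\<rho>\<^sup>2 * 1) * (exp (- l * R\<^sup>2)) ^ 3 \<le> (s x * (l * s x - 1)) * (\<phi> x) ^ 3"
          by (rule mult_mono) (use \<open>0 \<le> s x\<close> ls in auto)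
        then have "64 * l ^ 3 * ((\<rho>\<^sup>2 * 1) * (exp (- l * R\<^sup>2)) ^ 3) \<le> 64 * l ^ 3 * ((s x * (l * s x - 1)) * (\<phi> x) ^ 3)"
          using l by (intro mult_left_mono) auto
        then have "d \<le> D x" unfolding d_def D_def by (simp add: mult.assoc)
        then have "\<tau> ^ 3 * d \<le> \<tau> ^ 3 * D x" using \<tau>1 by (intro mult_left_mono) auto
        moreover have "\<tau> * Lq x + 16 * l\<^sup>2 * \<tau>\<^sup>2 \<le> \<tau> ^ 3 * d / 2"
        proof -
          have "\<tau> * Lq x \<le> \<tau> * B" using B[OF x(1)] \<tau>1 by (intro mult_left_mono) auto
          also have "\<dots> \<le> \<tau>\<^sup>2 * B" using \<tau>1 B0 by (intro mult_right_mono) (auto simp: power2_eq_square)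
          finally have "\<tau> * Lq x + 16 * l\<^sup>2 * \<tau>\<^sup>2 \<le> \<tau>\<^sup>2 * (B + 16 * l\<^sup>2)" by (simp add: algebra_simps)
          also have "\<dots> \<le> \<tau>\<^sup>2 * (\<tau> * d / 2)"
            using \<tau>2 d by (intro mult_left_mono) (auto simp: field_simps)
          finally show ?thesis by (simp add: power2_eq_square power3_eq_cube ac_simps)
        qed
        ultimately have "d / 2 * \<tau> ^ 3 \<le> \<tau> ^ 3 * D x - \<tau> * Lq x - 16 * l\<^sup>2 * \<tau>\<^sup>2"
          by (simp add: algebra_simps)
        then show ?thesis by (intro mult_right_mono) auto
      qed simp
      moreover have "\<tau> * (4 * H x + 2 * (q x - L\<phi> x) * G x) \<ge> 0" using H_ge[of x] \<tau>1 by simp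
      ultimately show ?thesis unfolding K_eq by (simp add: algebra_simps)
    qed
    have out: "G x = 0" "H x = 0" "L x = 0" "lap x = 0" if "x \<notin> cball c R" for x
      using f0[OF that] w0[OF that] by (auto simp: G_def H_def L_def lap_def intro!: sum.neutral)
    let ?T = "\<lambda>x. \<tau> * (4 * H x + 2 * (q x - L\<phi> x) * G x)
       + (\<tau> ^ 3 * (4 * K x - 2 * (q x - L\<phi> x) * m x) - \<tau> * Lq x) * (f x)\<^sup>2"
    let ?M = "\<lambda>x. 2 * (L x + \<tau>\<^sup>2 * m x * f x) * (- \<tau> * (2 * N x + q x * f x))"
    have iT: "integrable lborel ?T"
      by (rule integrable_compact_support[where c=c and R=R])
        (auto intro!: continuous_intros cLq simp: fsupp out)
    have iM: "integrable lborel ?M"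
      by (rule integrable_compact_support[where c=c and R=R])
        (auto intro!: continuous_intros simp: fsupp out)
    have if2: "integrable lborel (\<lambda>x. 16 * l\<^sup>2 * \<tau>\<^sup>2 * (f x)\<^sup>2)" "integrable lborel (\<lambda>x. d / 2 * \<tau> ^ 3 * (f x)\<^sup>2)"
      by (rule integrable_compact_support[where c=c and R=R]; auto intro!: continuous_intros simp: fsupp)+
    have ilap: "integrable lborel (\<lambda>x. (E x)\<^sup>2 * (lap x)\<^sup>2)"
      by (rule integrable_compact_support[where c=c and R=R])
        (auto intro!: continuous_intros simp: out)
    have id: "(LINT x|lborel. ?M x) = (LINT x|lborel. ?T x)"
      unfolding Lq_def defs by (rule carleman_identity[OF f \<phi>C2 qC2 fsupp])
    have "d / 2 * \<tau> ^ 3 * (LINT x|lborel. exp (2 * \<tau> * \<phi> x) * (w x)\<^sup>2) = (LINT x|lborel. d / 2 * \<tau> ^ 3 * (f x)\<^sup>2)"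
      by (simp add: f_def E2 power_mult_distrib)
    also have "\<dots> \<le> (LINT x|lborel. ?T x - 16 * l\<^sup>2 * \<tau>\<^sup>2 * (f x)\<^sup>2)"
      by (intro integral_mono if2 Bochner_Integration.integrable_diff iT up)
    also have "\<dots> = (LINT x|lborel. ?M x - 16 * l\<^sup>2 * \<tau>\<^sup>2 * (f x)\<^sup>2)"
      using iT iM if2 id by (simp only: Bochner_Integration.integral_diff)
    also have "\<dots> \<le> (LINT x|lborel. (E x)\<^sup>2 * (lap x)\<^sup>2)"
      by (intro integral_mono if2 Bochner_Integration.integrable_diff iM ilap low)
    finally show ?thesis unfolding E2 lap_def .
  qed
  show ?thesis
  proof (rule that[of "d / 2" \<tau>0])
  qed (use main d in \<open>auto simp: \<tau>0_def \<phi>_def l_def\<close>)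
qed

section \<open>Smooth functions\<close>

lemma partial_deriv_eqI: "(f has_derivative D) (at x) \<Longrightarrow> partial_deriv i f x = D i"
  unfolding partial_deriv_def by (metis frechet_derivative_at)

text \<open>Smoothness proofs run by induction on \<open>k\<close> with the Frechet derivative as
  intermediary: the calculus rules produce it, and its values on basis vectors are the partial
  derivatives that \<open>C_k\<close> asks for.\<close>

lemma C_k_SucI:
  assumes "\<And>x. (f has_derivative D x) (at x)" "\<And>i. i \<in> Basis \<Longrightarrow> C_k k (\<lambda>x. D x i)"
  shows "C_k (Suc k) f"
proof -
  have "partial_deriv i f = (\<lambda>x. D x i)" for i
    using partial_deriv_eqI[OF assms(1)] by auto
  then show ?thesis using assms by (auto simp: differentiable_def)
qed

lemma C_k_SucD:
  assumes "C_k (Suc k) f"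
  shows "(f has_derivative frechet_derivative f (at x)) (at x)"
    and "i \<in> Basis \<Longrightarrow> C_k k (\<lambda>x. frechet_derivative f (at x) i)"
  using assms by (auto simp: partial_deriv_def[abs_def] frechet_derivative_works[symmetric])

lemma C_k_Suc_imp: "C_k (Suc k) f \<Longrightarrow> C_k k f"
proof (induction k arbitrary: f)
  case 0
  then show ?case
    by (auto simp: continuous_on_eq_continuous_at intro!: differentiable_imp_continuous_within)
next
  case (Suc k)
  show ?case
    by (rule C_k_SucI[OF C_k_SucD(1)[OF Suc.prems]]) (intro Suc.IH C_k_SucD(2)[OF Suc.prems])
qed

lemma C_k_continuous: "C_k k f \<Longrightarrow> continuous_on UNIV f"
proof (induction k)
  case (Suc k)
  then show ?case using C_k_Suc_imp by blast
qed simp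

lemma C_k_const: "C_k k (\<lambda>x. c)"
proof (induction k arbitrary: c)
  case (Suc k)
  show ?case by (rule C_k_SucI[where D="\<lambda>x i. 0"]) (auto intro: Suc)
qed simp

lemma C_k_add: "C_k k f \<Longrightarrow> C_k k g \<Longrightarrow> C_k k (\<lambda>x. f x + g x)"
proof (induction k arbitrary: f g)
  case (Suc k)
  show ?case
    by (rule C_k_SucI[OF has_derivative_add[OF C_k_SucD(1)[OF Suc.prems(1)] C_k_SucD(1)[OF Suc.prems(2)]]])
      (intro Suc.IH C_k_SucD(2)[OF Suc.prems(1)] C_k_SucD(2)[OF Suc.prems(2)])
qed (auto intro: continuous_intros)

lemma C_k_linear:
  assumes L: "bounded_linear L"
  shows "C_k k f \<Longrightarrow> C_k k (\<lambda>x. L (f x))"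
proof (induction k arbitrary: f)
  case 0
  then show ?case
    using linear_continuous_on[OF L] by (auto intro: continuous_on_compose2)
next
  case (Suc k)
  show ?case
    by (rule C_k_SucI[OF bounded_linear.has_derivative[OF L C_k_SucD(1)[OF Suc.prems]]])
      (intro Suc.IH C_k_SucD(2)[OF Suc.prems])
qed

lemma C_k_cmult: "C_k k f \<Longrightarrow> C_k k (\<lambda>x. c * f x)" for c :: real
  by (rule C_k_linear[OF bounded_linear_mult_right])

lemma C_k_minus: "C_k k f \<Longrightarrow> C_k k (\<lambda>x. - f x)"
  by (rule C_k_linear) (auto intro: bounded_linear_minus bounded_linear_ident)

lemma C_k_diff: "C_k k f \<Longrightarrow> C_k k g \<Longrightarrow> C_k k (\<lambda>x. f x - g x)"
  using C_k_add[OF _ C_k_minus, of k f g] by simp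

lemma C_k_mult: "C_k k f \<Longrightarrow> C_k k g \<Longrightarrow> C_k k (\<lambda>x. f x * g x :: real)"
proof (induction k arbitrary: f g)
  case (Suc k)
  note f = C_k_SucD[OF Suc.prems(1)] and g = C_k_SucD[OF Suc.prems(2)]
  show ?case
    by (rule C_k_SucI[OF has_derivative_mult[OF f(1) g(1)]])
      (intro C_k_add Suc.IH f(2) g(2) C_k_Suc_imp[OF Suc.prems(1)] C_k_Suc_imp[OF Suc.prems(2)])
qed (auto intro: continuous_intros)

lemma C_k_inverse: "C_k k f \<Longrightarrow> (\<And>x. f x \<noteq> 0) \<Longrightarrow> C_k k (\<lambda>x. inverse (f x :: real))"
proof (induction k)
  case 0
  then show ?case by (auto intro!: continuous_intros)
next
  case (Suc k)
  note f = C_k_SucD[OF Suc.prems(1)]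
  have i: "C_k k (\<lambda>x. inverse (f x))"
    using Suc C_k_Suc_imp by blast
  show ?case
    by (rule C_k_SucI[OF Deriv.has_derivative_inverse[OF Suc.prems(2) f(1)]])
      (intro C_k_minus C_k_mult i f(2))
qed

lemma C_k_translate: "C_k k f \<Longrightarrow> C_k k (\<lambda>x. f (x - c))"
proof (induction k arbitrary: f)
  case 0
  then show ?case
    by simp (rule continuous_on_compose2[of UNIV f UNIV "\<lambda>x. x - c"], auto intro!: continuous_intros)
next
  case (Suc k)
  note f = C_k_SucD[OF Suc.prems]
  have "((\<lambda>x. f (x - c)) has_derivative frechet_derivative f (at (x - c))) (at x)" for x
  proof -
    have "((\<lambda>x. x - c) has_derivative (\<lambda>h. h)) (at x)" by (auto intro!: derivative_eq_intros)
    from has_derivative_compose[OF this f(1)] show ?thesis by simp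
  qed
  then show ?case
    by (rule C_k_SucI) (rule Suc.IH[OF f(2)])
qed

lemma C_k_inner: "C_k k (\<lambda>x. (x - c) \<bullet> b)"
proof (cases k)
  case 0
  then show ?thesis by (auto intro!: continuous_intros)
next
  case (Suc l)
  show ?thesis unfolding Suc
    by (rule C_k_SucI[where D="\<lambda>x h. h \<bullet> b"]) (auto intro!: derivative_eq_intros C_k_const)
qed

lemma C_k_sum: "(\<And>j. j \<in> J \<Longrightarrow> C_k k (f j)) \<Longrightarrow> C_k k (\<lambda>x. \<Sum>j\<in>J. f j x)"
  by (induction J rule: infinite_finite_induct) (auto intro: C_k_const C_k_add)

lemma C_k_sqdist: "C_k k (\<lambda>x. (x - c) \<bullet> (x - c))"
proof -
  have "(\<lambda>x. (x - c) \<bullet> (x - c)) = (\<lambda>x. \<Sum>b\<in>Basis. ((x - c) \<bullet> b) * ((x - c) \<bullet> b))"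
    by (rule ext) (rule euclidean_inner)
  then show ?thesis by (simp only:) (intro C_k_sum C_k_mult C_k_inner)
qed

section \<open>Smooth cutoffs and mollifiers\<close>

lemma power_le_fact_exp: "0 \<le> s \<Longrightarrow> s ^ n \<le> fact n * exp s" for s :: real
proof -
  assume s: "0 \<le> s"
  have "inverse (fact n) *\<^sub>R s ^ n = (\<Sum>m\<in>{n}. inverse (fact m) *\<^sub>R s ^ m)" by simp
  also have "\<dots> \<le> (\<Sum>m. inverse (fact m) *\<^sub>R s ^ m)"
    using s by (intro sum_le_suminf summable_exp_generic) auto
  finally have "s ^ n / fact n \<le> exp s" by (simp add: exp_def divide_inverse mult.commute)
  then show ?thesis by (simp only: pos_divide_le_eq[OF fact_gt_zero] mult.commute)
qed

text \<open>The exponent \<open>m\<close> makes the family closed under differentiation: the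
  derivative of a member is a combination of the members \<open>m + 1\<close> and
  \<open>m + 2\<close>. Smoothness then follows by an induction on the order that keeps
  \<open>m\<close> arbitrary.\<close>

definition flat_exp :: "nat \<Rightarrow> real \<Rightarrow> real" where
  "flat_exp m t = (if t \<le> 0 then 0 else inverse t ^ m * exp (- inverse t))"

text \<open>With \<open>s = inverse t\<close> this is the estimate of \<open>s ^ (m + 2)\<close> by
  \<open>fact (m + 2) * exp s\<close>. Quadratic smallness at the origin is what yields derivative 0
  there.\<close>

lemma flat_exp_bound: "\<bar>flat_exp m t\<bar> \<le> fact (m + 2) * t\<^sup>2"
proof (cases "t \<le> 0")
  case False
  define s where "s = inverse t"
  have s: "s > 0" using False by (simp add: s_def)
  have "s ^ (m + 2) \<le> exp s * fact (m + 2)"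
    using power_le_fact_exp[of s "m + 2"] s by (simp only: mult.commute)
  then have "s ^ (m + 2) * exp (- s) \<le> exp s * fact (m + 2) * exp (- s)"
    by (intro mult_right_mono) auto
  also have "\<dots> = fact (m + 2)" by (simp only: exp_minus) (simp del: fact_Suc)
  finally have "t\<^sup>2 * (s ^ (m + 2) * exp (- s)) \<le> t\<^sup>2 * fact (m + 2)"
    by (intro mult_left_mono) auto
  moreover have "t\<^sup>2 * (s ^ (m + 2) * exp (- s)) = \<bar>flat_exp m t\<bar>"
  proof -
    have "t\<^sup>2 * (s ^ (m + 2) * exp (- s)) = (t * s)\<^sup>2 * (s ^ m * exp (- s))"
      by (simp add: power_add power2_eq_square ac_simps)
    moreover have "t * s = 1" using False by (simp add: s_def)
    ultimately show ?thesis using False s by (simp add: flat_exp_def s_def)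
  qed
  ultimately show ?thesis by (metis mult.commute)
qed (simp add: flat_exp_def)

lemma DERIV_flat_exp: "(flat_exp m has_real_derivative flat_exp (m + 2) t - m * flat_exp (m + 1) t) (at t)"
proof -
  consider "t < 0" | "t = 0" | "t > 0" by linarith
  then show ?thesis
  proof cases
    case 1
    have "((\<lambda>_. 0) has_real_derivative 0) (at t)" by simp
    moreover have "\<forall>\<^sub>F x in nhds t. 0 = flat_exp m x"
    proof -
      have "\<forall>\<^sub>F x in nhds t. x \<in> {..<0}" using 1 by (intro eventually_nhds_in_open) auto
      then show ?thesis by eventually_elim (simp add: flat_exp_def)
    qed
    ultimately have "(flat_exp m has_real_derivative 0) (at t)"
      using DERIV_cong_ev[OF refl, of "\<lambda>_. 0" "flat_exp m" t 0 0] by blast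
    then show ?thesis using 1 by (simp add: flat_exp_def)
  next
    case 2
    have "((\<lambda>h. flat_exp m h / h) \<longlongrightarrow> 0) (at 0)"
    proof (rule tendsto_rabs_zero_cancel, rule real_tendsto_sandwich[where f="\<lambda>_. 0" and h="\<lambda>h. fact (m + 2) * \<bar>h\<bar>"])
      show "((\<lambda>h::real. fact (m + 2) * \<bar>h\<bar>) \<longlongrightarrow> 0) (at 0)"
        by (intro tendsto_mult_right_zero tendsto_rabs_zero tendsto_ident_at)
      have "\<bar>flat_exp m h / h\<bar> \<le> fact (m + 2) * \<bar>h\<bar>" if "h \<noteq> 0" for h
      proof -
        have "\<bar>flat_exp m h / h\<bar> = \<bar>flat_exp m h\<bar> / \<bar>h\<bar>" by (simp add: abs_divide)
        also have "\<dots> \<le> fact (m + 2) * h\<^sup>2 / \<bar>h\<bar>"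
          by (intro divide_right_mono flat_exp_bound) auto
        also have "\<dots> = fact (m + 2) * (h\<^sup>2 / \<bar>h\<bar>)" by (simp only: times_divide_eq_right)
        also have "h\<^sup>2 / \<bar>h\<bar> = \<bar>h\<bar>" using that by (simp add: power2_eq_square divide_eq_eq)
        finally show ?thesis .
      qed
      then show "\<forall>\<^sub>F h in at 0. \<bar>flat_exp m h / h\<bar> \<le> fact (m + 2) * \<bar>h\<bar>"
        by (auto simp: eventually_at_filter)
    qed auto
    then show ?thesis using 2 by (simp add: DERIV_def flat_exp_def)
  next
    case 3
    have "((\<lambda>t. inverse t ^ m * exp (- inverse t)) has_real_derivative
        flat_exp (m + 2) t - m * flat_exp (m + 1) t) (at t)"
    proof (rule DERIV_cong)
      have i: "((\<lambda>t. inverse t) has_real_derivative - (inverse t ^ 2)) (at t)"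
        using DERIV_inverse[of t UNIV] 3 by (simp add: numeral_2_eq_2)
      show "((\<lambda>t. inverse t ^ m * exp (- inverse t)) has_real_derivative
          real m * (- (inverse t ^ 2) * inverse t ^ (m - Suc 0)) * exp (- inverse t)
            + exp (- inverse t) * - (- (inverse t ^ 2)) * inverse t ^ m) (at t)"
        by (intro DERIV_mult DERIV_power DERIV_fun_exp DERIV_minus i)
      show "real m * (- (inverse t ^ 2) * inverse t ^ (m - Suc 0)) * exp (- inverse t)
            + exp (- inverse t) * - (- (inverse t ^ 2)) * inverse t ^ m
          = flat_exp (m + 2) t - m * flat_exp (m + 1) t"
        using 3 by (cases m) (simp_all add: flat_exp_def power_add power2_eq_square)
    qed
    moreover have "\<forall>\<^sub>F x in nhds t. inverse x ^ m * exp (- inverse x) = flat_exp m x"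
    proof -
      have "\<forall>\<^sub>F x in nhds t. x \<in> {0<..}" using 3 by (intro eventually_nhds_in_open) auto
      then show ?thesis by eventually_elim (simp add: flat_exp_def)
    qed
    ultimately show ?thesis
      using DERIV_cong_ev[OF refl, of "\<lambda>t. inverse t ^ m * exp (- inverse t)" "flat_exp m" t _ "flat_exp (m + 2) t - m * flat_exp (m + 1) t"] by blast
  qed
qed

lemma C_k_flat_exp: "(\<And>k. C_k k p) \<Longrightarrow> C_k k (\<lambda>x. flat_exp m (p x))"
proof (induction k arbitrary: m)
  case 0
  have "isCont (flat_exp m) t" for t using DERIV_flat_exp DERIV_isCont by blast
  then have "continuous_on UNIV (flat_exp m)" by (simp add: continuous_on_eq_continuous_at)
  then show ?case using C_k_continuous[OF 0] by (auto intro: continuous_on_compose2)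
next
  case (Suc k)
  note p = C_k_SucD[OF Suc.prems[of "Suc k"]]
  have "((\<lambda>x. flat_exp m (p x)) has_derivative
     (\<lambda>h. frechet_derivative p (at x) h * (flat_exp (m + 2) (p x) - m * flat_exp (m + 1) (p x)))) (at x)" for x
    by (rule DERIV_compose_FDERIV[OF DERIV_flat_exp p(1)])
  then show ?case
    by (rule C_k_SucI) (intro C_k_mult C_k_diff C_k_cmult p(2) Suc)
qed

lemma flat_exp_nonneg: "flat_exp m t \<ge> 0" by (simp add: flat_exp_def)

lemma flat_exp_pos: "t > 0 \<Longrightarrow> flat_exp m t > 0" by (simp add: flat_exp_def)

lemma C_k_imp_dd:
  assumes "C_k (Suc k) (f :: 'a::euclidean_space \<Rightarrow> real)"
  shows "dd i f (partial_deriv i f)"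
  unfolding dd_def partial_deriv_def
proof
  fix x
  have "((\<lambda>t. x + t *\<^sub>R i) has_derivative (\<lambda>h. h *\<^sub>R i)) (at 0)"
    by (auto intro!: derivative_eq_intros)
  from has_derivative_compose[OF this, of f "frechet_derivative f (at x)"] C_k_SucD(1)[OF assms, of x]
  have "((\<lambda>t. f (x + t *\<^sub>R i)) has_derivative (\<lambda>h. frechet_derivative f (at x) (h *\<^sub>R i))) (at 0)" by simp
  moreover have "(\<lambda>h. frechet_derivative f (at x) (h *\<^sub>R i)) = (*) (frechet_derivative f (at x) i)"
    using has_derivative_linear[OF C_k_SucD(1)[OF assms, of x]] by (auto simp: linear_cmul)
  ultimately show "((\<lambda>t. f (x + t *\<^sub>R i)) has_real_derivative frechet_derivative f (at x) i) (at 0)"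
    by (simp add: has_field_derivative_def)
qed

lemma C_k_imp_C2:
  assumes "C_k 2 (f :: 'a::euclidean_space \<Rightarrow> real)"
  shows "C2 f (\<lambda>i. partial_deriv i f) (\<lambda>i j. partial_deriv j (partial_deriv i f))"
proof -
  have f: "C_k (Suc (Suc 0)) f" using assms by (simp add: numeral_2_eq_2)
  then have 1: "C_k (Suc 0) (partial_deriv i f)" if "i \<in> Basis" for i using that by simp
  then have 2: "C_k 0 (partial_deriv j (partial_deriv i f))" if "i \<in> Basis" "j \<in> Basis" for i j
    using that by simp
  show ?thesis unfolding C2_def
    by (intro conjI ballI C_k_continuous[OF f] C_k_imp_dd[OF f] C_k_continuous[OF 1] C_k_imp_dd[OF 1]
        C_k_continuous[OF 2])
qed

text \<open>The quotient of \<open>p\<close> by \<open>p + r\<close> for two flat functions,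
  \<open>p\<close> living at distances below \<open>b\<close> from \<open>c\<close> and
  \<open>r\<close> at distances above \<open>a\<close>. As \<open>a < b\<close>, at least one of
  them is positive at every point, so the denominator never vanishes.\<close>

lemma exists_cutoff:
  fixes c :: "'a::euclidean_space"
  assumes "0 < a" "a < b"
  obtains \<theta> :: "'a \<Rightarrow> real" where "\<And>k. C_k k \<theta>" "\<And>x. 0 \<le> \<theta> x" "\<And>x. \<theta> x \<le> 1"
    "\<And>x. x \<in> cball c a \<Longrightarrow> \<theta> x = 1" "\<And>x. x \<notin> ball c b \<Longrightarrow> \<theta> x = 0"
proof -
  define s where "s x = (x - c) \<bullet> (x - c)" for x
  have s: "s x = (dist c x)\<^sup>2" for x
    unfolding s_def by (metis dist_norm dist_commute power2_norm_eq_inner)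
  define p where "p x = flat_exp 0 (b\<^sup>2 - s x)" for x
  define r where "r x = flat_exp 0 (s x - a\<^sup>2)" for x
  have cs: "C_k k (\<lambda>x. b\<^sup>2 - s x)" "C_k k (\<lambda>x. s x - a\<^sup>2)" for k
    unfolding s_def by (intro C_k_diff C_k_const C_k_sqdist)+
  have cp: "C_k k p" "C_k k r" for k
    unfolding p_def r_def by (intro C_k_flat_exp cs)+
  have ab: "a\<^sup>2 < b\<^sup>2" using assms by (intro power_strict_mono) auto
  have nn: "p x \<ge> 0" "r x \<ge> 0" for x by (auto simp: p_def r_def flat_exp_nonneg)
  have pos: "p x + r x > 0" for x
  proof (cases "s x < b\<^sup>2")
    case True
    then have "p x > 0" by (simp add: p_def flat_exp_pos)
    then show ?thesis using nn(2)[of x] by linarith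
  next
    case False
    then have "r x > 0" using ab by (simp add: r_def flat_exp_pos)
    then show ?thesis using nn(1)[of x] by linarith
  qed
  show ?thesis
  proof (rule that[of "\<lambda>x. p x * inverse (p x + r x)"])
    show "C_k k (\<lambda>x. p x * inverse (p x + r x))" for k
      using pos by (intro C_k_mult C_k_inverse C_k_add cp) (auto simp: less_imp_neq[THEN not_sym])
    show "0 \<le> p x * inverse (p x + r x)" for x using nn[of x] pos[of x] by simp
    show "p x * inverse (p x + r x) \<le> 1" for x using nn[of x] pos[of x] by (simp add: field_simps)
    show "p x * inverse (p x + r x) = 1" if "x \<in> cball c a" for x
    proof -
      have "s x \<le> a\<^sup>2" unfolding s using that by (intro power_mono) auto
      then have "r x = 0" by (simp add: r_def flat_exp_def)
      then show ?thesis using pos[of x] by simp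
    qed
    show "p x * inverse (p x + r x) = 0" if "x \<notin> ball c b" for x
    proof -
      have "s x \<ge> b\<^sup>2" unfolding s using that assms by (intro power_mono) auto
      then show ?thesis by (simp add: p_def flat_exp_def)
    qed
  qed
qed

lemma exists_mollifier:
  assumes "\<epsilon> > 0"
  obtains k :: "'a::euclidean_space \<Rightarrow> real" where "\<And>n. C_k n k" "\<And>x. 0 \<le> k x"
    "\<And>x. x \<notin> ball 0 \<epsilon> \<Longrightarrow> k x = 0" "(LINT x|lborel. k x) = 1"
proof -
  have "0 < \<epsilon>/2" "\<epsilon>/2 < \<epsilon>" using assms by auto
  then obtain \<theta> :: "'a \<Rightarrow> real" where \<theta>: "\<And>k. C_k k \<theta>" "\<And>x. 0 \<le> \<theta> x" "\<And>x. \<theta> x \<le> 1"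
    "\<And>x. x \<in> cball 0 (\<epsilon>/2) \<Longrightarrow> \<theta> x = 1" "\<And>x. x \<notin> ball 0 \<epsilon> \<Longrightarrow> \<theta> x = 0"
    by (rule exists_cutoff[where c=0]) blast
  have i: "integrable lborel \<theta>"
    by (rule integrable_compact_support[OF C_k_continuous[OF \<theta>(1)[of 0]], of 0 \<epsilon>]) (use \<theta>(5) in auto)
  define Z where "Z = (LINT x|lborel. \<theta> x)"
  have "0 < measure lborel (ball (0::'a) (\<epsilon>/2))" using assms by (simp add: content_ball_pos)
  also have "\<dots> = (LINT x|lborel. indicator (ball (0::'a) (\<epsilon>/2)) x)" by simp
  also have "\<dots> \<le> Z" unfolding Z_def
    by (intro integral_mono i integrable_real_indicator)
      (use \<theta>(2,4) in \<open>auto simp: indicator_def intro!: emeasure_bounded_finite[unfolded infinity_ennreal_def]\<close>)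
  finally have Z: "Z > 0" .
  show ?thesis
  proof (rule that[of "\<lambda>x. inverse Z * \<theta> x"])
    show "C_k n (\<lambda>x. inverse Z * \<theta> x)" for n by (intro C_k_cmult \<theta>)
    show "(LINT x|lborel. inverse Z * \<theta> x) = 1" using Z by (simp add: Z_def)
  qed (use \<theta> Z in auto)
qed

section \<open>Three balls for C2 functions\<close>

definition bint :: "'a::euclidean_space set \<Rightarrow> ('a \<Rightarrow> real) \<Rightarrow> real" where
  "bint S f = (LINT x|lborel. indicator S x * f x)"

lemma bint_integrable:
  fixes f :: "'a::euclidean_space \<Rightarrow> real"
  assumes "continuous_on UNIV f" "bounded S" "S \<in> sets borel"
  shows "integrable lborel (\<lambda>x. indicator S x * f x)"
proof -
  obtain r where r: "S \<subseteq> cball 0 r" using assms(2) unfolding bounded_any_center[where a=0] by (auto simp: subset_eq)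
  have "integrable lborel (\<lambda>x. indicator (cball 0 r) x *\<^sub>R f x)"
    by (intro borel_integrable_compact continuous_on_subset[OF assms(1)]) auto
  then have "integrable lborel (\<lambda>x. indicator S x * (indicator (cball 0 r) x *\<^sub>R f x))"
    using assms(3) integrable_mult_indicator[of S lborel "\<lambda>x. indicator (cball 0 r) x *\<^sub>R f x"] by simp
  moreover have "(\<lambda>x. indicator S x * (indicator (cball 0 r) x *\<^sub>R f x)) = (\<lambda>x. indicator S x * f x)"
    using r by (auto simp: fun_eq_iff indicator_def)
  ultimately show ?thesis by simp
qed

lemma bint_mono:
  assumes "integrable lborel (\<lambda>x. indicator S x * f x)" "integrable lborel (\<lambda>x. indicator T x * g x)"
    and "S \<subseteq> T" "\<And>x. x \<in> S \<Longrightarrow> f x \<le> g x" "\<And>x. x \<in> T \<Longrightarrow> 0 \<le> g x"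
  shows "bint S f \<le> bint T g"
  unfolding bint_def using assms by (intro integral_mono) (auto simp: indicator_def)

lemma bint_nonneg: "(\<And>x. x \<in> S \<Longrightarrow> 0 \<le> f x) \<Longrightarrow> 0 \<le> bint S f"
  unfolding bint_def by (intro Bochner_Integration.integral_nonneg) (auto simp: indicator_def)

lemma bint_add:
  assumes "integrable lborel (\<lambda>x. indicator S x * f x)" "integrable lborel (\<lambda>x. indicator S x * g x)"
  shows "bint S (\<lambda>x. f x + g x) = bint S f + bint S g"
  unfolding bint_def using assms by (simp add: distrib_left)

lemma bint_cmult: "bint S (\<lambda>x. c * f x) = c * bint S f"
  unfolding bint_def by (simp add: mult.left_commute)

section \<open>Caccioppoli inequalities\<close>

text \<open>The field \<open>\<psi> * Z * grad Z - Z\<^sup>2 * grad \<psi> / 2\<close> has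
  divergence \<open>\<psi> * |grad Z|\<^sup>2 + \<psi> * Z * Delta Z - Z\<^sup>2 * Delta \<psi> /
  2\<close>. Moving two derivatives to the cutoff leaves no gradient of \<open>Z\<close> on the
  right.\<close>

lemma green_identity:
  assumes \<psi>: "C2 \<psi> \<psi>1 \<psi>2" and Z: "C2 Z Z1 Z2" and supp: "\<And>x. x \<notin> cball c R \<Longrightarrow> \<psi> x = 0"
  shows "(LINT x|lborel. \<psi> x * (\<Sum>i\<in>Basis. (Z1 i x)\<^sup>2)) =
    (LINT x|lborel. (\<Sum>i\<in>Basis. \<psi>2 i i x) / 2 * (Z x)\<^sup>2 - \<psi> x * (Z x * (\<Sum>i\<in>Basis. Z2 i i x)))"
proof -
  note \<psi>D = C2D[OF \<psi>] and ZD = C2D[OF Z]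
  note [continuous_intros] = \<psi>D(1,3,5) ZD(1,3,5)
  have out: "\<psi>1 i x = 0" "\<psi>2 i i x = 0" if "x \<notin> cball c R" "i \<in> Basis" for i x
    using C2_zero_outside[OF \<psi>, of c R] supp that by blast+
  let ?V = "\<lambda>i x. \<psi> x * (Z x * Z1 i x) - 1/2 * (\<psi>1 i x * (Z x * Z x))"
  let ?V' = "\<lambda>i x. (\<psi>1 i x * (Z x * Z1 i x) + \<psi> x * (Z1 i x * Z1 i x + Z x * Z2 i i x))
     - 1/2 * (\<psi>2 i i x * (Z x * Z x) + \<psi>1 i x * (Z1 i x * Z x + Z x * Z1 i x))"
  have dd: "dd i (?V i) (?V' i)" if "i \<in> Basis" for i
    using that by (intro dd_diff dd_cmult dd_mult \<psi>D ZD)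
  have cV: "continuous_on UNIV (?V i)" "continuous_on UNIV (?V' i)" if "i \<in> Basis" for i
    using that by (auto intro!: continuous_intros)
  have sV: "?V i x = 0" if "i \<in> Basis" "x \<notin> cball c R" for i x
    using out[OF that(2,1)] supp[OF that(2)] by simp
  have i1: "integrable lborel (\<lambda>x. (\<Sum>i\<in>Basis. \<psi>2 i i x) / 2 * (Z x)\<^sup>2 - \<psi> x * (Z x * (\<Sum>i\<in>Basis. Z2 i i x)))"
    by (rule integrable_compact_support[where c=c and R=R])
      (use out supp in \<open>auto intro!: continuous_intros sum.neutral\<close>)
  have "\<psi> x * (\<Sum>i\<in>Basis. (Z1 i x)\<^sup>2) = ((\<Sum>i\<in>Basis. \<psi>2 i i x) / 2 * (Z x)\<^sup>2 - \<psi> x * (Z x * (\<Sum>i\<in>Basis. Z2 i i x)))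
      + (\<Sum>i\<in>Basis. ?V' i x)" for x
  proof -
    have "?V' i x = \<psi> x * (Z1 i x)\<^sup>2 + \<psi> x * (Z x * Z2 i i x) - \<psi>2 i i x / 2 * (Z x)\<^sup>2" for i
      by (simp add: power2_eq_square algebra_simps)
    then show ?thesis
      by (simp add: sum.distrib sum_subtractf sum_distrib_left sum_distrib_right sum_divide_distrib)
  qed
  then show ?thesis
    using Bochner_Integration.integral_add[OF i1 integral_sum_dd_eq_0(2)[of ?V ?V' c R, OF dd cV sV]]
      integral_sum_dd_eq_0(1)[of ?V ?V' c R, OF dd cV sV] by simp
qed

lemma caccioppoli:
  fixes c :: "'a::euclidean_space"
  assumes ab: "0 < a" "a < b"
  obtains K where "K \<ge> 0" "\<And>Z Z1 Z2. C2 Z Z1 Z2 \<Longrightarrow>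
     bint (cball c a) (\<lambda>x. \<Sum>i\<in>Basis. (Z1 i x)\<^sup>2)
       \<le> K * bint (cball c b) (\<lambda>x. (Z x)\<^sup>2 + \<bar>Z x * (\<Sum>i\<in>Basis. Z2 i i x)\<bar>)"
proof -
  obtain \<theta> :: "'a \<Rightarrow> real" where \<theta>: "\<And>k. C_k k \<theta>" "\<And>x. 0 \<le> \<theta> x" "\<And>x. \<theta> x \<le> 1"
    "\<And>x. x \<in> cball c a \<Longrightarrow> \<theta> x = 1" "\<And>x. x \<notin> ball c b \<Longrightarrow> \<theta> x = 0"
    using ab by (rule exists_cutoff[where c=c]) blast
  define \<theta>1 where "\<theta>1 = (\<lambda>i. partial_deriv i \<theta>)"
  define \<theta>2 where "\<theta>2 = (\<lambda>i j. partial_deriv j (partial_deriv i \<theta>))"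
  have \<theta>C2: "C2 \<theta> \<theta>1 \<theta>2" unfolding \<theta>1_def \<theta>2_def by (rule C_k_imp_C2) (rule \<theta>)
  note \<theta>D = C2D[OF \<theta>C2]
  have supp: "\<theta> x = 0" if "x \<notin> cball c b" for x using that \<theta>(5)[of x] by auto
  define l where "l x = (\<Sum>i\<in>Basis. \<theta>2 i i x)" for x
  have l0: "l x = 0" if "x \<notin> cball c b" for x
    using C2_zero_outside(2)[OF \<theta>C2, of c b] supp that by (auto simp: l_def intro!: sum.neutral)
  have cl: "continuous_on UNIV l" unfolding l_def by (intro continuous_on_sum \<theta>D)
  obtain B where B: "B \<ge> 0" "\<And>x. \<bar>l x\<bar> \<le> B" using compact_support_bounded[OF cl l0] by blast
  show ?thesis
  proof (rule that[of "B + 1"])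
    fix Z :: "'a \<Rightarrow> real" and Z1 Z2 assume Z: "C2 Z Z1 Z2"
    note ZD = C2D[OF Z]
    note [continuous_intros] = \<theta>D(1,3,5) ZD(1,3,5) cl
    let ?G = "\<lambda>x. \<Sum>i\<in>Basis. (Z1 i x)\<^sup>2" and ?L = "\<lambda>x. \<Sum>i\<in>Basis. Z2 i i x"
    have "bint (cball c a) ?G \<le> (LINT x|lborel. \<theta> x * ?G x)"
      unfolding bint_def
    proof (rule integral_mono)
      show "integrable lborel (\<lambda>x. indicator (cball c a) x * ?G x)"
        by (intro bint_integrable continuous_intros) auto
      show "integrable lborel (\<lambda>x. \<theta> x * ?G x)"
        by (rule integrable_compact_support[where c=c and R=b]) (use supp in \<open>auto intro!: continuous_intros\<close>)
      show "indicator (cball c a) x * ?G x \<le> \<theta> x * ?G x" for x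
        using \<theta>(2)[of x] \<theta>(4)[of x] by (cases "x \<in> cball c a") (auto simp: sum_nonneg)
    qed
    also have "\<dots> = (LINT x|lborel. l x / 2 * (Z x)\<^sup>2 - \<theta> x * (Z x * ?L x))"
      unfolding l_def using green_identity[OF \<theta>C2 Z supp] by blast
    also have "\<dots> \<le> (LINT x|lborel. indicator (cball c b) x * ((B + 1) * ((Z x)\<^sup>2 + \<bar>Z x * ?L x\<bar>)))"
    proof (rule integral_mono)
      show "integrable lborel (\<lambda>x. l x / 2 * (Z x)\<^sup>2 - \<theta> x * (Z x * ?L x))"
        by (rule integrable_compact_support[where c=c and R=b]) (use supp l0 in \<open>auto intro!: continuous_intros\<close>)
      show "integrable lborel (\<lambda>x. indicator (cball c b) x * ((B + 1) * ((Z x)\<^sup>2 + \<bar>Z x * ?L x\<bar>)))"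
        by (intro bint_integrable continuous_intros) auto
      show "l x / 2 * (Z x)\<^sup>2 - \<theta> x * (Z x * ?L x) \<le> indicator (cball c b) x * ((B + 1) * ((Z x)\<^sup>2 + \<bar>Z x * ?L x\<bar>))" for x
      proof (cases "x \<in> cball c b")
        case True
        have "l x / 2 * (Z x)\<^sup>2 \<le> (B + 1) * (Z x)\<^sup>2"
          using B(1) B(2)[of x] by (intro mult_right_mono) auto
        moreover have "- (\<theta> x * (Z x * ?L x)) \<le> (B + 1) * \<bar>Z x * ?L x\<bar>"
        proof -
          have "- (\<theta> x * (Z x * ?L x)) \<le> \<bar>\<theta> x * (Z x * ?L x)\<bar>" by simp
          also have "\<dots> = \<theta> x * \<bar>Z x * ?L x\<bar>" using \<theta>(2)[of x] by (simp add: abs_mult)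
          also have "\<dots> \<le> (B + 1) * \<bar>Z x * ?L x\<bar>"
            using \<theta>(3)[of x] B(1) by (intro mult_right_mono) auto
          finally show ?thesis .
        qed
        ultimately show ?thesis using True by (simp add: distrib_left)
      qed (use supp l0 in auto)
    qed
    also have "\<dots> = (B + 1) * bint (cball c b) (\<lambda>x. (Z x)\<^sup>2 + \<bar>Z x * ?L x\<bar>)"
      unfolding bint_cmult[symmetric] by (simp add: bint_def)
    finally show "bint (cball c a) ?G \<le> (B + 1) * bint (cball c b) (\<lambda>x. (Z x)\<^sup>2 + \<bar>Z x * ?L x\<bar>)" .
  qed (use B in auto)
qed

text \<open>The last integrand is the square of the amount by which \<open>Z\<close> violates
  \<open>|Delta Z| \<le> M * |Z|\<close>. The bound grows only linearly in \<open>M\<close>, which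
  the factor \<open>\<tau> ^ 3\<close> of the Carleman estimate can pay for.\<close>

lemma caccioppoli_potential:
  fixes c :: "'a::euclidean_space"
  assumes ab: "0 < a" "a < b"
  obtains K where "K \<ge> 0" "\<And>Z Z1 Z2 M. C2 Z Z1 Z2 \<Longrightarrow> M \<ge> 0 \<Longrightarrow>
     bint (cball c a) (\<lambda>x. (Z x)\<^sup>2 + (\<Sum>i\<in>Basis. (Z1 i x)\<^sup>2))
       \<le> K * (M + 2) * (bint (ball c b) (\<lambda>x. (Z x)\<^sup>2)
            + bint (ball c b) (\<lambda>x. (max 0 (\<bar>\<Sum>i\<in>Basis. Z2 i i x\<bar> - M * \<bar>Z x\<bar>))\<^sup>2))"
proof -
  define b' where "b' = (a + b) / 2"
  have b': "a < b'" "b' < b" using ab by (auto simp: b'_def)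
  then have sub: "cball c b' \<subseteq> ball c b" "cball c a \<subseteq> ball c b" by auto
  obtain K where K: "K \<ge> 0" "\<And>Z Z1 Z2. C2 Z Z1 Z2 \<Longrightarrow>
     bint (cball c a) (\<lambda>x. \<Sum>i\<in>Basis. (Z1 i x)\<^sup>2)
       \<le> K * bint (cball c b') (\<lambda>x. (Z x)\<^sup>2 + \<bar>Z x * (\<Sum>i\<in>Basis. Z2 i i x)\<bar>)"
    using ab(1) b'(1) by (rule caccioppoli[where c=c]) blast
  have young: "\<bar>p\<bar> * q \<le> p\<^sup>2 + q\<^sup>2" for p q :: real
    using sum_squares_bound[of "\<bar>p\<bar>" q] sum_power2_ge_zero[of p q] by (simp only: power2_abs)
  show ?thesis
  proof (rule that[of "K + 1"])
    fix Z :: "'a \<Rightarrow> real" and Z1 Z2 and M :: real assume Z: "C2 Z Z1 Z2" and M: "M \<ge> 0"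
    note [continuous_intros] = C2D(1,3,5)[OF Z]
    let ?L = "\<lambda>x. \<Sum>i\<in>Basis. Z2 i i x"
    let ?g = "\<lambda>x. max 0 (\<bar>?L x\<bar> - M * \<bar>Z x\<bar>)"
    define Y where "Y = bint (ball c b) (\<lambda>x. (Z x)\<^sup>2) + bint (ball c b) (\<lambda>x. (?g x)\<^sup>2)"
    have int: "integrable lborel (\<lambda>x. indicator S x * (Z x)\<^sup>2)" "integrable lborel (\<lambda>x. indicator S x * (?g x)\<^sup>2)"
      "integrable lborel (\<lambda>x. indicator S x * ((M + 2) * ((Z x)\<^sup>2 + (?g x)\<^sup>2)))"
      "integrable lborel (\<lambda>x. indicator S x * ((Z x)\<^sup>2 + \<bar>Z x * ?L x\<bar>))"
      "integrable lborel (\<lambda>x. indicator S x * (\<Sum>i\<in>Basis. (Z1 i x)\<^sup>2))"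
      if "bounded S" "S \<in> sets borel" for S
      using that by (intro bint_integrable continuous_intros; simp)+
    have Y0: "bint (ball c b) (\<lambda>x. (Z x)\<^sup>2) \<ge> 0" "bint (ball c b) (\<lambda>x. (?g x)\<^sup>2) \<ge> 0"
      by (intro bint_nonneg; simp)+
    have "(Z x)\<^sup>2 + \<bar>Z x * ?L x\<bar> \<le> (M + 2) * ((Z x)\<^sup>2 + (?g x)\<^sup>2)" for x
    proof -
      have "\<bar>?L x\<bar> \<le> M * \<bar>Z x\<bar> + ?g x" by simp
      then have "\<bar>Z x\<bar> * \<bar>?L x\<bar> \<le> \<bar>Z x\<bar> * (M * \<bar>Z x\<bar> + ?g x)" by (intro mult_left_mono) auto
      also have "\<dots> = M * (Z x)\<^sup>2 + \<bar>Z x\<bar> * ?g x" by (simp add: algebra_simps power2_eq_square)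
      also have "\<bar>Z x\<bar> * ?g x \<le> (Z x)\<^sup>2 + (?g x)\<^sup>2"
        by (rule young)
      finally have "(Z x)\<^sup>2 + \<bar>Z x * ?L x\<bar> \<le> (M + 2) * (Z x)\<^sup>2 + 1 * (?g x)\<^sup>2"
        by (simp add: abs_mult algebra_simps)
      also have "\<dots> \<le> (M + 2) * (Z x)\<^sup>2 + (M + 2) * (?g x)\<^sup>2"
        using M by (intro add_mono mult_right_mono) auto
      finally show ?thesis by (simp add: distrib_left)
    qed
    then have "bint (cball c b') (\<lambda>x. (Z x)\<^sup>2 + \<bar>Z x * ?L x\<bar>) \<le> bint (ball c b) (\<lambda>x. (M + 2) * ((Z x)\<^sup>2 + (?g x)\<^sup>2))"
      using M by (intro bint_mono int sub) auto
    also have "\<dots> = (M + 2) * Y"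
      unfolding bint_cmult Y_def by (subst bint_add) (auto intro!: int)
    finally have "K * bint (cball c b') (\<lambda>x. (Z x)\<^sup>2 + \<bar>Z x * ?L x\<bar>) \<le> K * ((M + 2) * Y)"
      using K(1) by (intro mult_left_mono)
    with K(2)[OF Z] have G: "bint (cball c a) (\<lambda>x. \<Sum>i\<in>Basis. (Z1 i x)\<^sup>2) \<le> K * ((M + 2) * Y)" by linarith
    have "bint (cball c a) (\<lambda>x. (Z x)\<^sup>2) \<le> bint (ball c b) (\<lambda>x. (Z x)\<^sup>2)"
      by (intro bint_mono int sub) auto
    also have "\<dots> \<le> 1 * Y" using Y0 by (simp add: Y_def)
    also have "\<dots> \<le> (M + 2) * Y" using M Y0 by (intro mult_right_mono) (auto simp: Y_def)
    finally have "bint (cball c a) (\<lambda>x. (Z x)\<^sup>2 + (\<Sum>i\<in>Basis. (Z1 i x)\<^sup>2)) \<le> (M + 2) * Y + K * ((M + 2) * Y)"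
      using G by (subst bint_add) (auto intro!: int)
    then show "bint (cball c a) (\<lambda>x. (Z x)\<^sup>2 + (\<Sum>i\<in>Basis. (Z1 i x)\<^sup>2)) \<le> (K + 1) * (M + 2) *
       (bint (ball c b) (\<lambda>x. (Z x)\<^sup>2) + bint (ball c b) (\<lambda>x. (?g x)\<^sup>2))"
      unfolding Y_def by (simp add: algebra_simps)
  qed (use K in auto)
qed

section \<open>From the Carleman estimate to three balls\<close>

lemma exists_annular_cutoff:
  fixes c :: "'a::euclidean_space"
  assumes r: "0 < s1" "s1 < t1" "t1 < s2" "s2 < t2"
  obtains \<zeta> \<zeta>1 \<zeta>2 B where "C2 \<zeta> \<zeta>1 \<zeta>2" "\<And>x. 0 \<le> \<zeta> x" "\<And>x. \<zeta> x \<le> (1::real)"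
    "\<And>x. x \<in> ball c s1 \<Longrightarrow> \<zeta> x = 0" "\<And>x. x \<notin> cball c t2 \<Longrightarrow> \<zeta> x = 0"
    "\<And>x. x \<in> ball c s2 - cball c t1 \<Longrightarrow> \<zeta> x = 1" "B \<ge> 0"
    "\<And>x i. i \<in> Basis \<Longrightarrow> \<bar>\<zeta>1 i x\<bar> \<le> B" "\<And>x. \<bar>\<Sum>i\<in>Basis. \<zeta>2 i i x\<bar> \<le> B"
proof -
  obtain \<theta> :: "'a \<Rightarrow> real" where \<theta>: "\<And>k. C_k k \<theta>" "\<And>x. 0 \<le> \<theta> x" "\<And>x. \<theta> x \<le> 1"
    "\<And>x. x \<in> cball c s1 \<Longrightarrow> \<theta> x = 1" "\<And>x. x \<notin> ball c t1 \<Longrightarrow> \<theta> x = 0"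
    using r(1,2) by (rule exists_cutoff[where c=c]) blast
  have "0 < s2" using r by simp
  then obtain \<eta> :: "'a \<Rightarrow> real" where \<eta>: "\<And>k. C_k k \<eta>" "\<And>x. 0 \<le> \<eta> x" "\<And>x. \<eta> x \<le> 1"
    "\<And>x. x \<in> cball c s2 \<Longrightarrow> \<eta> x = 1" "\<And>x. x \<notin> ball c t2 \<Longrightarrow> \<eta> x = 0"
    using r(4) by (rule exists_cutoff[where c=c]) blast
  define \<zeta> where "\<zeta> x = (1 - \<theta> x) * \<eta> x" for x
  have ck: "C_k k \<zeta>" for k unfolding \<zeta>_def by (intro C_k_mult C_k_diff C_k_const \<theta> \<eta>)
  define \<zeta>1 where "\<zeta>1 = (\<lambda>i. partial_deriv i \<zeta>)"
  define \<zeta>2 where "\<zeta>2 = (\<lambda>i j. partial_deriv j (partial_deriv i \<zeta>))"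
  have C2: "C2 \<zeta> \<zeta>1 \<zeta>2" unfolding \<zeta>1_def \<zeta>2_def by (rule C_k_imp_C2) (rule ck)
  note D = C2D[OF C2]
  have supp: "\<zeta> x = 0" if "x \<notin> cball c t2" for x using that \<eta>(5)[of x] by (auto simp: \<zeta>_def)
  have out: "\<zeta>1 i x = 0" "\<zeta>2 i i x = 0" if "x \<notin> cball c t2" "i \<in> Basis" for i x
    using C2_zero_outside[OF C2, of c t2] supp that by blast+
  have "\<exists>B. \<forall>x. \<bar>\<zeta>1 i x\<bar> \<le> B" if "i \<in> Basis" for i
    using compact_support_bounded[OF D(3)[OF that] out(1)[OF _ that]] by metis
  then obtain b where b: "\<And>i x. i \<in> Basis \<Longrightarrow> \<bar>\<zeta>1 i x\<bar> \<le> b i" by metis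
  define l where "l x = (\<Sum>i\<in>Basis. \<zeta>2 i i x)" for x
  have cl: "continuous_on UNIV l" unfolding l_def by (intro continuous_on_sum D)
  have "l x = 0" if "x \<notin> cball c t2" for x using out that by (auto simp: l_def intro!: sum.neutral)
  then obtain B' where B': "B' \<ge> 0" "\<And>x. \<bar>l x\<bar> \<le> B'" using compact_support_bounded[OF cl] by blast
  define B where "B = B' + (\<Sum>i\<in>Basis. b i)"
  have b0: "b i \<ge> 0" if "i \<in> Basis" for i using b[OF that, of c] by linarith
  have bB: "b i \<le> B" if "i \<in> Basis" for i
    using member_le_sum[of i Basis b] that b0 B' by (auto simp: B_def)
  have BB: "B' \<le> B" using b0 by (auto simp: B_def intro!: sum_nonneg)
  show ?thesis
  proof (rule that[OF C2])
    show "0 \<le> \<zeta> x" "\<zeta> x \<le> 1" for x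
      using \<theta>(2,3)[of x] \<eta>(2,3)[of x] by (auto simp: \<zeta>_def intro!: mult_le_one)
    show "\<zeta> x = 0" if "x \<in> ball c s1" for x using \<theta>(4)[of x] that by (simp add: \<zeta>_def)
    show "\<zeta> x = 1" if "x \<in> ball c s2 - cball c t1" for x
      using \<theta>(5)[of x] \<eta>(4)[of x] that by (simp add: \<zeta>_def)
    show "\<bar>\<zeta>1 i x\<bar> \<le> B" if "i \<in> Basis" for x i using b[OF that, of x] bB[OF that] by linarith
    show "\<bar>\<Sum>i\<in>Basis. \<zeta>2 i i x\<bar> \<le> B" for x using B'(2)[of x] BB by (simp add: l_def)
    show "B \<ge> 0" using B' BB by linarith
  qed (rule supp)
qed

lemma powr_two_thirds_cube:
  fixes M :: real
  assumes "M \<ge> 0"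
  shows "(M powr (2/3)) ^ 3 = M\<^sup>2"
proof (cases "M = 0")
  case False
  have "(M powr (2/3)) ^ 3 = (M powr (2/3)) powr 3"
    using False assms by (subst powr_numeral) auto
  also have "\<dots> = M powr 2" by (simp add: powr_powr)
  also have "\<dots> = M\<^sup>2" using False assms by (subst powr_numeral) auto
  finally show ?thesis .
qed simp

text \<open>The origin of the power 2/3: this is the smallest order of magnitude at which
  \<open>\<tau> ^ 3\<close> dominates \<open>M\<^sup>2\<close>, and enlarging \<open>t0\<close>
  absorbs any further constant.\<close>

lemma two_thirds_scale:
  fixes M t0 \<tau> :: real
  assumes t0: "t0 \<ge> 1" and M: "M \<ge> 0" and \<tau>: "\<tau> \<ge> t0 * (1 + M powr (2/3))"
  shows "\<tau> \<ge> 1" "1 + M\<^sup>2 \<le> \<tau> ^ 3" "t0 \<le> \<tau>" "t0 * M\<^sup>2 \<le> \<tau> ^ 3"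
proof -
  define m where "m = M powr (2/3)"
  have m0: "m \<ge> 0" by (simp add: m_def)
  have m3: "m ^ 3 = M\<^sup>2" unfolding m_def by (rule powr_two_thirds_cube[OF M])
  have \<tau>m: "\<tau> \<ge> 1 + m"
    using \<tau> mult_right_mono[OF t0, of "1 + m"] m0 by (simp add: m_def)
  show "\<tau> \<ge> 1" using \<tau>m m0 by linarith
  have "t0 * 1 \<le> t0 * (1 + m)" using t0 m0 by (intro mult_left_mono) auto
  then show "t0 \<le> \<tau>" using \<tau> by (simp add: m_def)
  have "(1 + m) ^ 3 \<le> \<tau> ^ 3" using \<tau>m m0 by (intro power_mono) auto
  moreover have "(1 + m) ^ 3 = 1 + m ^ 3 + 3 * m + 3 * m\<^sup>2"
    by (simp add: power2_eq_square power3_eq_cube algebra_simps)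
  ultimately show "1 + M\<^sup>2 \<le> \<tau> ^ 3" using m0 m3 by (smt (verit) zero_le_power2)
  have "t0 * m \<le> \<tau>" using \<tau> t0 by (simp add: m_def algebra_simps)
  then have "(t0 * m) ^ 3 \<le> \<tau> ^ 3" using t0 m0 by (intro power_mono) auto
  moreover have "t0 * m ^ 3 \<le> t0 ^ 3 * m ^ 3"
    using power_increasing[of 1 3 t0] t0 m0 by (intro mult_right_mono) auto
  ultimately show "t0 * M\<^sup>2 \<le> \<tau> ^ 3" unfolding m3[symmetric] power_mult_distrib by linarith
qed

text \<open>The Carleman estimate is applied to \<open>\<zeta> * Z\<close>, where
  \<open>\<zeta>\<close> is 1 between the radii \<open>r1/2\<close> and \<open>s2\<close>. The
  commutator of the Laplacian with \<open>\<zeta>\<close> lives on two shells: an inner one inside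
  \<open>ball c r1\<close>, where the weight is at most \<open>exp (2 * \<tau>)\<close>, and an
  outer one beyond \<open>s2\<close>, where the weight is smaller than on \<open>ball c r2\<close>
  by the factor \<open>exp (- 2 * a * \<tau>)\<close>.\<close>

lemma three_balls_C2:
  fixes c :: "'a::euclidean_space"
  assumes r: "0 < r1" "r1 < r2" "r2 < R"
  obtains a C t0 where "a > 0" "C \<ge> 0" "t0 \<ge> 1"
    "\<And>Z Z1 Z2 M \<tau>. C2 Z Z1 Z2 \<Longrightarrow> M \<ge> 0 \<Longrightarrow> \<tau> \<ge> t0 * (1 + M powr (2/3)) \<Longrightarrow>
       bint (ball c r2) (\<lambda>x. (Z x)\<^sup>2) \<le> C * (
         exp (2 * \<tau>) * (bint (ball c r1) (\<lambda>x. (Z x)\<^sup>2)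
            + bint (ball c R) (\<lambda>x. (max 0 (\<bar>\<Sum>i\<in>Basis. Z2 i i x\<bar> - M * \<bar>Z x\<bar>))\<^sup>2))
       + exp (- 2 * a * \<tau>) * (bint (ball c R) (\<lambda>x. (Z x)\<^sup>2)
            + bint (ball c R) (\<lambda>x. (max 0 (\<bar>\<Sum>i\<in>Basis. Z2 i i x\<bar> - M * \<bar>Z x\<bar>))\<^sup>2)))"
proof -
  \<comment> \<open>The gap from \<open>r2\<close> to \<open>s2\<close> produces the decay rate
    \<open>a\<close>; the gap from \<open>t2\<close> to \<open>R\<close> gives the Caccioppoli
    inequality room on the outer shell.\<close>
  define s2 t2 where "s2 = (2 * r2 + R) / 3" and "t2 = (r2 + 2 * R) / 3"
  have st: "r2 < s2" "s2 < t2" "t2 < R" "0 < t2" using r by (auto simp: s2_def t2_def field_simps)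
  \<comment> \<open>The gradient of the weight vanishes at its centre, so the Carleman estimate
    needs a function that is zero on a ball around \<open>c\<close>, here of radius
    \<open>r1/4\<close>. The gap from \<open>r1/2\<close> to \<open>r1\<close> is for the
    Caccioppoli inequality on the inner shell.\<close>
  have q: "0 < r1/4" "r1/4 < r1/2" "r1/2 < r1" "r1/2 < s2" "r1/4 \<le> t2" "r1/2 < r2" using r st by auto
  obtain \<zeta> \<zeta>1 \<zeta>2 B where \<zeta>: "C2 \<zeta> \<zeta>1 \<zeta>2" "\<And>x. 0 \<le> \<zeta> x" "\<And>x. \<zeta> x \<le> (1::real)"
    "\<And>x. x \<in> ball c (r1/4) \<Longrightarrow> \<zeta> x = 0" "\<And>x. x \<notin> cball c t2 \<Longrightarrow> \<zeta> x = 0"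
    "\<And>x. x \<in> ball c s2 - cball c (r1/2) \<Longrightarrow> \<zeta> x = 1" "B \<ge> 0"
    "\<And>x i. i \<in> Basis \<Longrightarrow> \<bar>\<zeta>1 i x\<bar> \<le> B" "\<And>x. \<bar>\<Sum>i\<in>Basis. \<zeta>2 i i x\<bar> \<le> B"
    using q(1,2,4) st(2) by (rule exists_annular_cutoff[where c=c]) blast
  define k where "k = 2 / (r1/4)\<^sup>2"
  define \<phi> where "\<phi> = gauss k c"
  obtain d \<tau>0 where d: "d > 0" "\<tau>0 \<ge> 1" and carl:
    "\<And>\<tau> w w1 w2. \<tau> \<ge> \<tau>0 \<Longrightarrow> C2 w w1 w2 \<Longrightarrow> (\<And>x. x \<notin> cball c t2 \<Longrightarrow> w x = 0) \<Longrightarrow>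
       (\<And>x. x \<in> ball c (r1/4) \<Longrightarrow> w x = 0) \<Longrightarrow>
       d * \<tau> ^ 3 * (LINT x|lborel. exp (2 * \<tau> * \<phi> x) * (w x)\<^sup>2)
         \<le> (LINT x|lborel. exp (2 * \<tau> * \<phi> x) * (\<Sum>i\<in>Basis. w2 i i x)\<^sup>2)"
    using q(1,5) unfolding \<phi>_def k_def by (rule carleman_estimate[where c=c]) blast
  obtain K1 where K1: "K1 \<ge> 0" "\<And>Z Z1 Z2 M. C2 Z Z1 Z2 \<Longrightarrow> M \<ge> 0 \<Longrightarrow>
     bint (cball c (r1/2)) (\<lambda>x. (Z x)\<^sup>2 + (\<Sum>i\<in>Basis. (Z1 i x)\<^sup>2))
       \<le> K1 * (M + 2) * (bint (ball c r1) (\<lambda>x. (Z x)\<^sup>2)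
            + bint (ball c r1) (\<lambda>x. (max 0 (\<bar>\<Sum>i\<in>Basis. Z2 i i x\<bar> - M * \<bar>Z x\<bar>))\<^sup>2))"
    using half_gt_zero[OF r(1)] q(3) by (rule caccioppoli_potential[where c=c]) blast
  obtain K2 where K2: "K2 \<ge> 0" "\<And>Z Z1 Z2 M. C2 Z Z1 Z2 \<Longrightarrow> M \<ge> 0 \<Longrightarrow>
     bint (cball c t2) (\<lambda>x. (Z x)\<^sup>2 + (\<Sum>i\<in>Basis. (Z1 i x)\<^sup>2))
       \<le> K2 * (M + 2) * (bint (ball c R) (\<lambda>x. (Z x)\<^sup>2)
            + bint (ball c R) (\<lambda>x. (max 0 (\<bar>\<Sum>i\<in>Basis. Z2 i i x\<bar> - M * \<bar>Z x\<bar>))\<^sup>2))"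
    using st(4,3) by (rule caccioppoli_potential[where c=c]) blast
  define \<Phi> where "\<Phi> r = exp (- k * r\<^sup>2)" for r :: real
  have l: "k > 0" using r by (simp add: k_def)
  have \<phi>\<Phi>: "\<phi> x = \<Phi> (dist c x)" for x
    unfolding \<phi>_def \<Phi>_def gauss_def by (metis dist_norm dist_commute power2_norm_eq_inner)
  have \<Phi>mono: "\<Phi> s \<le> \<Phi> t" if "0 \<le> t" "t \<le> s" for s t
    unfolding \<Phi>_def using that l by (auto intro!: mult_left_mono power_mono)
  have \<Phi>1: "\<Phi> s \<le> 1" for s unfolding \<Phi>_def using l by simp
  have \<Phi>0: "\<Phi> s > 0" for s unfolding \<Phi>_def by simp
  \<comment> \<open>Half the exponential rate by which the weight at radius \<open>s2\<close> falls
    below the weight at radius \<open>r2\<close>.\<close>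
  define a where "a = \<Phi> r2 - \<Phi> s2"
  have a: "a > 0"
  proof -
    have "r2\<^sup>2 < s2\<^sup>2" using r st by (intro power_strict_mono) auto
    then show ?thesis unfolding a_def \<Phi>_def using l by simp
  qed
  define n where "n = real DIM('a)"
  \<comment> \<open>The commutator is \<open>T = l * Z + 2 * N\<close>, whose square is at most
    \<open>2 * (l * Z)\<^sup>2 + 8 * N\<^sup>2\<close>; Cauchy-Schwarz over the \<open>n\<close>
    directions then bounds \<open>N\<^sup>2\<close>.\<close>
  define B' where "B' = 2 * B\<^sup>2 + 8 * (n * B\<^sup>2)"
  have B': "B' \<ge> 0" unfolding B'_def n_def by simp
  \<comment> \<open>With \<open>6 / d\<close> the potential term \<open>3 * M\<^sup>2\<close> is at
    most half of \<open>d * \<tau> ^ 3\<close> and moves to the left side.\<close>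
  define t0 where "t0 = max \<tau>0 (6 / d)"
  define C where "C = 2 / d * (3 + 9 * B' * K1) + 1 + 2 / d * (9 * B' * K2)"
  have C: "C \<ge> 0" unfolding C_def using d B' K1(1) K2(1) by simp
  show ?thesis
  proof (rule that[OF a C, of t0])
    show "t0 \<ge> 1" using d by (simp add: t0_def)
    fix Z :: "'a \<Rightarrow> real" and Z1 Z2 and M \<tau> :: real
    assume Z: "C2 Z Z1 Z2" and M: "M \<ge> 0" and \<tau>: "\<tau> \<ge> t0 * (1 + M powr (2/3))"
    have t01: "t0 \<ge> 1" using d by (simp add: t0_def)
    note scale = two_thirds_scale[OF t01 M \<tau>]
    have \<tau>1: "\<tau> \<ge> 1" and t3: "\<tau> ^ 3 \<ge> 1 + M\<^sup>2" using scale(1,2) .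
    have \<tau>\<tau>0: "\<tau> \<ge> \<tau>0" using scale(3) by (simp add: t0_def)
    have M2: "M + 2 \<le> 3 * \<tau> ^ 3"
    proof -
      have "2 * M \<le> 1 + M\<^sup>2" using zero_le_power2[of "M - 1"] by (simp add: power2_eq_square algebra_simps)
      then show ?thesis using t3 zero_le_power2[of M] by linarith
    qed
    have dM: "d * \<tau> ^ 3 \<ge> 6 * M\<^sup>2"
    proof -
      have "6 / d * M\<^sup>2 \<le> t0 * M\<^sup>2" by (intro mult_right_mono) (auto simp: t0_def)
      then have "6 / d * M\<^sup>2 \<le> \<tau> ^ 3" using scale(4) by (rule order_trans)
      then show ?thesis using d by (simp add: field_simps)
    qed
    define L where "L x = (\<Sum>i\<in>Basis. Z2 i i x)" for x
    define g where "g x = max 0 (\<bar>L x\<bar> - M * \<bar>Z x\<bar>)" for x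
    define G where "G x = (\<Sum>i\<in>Basis. (Z1 i x)\<^sup>2)" for x
    define w where "w x = \<zeta> x * Z x" for x
    define w2 where "w2 i j x = \<zeta>2 i j x * Z x + \<zeta>1 i x * Z1 j x + (\<zeta>1 j x * Z1 i x + \<zeta> x * Z2 i j x)" for i j x
    have w: "C2 w (\<lambda>i x. \<zeta>1 i x * Z x + \<zeta> x * Z1 i x) w2"
      using C2_mult[OF \<zeta>(1) Z] unfolding w_def[abs_def] w2_def[abs_def] .
    define l where "l x = (\<Sum>i\<in>Basis. \<zeta>2 i i x)" for x
    define N where "N x = (\<Sum>i\<in>Basis. \<zeta>1 i x * Z1 i x)" for x
    define T where "T x = l x * Z x + 2 * N x" for x
    note [continuous_intros] = C2D(1,3,5)[OF Z] C2D(1,3,5)[OF \<zeta>(1)] C2D(1,3,5)[OF w]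
    have [continuous_intros]: "continuous_on UNIV L" "continuous_on UNIV g" "continuous_on UNIV G" "continuous_on UNIV \<phi>"
      "continuous_on UNIV l" "continuous_on UNIV N" "continuous_on UNIV T"
      unfolding L_def g_def G_def l_def N_def T_def \<phi>_def gauss_def by (auto intro!: continuous_intros)
    have lapw: "(\<Sum>i\<in>Basis. w2 i i x) = \<zeta> x * L x + T x" for x
      unfolding w2_def L_def T_def l_def N_def by (simp add: sum.distrib sum_distrib_left sum_distrib_right ac_simps)
    have G0: "G x \<ge> 0" for x unfolding G_def by (intro sum_nonneg) auto
    define E where "E x = exp (2 * \<tau> * \<phi> x)" for x
    have [continuous_intros]: "continuous_on UNIV E" unfolding E_def by (auto intro!: continuous_intros)
    have E0: "E x > 0" for x by (simp add: E_def)
    have E1: "E x \<le> exp (2 * \<tau>)" for x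
      unfolding E_def \<phi>\<Phi> using \<Phi>1[of "dist c x"] \<tau>1 by simp
    have supp: "\<zeta> x = 0" "w x = 0" "T x = 0" if "x \<notin> cball c t2" for x
    proof -
      show "\<zeta> x = 0" "w x = 0" using \<zeta>(5)[OF that] by (simp_all add: w_def)
      show "T x = 0" using C2_zero_outside[OF \<zeta>(1), of c t2] \<zeta>(5) that
        unfolding T_def l_def N_def by (auto intro!: sum.neutral)
    qed
    have Tmid: "T x = 0" if x: "x \<in> ball c s2 - cball c (r1/2)" for x
    proof -
      have U: "open (ball c s2 - cball c (r1/2))" by auto
      have "\<zeta>1 i x = 0" "\<zeta>2 i i x = 0" if "i \<in> Basis" for i
        using C2_const_open[OF \<zeta>(1) U \<zeta>(6) x that] that by blast+
      then show ?thesis unfolding T_def l_def N_def by (auto intro!: sum.neutral)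
    qed
    have T2: "(T x)\<^sup>2 \<le> B' * ((Z x)\<^sup>2 + G x)" for x
    proof -
      have "(T x)\<^sup>2 \<le> 2 * (l x * Z x)\<^sup>2 + 2 * (2 * N x)\<^sup>2"
        unfolding T_def using zero_le_power2[of "l x * Z x - 2 * N x"] by (simp add: power2_eq_square algebra_simps)
      also have "(l x * Z x)\<^sup>2 \<le> B\<^sup>2 * (Z x)\<^sup>2"
        unfolding power_mult_distrib using \<zeta>(9)[of x] by (intro mult_right_mono) (auto simp: l_def abs_le_square_iff[symmetric] \<zeta>(7))
      also have "(N x)\<^sup>2 \<le> (n * B\<^sup>2) * G x"
      proof -
        have "(N x)\<^sup>2 \<le> (\<Sum>i\<in>Basis. (\<zeta>1 i x)\<^sup>2) * G x"
          unfolding N_def G_def by (rule Cauchy_Schwarz_ineq_sum)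
        also have "(\<Sum>i\<in>Basis. (\<zeta>1 i x)\<^sup>2) \<le> (\<Sum>i\<in>(Basis::'a set). B\<^sup>2)"
          using \<zeta>(8) by (intro sum_mono) (auto simp: abs_le_square_iff[symmetric] \<zeta>(7))
        finally show ?thesis using G0[of x] by (simp add: n_def mult_right_mono)
      qed
      then have "(2 * N x)\<^sup>2 \<le> 4 * ((n * B\<^sup>2) * G x)" by (simp add: power_mult_distrib)
      finally have "(T x)\<^sup>2 \<le> 2 * B\<^sup>2 * (Z x)\<^sup>2 + 8 * (n * B\<^sup>2) * G x" by simp
      also have "\<dots> \<le> B' * (Z x)\<^sup>2 + B' * G x"
        unfolding B'_def n_def using G0[of x] by (intro add_mono mult_right_mono) auto
      finally show ?thesis by (simp add: distrib_left)
    qed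
    define Y1 where "Y1 = bint (ball c r1) (\<lambda>x. (Z x)\<^sup>2) + bint (ball c R) (\<lambda>x. (g x)\<^sup>2)"
    define Y2 where "Y2 = bint (ball c R) (\<lambda>x. (Z x)\<^sup>2) + bint (ball c R) (\<lambda>x. (g x)\<^sup>2)"
    have nn: "bint S (\<lambda>x. (Z x)\<^sup>2) \<ge> 0" "bint S (\<lambda>x. (g x)\<^sup>2) \<ge> 0" for S
      by (intro bint_nonneg; simp)+
    have int: "integrable lborel (\<lambda>x. indicator S x * (Z x)\<^sup>2)" "integrable lborel (\<lambda>x. indicator S x * (g x)\<^sup>2)"
      "integrable lborel (\<lambda>x. indicator S x * ((Z x)\<^sup>2 + G x))"
      if "bounded S" "S \<in> sets borel" for S
      using that by (intro bint_integrable continuous_intros; simp)+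
    have tp: "0 \<le> \<tau> ^ 3" using \<tau>1 by simp
    have c1: "bint (cball c (r1/2)) (\<lambda>x. (Z x)\<^sup>2 + G x) \<le> K1 * (3 * \<tau> ^ 3) * Y1"
    proof -
      have "bint (cball c (r1/2)) (\<lambda>x. (Z x)\<^sup>2 + G x) \<le> K1 * (M + 2) *
          (bint (ball c r1) (\<lambda>x. (Z x)\<^sup>2) + bint (ball c r1) (\<lambda>x. (g x)\<^sup>2))"
        unfolding G_def g_def L_def by (rule K1(2)[OF Z M])
      also have "\<dots> \<le> K1 * (3 * \<tau> ^ 3) * Y1"
        unfolding Y1_def using r K1(1) M2 M nn tp
        by (intro mult_mono add_mono mult_left_mono order_refl bint_mono int) auto
      finally show ?thesis .
    qed
    have c2: "bint (cball c t2) (\<lambda>x. (Z x)\<^sup>2 + G x) \<le> K2 * (3 * \<tau> ^ 3) * Y2"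
    proof -
      have "bint (cball c t2) (\<lambda>x. (Z x)\<^sup>2 + G x) \<le> K2 * (M + 2) * Y2"
        unfolding Y2_def G_def g_def L_def by (rule K2(2)[OF Z M])
      also have "\<dots> \<le> K2 * (3 * \<tau> ^ 3) * Y2"
        using K2(1) M2 M nn tp by (intro mult_mono mult_left_mono order_refl) (auto simp: Y2_def)
      finally show ?thesis .
    qed
    have iE: "integrable lborel (\<lambda>x. E x * (w x)\<^sup>2)" "integrable lborel (\<lambda>x. E x * (\<zeta> x * g x)\<^sup>2)"
      "integrable lborel (\<lambda>x. E x * (T x)\<^sup>2)" "integrable lborel (\<lambda>x. E x * (\<Sum>i\<in>Basis. w2 i i x)\<^sup>2)"
      by (rule integrable_compact_support[where c=c and R=t2];
          use supp in \<open>auto intro!: continuous_intros simp: lapw\<close>)+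
    have lap2: "E x * (\<Sum>i\<in>Basis. w2 i i x)\<^sup>2 \<le> 3 * M\<^sup>2 * (E x * (w x)\<^sup>2) + 3 * (E x * (\<zeta> x * g x)\<^sup>2) + 3 * (E x * (T x)\<^sup>2)" for x
    proof -
      define p q s where "p = M * \<bar>w x\<bar>" and "q = \<zeta> x * g x" and "s = \<bar>T x\<bar>"
      have "\<bar>L x\<bar> \<le> M * \<bar>Z x\<bar> + g x" by (simp add: g_def)
      then have "\<zeta> x * \<bar>L x\<bar> \<le> \<zeta> x * (M * \<bar>Z x\<bar> + g x)" using \<zeta>(2)[of x] by (intro mult_left_mono)
      then have "\<bar>\<zeta> x * L x + T x\<bar> \<le> p + q + s"
        unfolding p_def q_def s_def w_def using \<zeta>(2)[of x] by (auto simp: abs_mult algebra_simps intro: order_trans[OF abs_triangle_ineq])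
      then have "(\<zeta> x * L x + T x)\<^sup>2 \<le> (p + q + s)\<^sup>2"
        by (metis abs_ge_zero power2_abs power_mono)
      also have "\<dots> \<le> 3 * p\<^sup>2 + 3 * q\<^sup>2 + 3 * s\<^sup>2"
        using zero_le_power2[of "p - q"] zero_le_power2[of "q - s"] zero_le_power2[of "p - s"]
        by (simp add: power2_eq_square algebra_simps)
      finally have "E x * (\<zeta> x * L x + T x)\<^sup>2 \<le> E x * (3 * p\<^sup>2 + 3 * q\<^sup>2 + 3 * s\<^sup>2)"
        using E0[of x] by (intro mult_left_mono) auto
      then show ?thesis unfolding lapw p_def q_def s_def by (simp add: algebra_simps power_mult_distrib)
    qed
    define IW where "IW = (LINT x|lborel. E x * (w x)\<^sup>2)"
    have IW0: "IW \<ge> 0" unfolding IW_def using E0 by (intro Bochner_Integration.integral_nonneg) (simp add: less_imp_le)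
    have main1: "d / 2 * \<tau> ^ 3 * IW \<le> 3 * (LINT x|lborel. E x * (\<zeta> x * g x)\<^sup>2) + 3 * (LINT x|lborel. E x * (T x)\<^sup>2)"
    proof -
      have "d * \<tau> ^ 3 * IW \<le> (LINT x|lborel. E x * (\<Sum>i\<in>Basis. w2 i i x)\<^sup>2)"
        unfolding IW_def E_def using supp(2) \<zeta>(4) by (intro carl[OF \<tau>\<tau>0 w]) (auto simp: w_def)
      also have "\<dots> \<le> (LINT x|lborel. 3 * M\<^sup>2 * (E x * (w x)\<^sup>2) + 3 * (E x * (\<zeta> x * g x)\<^sup>2) + 3 * (E x * (T x)\<^sup>2))"
        using iE by (intro integral_mono lap2) auto
      also have "\<dots> = 3 * M\<^sup>2 * IW + 3 * (LINT x|lborel. E x * (\<zeta> x * g x)\<^sup>2) + 3 * (LINT x|lborel. E x * (T x)\<^sup>2)"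
        unfolding IW_def using iE by simp
      finally have "d * \<tau> ^ 3 * IW \<le> \<dots>" .
      moreover have "6 * M\<^sup>2 * IW \<le> d * \<tau> ^ 3 * IW" using dM IW0 by (intro mult_right_mono) auto
      ultimately show ?thesis by simp
    qed
    have g1: "(LINT x|lborel. E x * (\<zeta> x * g x)\<^sup>2) \<le> exp (2 * \<tau>) * Y1"
    proof -
      have "(LINT x|lborel. E x * (\<zeta> x * g x)\<^sup>2) \<le> (LINT x|lborel. indicator (ball c R) x * (exp (2 * \<tau>) * (g x)\<^sup>2))"
      proof (intro integral_mono iE(2))
        show "integrable lborel (\<lambda>x. indicator (ball c R) x * (exp (2 * \<tau>) * (g x)\<^sup>2))"
          by (intro bint_integrable continuous_intros) auto
        show "E x * (\<zeta> x * g x)\<^sup>2 \<le> indicator (ball c R) x * (exp (2 * \<tau>) * (g x)\<^sup>2)" for x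
        proof (cases "x \<in> cball c t2")
          case True
          have "(\<zeta> x)\<^sup>2 \<le> 1" using \<zeta>(2,3)[of x] by (simp add: power_le_one)
          then have "(\<zeta> x * g x)\<^sup>2 \<le> 1 * (g x)\<^sup>2" unfolding power_mult_distrib by (intro mult_right_mono) auto
          then have "E x * (\<zeta> x * g x)\<^sup>2 \<le> exp (2 * \<tau>) * (1 * (g x)\<^sup>2)"
            using E1[of x] E0[of x] by (intro mult_mono) auto
          moreover have "x \<in> ball c R" using True st by auto
          ultimately show ?thesis by simp
        qed (use supp in auto)
      qed
      also have "\<dots> = exp (2 * \<tau>) * bint (ball c R) (\<lambda>x. (g x)\<^sup>2)"
        unfolding bint_def[symmetric] by (rule bint_cmult)
      also have "\<dots> \<le> exp (2 * \<tau>) * Y1" unfolding Y1_def using nn by (intro mult_left_mono) auto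
      finally show ?thesis .
    qed
    define e2 where "e2 = exp (2 * \<tau> * \<Phi> s2)"
    have T1: "(LINT x|lborel. E x * (T x)\<^sup>2) \<le> B' * (exp (2 * \<tau>) * (K1 * (3 * \<tau> ^ 3) * Y1) + e2 * (K2 * (3 * \<tau> ^ 3) * Y2))"
    proof -
      let ?h = "\<lambda>x. (Z x)\<^sup>2 + G x"
      have "(LINT x|lborel. E x * (T x)\<^sup>2) \<le> (LINT x|lborel. (B' * exp (2 * \<tau>)) * (indicator (cball c (r1/2)) x * ?h x)
          + (B' * e2) * (indicator (cball c t2) x * ?h x))"
      proof (intro integral_mono iE(3))
        show "integrable lborel (\<lambda>x. (B' * exp (2 * \<tau>)) * (indicator (cball c (r1/2)) x * ?h x)
          + (B' * e2) * (indicator (cball c t2) x * ?h x))"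
          by (intro Bochner_Integration.integrable_add integrable_mult_right int) auto
        show "E x * (T x)\<^sup>2 \<le> (B' * exp (2 * \<tau>)) * (indicator (cball c (r1/2)) x * ?h x)
          + (B' * e2) * (indicator (cball c t2) x * ?h x)" for x
        proof -
          have h0: "?h x \<ge> 0" using G0[of x] by simp
          consider "x \<in> cball c (r1/2)" | "x \<in> ball c s2 - cball c (r1/2)" | "x \<notin> cball c t2" | "x \<notin> ball c s2" "x \<in> cball c t2"
            by blast
          then show ?thesis
          proof cases
            case 1
            have "E x * (T x)\<^sup>2 \<le> exp (2 * \<tau>) * (B' * ?h x)"
              using E1[of x] E0[of x] T2[of x] by (intro mult_mono) auto
            moreover have "0 \<le> (B' * e2) * (indicator (cball c t2) x * ?h x)"
              using h0 B' by (auto simp: e2_def indicator_def)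
            ultimately show ?thesis using 1 by (simp add: ac_simps)
          next
            case 4
            have "\<phi> x \<le> \<Phi> s2" unfolding \<phi>\<Phi> using 4 r st by (intro \<Phi>mono) auto
            then have "E x \<le> e2" unfolding E_def e2_def using \<tau>1 by simp
            then have "E x * (T x)\<^sup>2 \<le> e2 * (B' * ?h x)"
              using E0[of x] T2[of x] by (intro mult_mono) (auto simp: e2_def)
            moreover have "0 \<le> (B' * exp (2 * \<tau>)) * (indicator (cball c (r1/2)) x * ?h x)"
              using h0 B' by (auto simp: indicator_def)
            ultimately show ?thesis using 4 by (simp add: ac_simps)
          qed (use Tmid supp h0 B' in \<open>auto simp: e2_def indicator_def\<close>)
        qed
      qed
      also have "\<dots> = B' * exp (2 * \<tau>) * bint (cball c (r1/2)) ?h + B' * e2 * bint (cball c t2) ?h"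
        unfolding bint_def by (subst Bochner_Integration.integral_add) (auto intro!: int)
      also have "\<dots> \<le> B' * exp (2 * \<tau>) * (K1 * (3 * \<tau> ^ 3) * Y1) + B' * e2 * (K2 * (3 * \<tau> ^ 3) * Y2)"
        using B' by (intro add_mono mult_left_mono c1 c2) (auto simp: e2_def)
      finally show ?thesis by (simp add: algebra_simps)
    qed
    have Y0: "Y1 \<ge> 0" "Y2 \<ge> 0" using nn by (auto simp: Y1_def Y2_def)
    define A where "A = ball c r2 - cball c (r1/2)"
    have Ab: "bounded A" "A \<in> sets borel" by (auto simp: A_def intro: bounded_subset[OF bounded_ball])
    define J where "J = bint A (\<lambda>x. (Z x)\<^sup>2)"
    have low: "exp (2 * \<tau> * \<Phi> r2) * J \<le> IW"
    proof -
      have "exp (2 * \<tau> * \<Phi> r2) * J = (LINT x|lborel. indicator A x * (exp (2 * \<tau> * \<Phi> r2) * (Z x)\<^sup>2))"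
        unfolding J_def bint_def[symmetric] by (rule bint_cmult[symmetric])
      also have "\<dots> \<le> IW" unfolding IW_def
      proof (intro integral_mono iE(1))
        show "integrable lborel (\<lambda>x. indicator A x * (exp (2 * \<tau> * \<Phi> r2) * (Z x)\<^sup>2))"
          by (intro bint_integrable continuous_intros Ab)
        show "indicator A x * (exp (2 * \<tau> * \<Phi> r2) * (Z x)\<^sup>2) \<le> E x * (w x)\<^sup>2" for x
        proof (cases "x \<in> A")
          case True
          then have "\<zeta> x = 1" using st by (intro \<zeta>(6)) (auto simp: A_def)
          moreover have "\<Phi> r2 \<le> \<phi> x" unfolding \<phi>\<Phi> using True by (intro \<Phi>mono) (auto simp: A_def)
          then have "exp (2 * \<tau> * \<Phi> r2) \<le> E x" unfolding E_def using \<tau>1 by simp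
          ultimately show ?thesis using True by (simp add: w_def mult_right_mono)
        qed (use E0[of x] in auto)
      qed
      finally show ?thesis .
    qed
    have t31: "\<tau> ^ 3 \<ge> 1" using \<tau>1 by simp
    define e1 where "e1 = exp (2 * \<tau>)"
    \<comment> \<open>The Caccioppoli factor, bounded by \<open>3 * \<tau> ^ 3\<close>, is paid for
      exactly by the Carleman gain: every term carries at most \<open>\<tau> ^ 3\<close>, which is
      divided out, so no power of \<open>M\<close> survives.\<close>
    have "\<tau> ^ 3 * (d / 2 * (exp (2 * \<tau> * \<Phi> r2) * J)) = d / 2 * \<tau> ^ 3 * (exp (2 * \<tau> * \<Phi> r2) * J)" by simp
    also have "\<dots> \<le> d / 2 * \<tau> ^ 3 * IW"
      using low d \<tau>1 by (intro mult_left_mono) auto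
    also have "\<dots> \<le> 3 * (e1 * Y1) + 3 * (B' * (e1 * (K1 * (3 * \<tau> ^ 3) * Y1) + e2 * (K2 * (3 * \<tau> ^ 3) * Y2)))"
      using main1 g1 T1 unfolding e1_def by linarith
    also have "\<dots> \<le> \<tau> ^ 3 * (3 * (e1 * Y1)) + 3 * (B' * (e1 * (K1 * (3 * \<tau> ^ 3) * Y1) + e2 * (K2 * (3 * \<tau> ^ 3) * Y2)))"
      using mult_right_mono[OF t31, of "3 * (e1 * Y1)"] Y0 by (simp add: e1_def)
    also have "\<dots> = \<tau> ^ 3 * ((3 + 9 * B' * K1) * (e1 * Y1) + 9 * B' * K2 * (e2 * Y2))"
      by (simp add: algebra_simps)
    finally have "d / 2 * (exp (2 * \<tau> * \<Phi> r2) * J) \<le> (3 + 9 * B' * K1) * (e1 * Y1) + 9 * B' * K2 * (e2 * Y2)"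
      using \<tau>1 by (subst (asm) mult_le_cancel_left_pos) auto
    then have J1: "exp (2 * \<tau> * \<Phi> r2) * J \<le> 2 / d * (3 + 9 * B' * K1) * (e1 * Y1) + 2 / d * (9 * B' * K2) * (e2 * Y2)"
      using d by (simp add: field_simps)
    have "J = exp (- (2 * \<tau> * \<Phi> r2)) * (exp (2 * \<tau> * \<Phi> r2) * J)" by (simp add: exp_minus)
    also have "\<dots> \<le> exp (- (2 * \<tau> * \<Phi> r2)) * (2 / d * (3 + 9 * B' * K1) * (e1 * Y1) + 2 / d * (9 * B' * K2) * (e2 * Y2))"
      using J1 by (intro mult_left_mono) auto
    also have "\<dots> = 2 / d * (3 + 9 * B' * K1) * (exp (- (2 * \<tau> * \<Phi> r2)) * e1 * Y1)
        + 2 / d * (9 * B' * K2) * (exp (- (2 * \<tau> * \<Phi> r2)) * e2 * Y2)" by (simp add: algebra_simps)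
    also have "\<dots> \<le> 2 / d * (3 + 9 * B' * K1) * (e1 * Y1) + 2 / d * (9 * B' * K2) * (exp (- 2 * a * \<tau>) * Y2)"
    proof (intro add_mono mult_left_mono mult_right_mono Y0)
      have "0 \<le> 2 * \<tau> * \<Phi> r2" using \<tau>1 \<Phi>0[of r2] by simp
      then show "exp (- (2 * \<tau> * \<Phi> r2)) * e1 \<le> e1" by (simp add: e1_def)
      show "exp (- (2 * \<tau> * \<Phi> r2)) * e2 \<le> exp (- 2 * a * \<tau>)"
        unfolding e2_def a_def exp_add[symmetric] by (simp add: algebra_simps)
    qed (use d B' K1(1) K2(1) in auto)
    finally have J2: "J \<le> 2 / d * (3 + 9 * B' * K1) * (e1 * Y1) + 2 / d * (9 * B' * K2) * (exp (- 2 * a * \<tau>) * Y2)" .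
    \<comment> \<open>The part of \<open>ball c r2\<close> not covered by \<open>A\<close> has
      radius \<open>r1/2\<close> and lies in \<open>ball c r1\<close>.\<close>
    have J3: "bint (ball c r2) (\<lambda>x. (Z x)\<^sup>2) \<le> bint (ball c r1) (\<lambda>x. (Z x)\<^sup>2) + J"
    proof -
      have "bint (ball c r2) (\<lambda>x. (Z x)\<^sup>2) \<le> (LINT x|lborel. indicator (ball c r1) x * (Z x)\<^sup>2 + indicator A x * (Z x)\<^sup>2)"
        unfolding bint_def using r
        by (intro integral_mono Bochner_Integration.integrable_add int Ab) (auto simp: indicator_def A_def)
      also have "\<dots> = bint (ball c r1) (\<lambda>x. (Z x)\<^sup>2) + J"
        unfolding J_def bint_def by (intro Bochner_Integration.integral_add int Ab) auto
      finally show ?thesis .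
    qed
    have "bint (ball c r1) (\<lambda>x. (Z x)\<^sup>2) \<le> 1 * (e1 * Y1)"
    proof -
      have "1 * Y1 \<le> e1 * Y1" using \<tau>1 Y0 by (intro mult_right_mono) (auto simp: e1_def)
      then show ?thesis using nn(2)[of "ball c R"] by (simp add: Y1_def)
    qed
    then have "bint (ball c r2) (\<lambda>x. (Z x)\<^sup>2) \<le> (2 / d * (3 + 9 * B' * K1) + 1) * (e1 * Y1) + 2 / d * (9 * B' * K2) * (exp (- 2 * a * \<tau>) * Y2)"
      using J2 J3 unfolding distrib_right by linarith
    also have "\<dots> \<le> C * (e1 * Y1) + C * (exp (- 2 * a * \<tau>) * Y2)"
    proof (intro add_mono mult_right_mono)
      have "2 / d * (3 + 9 * B' * K1) \<ge> 0" "2 / d * (9 * B' * K2) \<ge> 0" using d B' K1(1) K2(1) by simp_all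
      then show "2 / d * (3 + 9 * B' * K1) + 1 \<le> C" "2 / d * (9 * B' * K2) \<le> C" unfolding C_def by linarith+
    qed (use Y0 in \<open>auto simp: e1_def\<close>)
    finally show "bint (ball c r2) (\<lambda>x. (Z x)\<^sup>2) \<le> C * (
         exp (2 * \<tau>) * (bint (ball c r1) (\<lambda>x. (Z x)\<^sup>2)
            + bint (ball c R) (\<lambda>x. (max 0 (\<bar>\<Sum>i\<in>Basis. Z2 i i x\<bar> - M * \<bar>Z x\<bar>))\<^sup>2))
       + exp (- 2 * a * \<tau>) * (bint (ball c R) (\<lambda>x. (Z x)\<^sup>2)
            + bint (ball c R) (\<lambda>x. (max 0 (\<bar>\<Sum>i\<in>Basis. Z2 i i x\<bar> - M * \<bar>Z x\<bar>))\<^sup>2)))"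
      unfolding Y1_def Y2_def e1_def g_def L_def by (simp add: distrib_left)
  qed
qed

section \<open>Test functions\<close>

lemma test_functions_C_k: "v \<in> test_functions \<Omega> \<Longrightarrow> C_k k v"
  by (simp add: test_functions_def)

lemma test_functions_continuous: "v \<in> test_functions \<Omega> \<Longrightarrow> continuous_on UNIV v"
  using test_functions_C_k[of v \<Omega> 0] by simp

lemma test_functions_zero: "v \<in> test_functions \<Omega> \<Longrightarrow> x \<notin> \<Omega> \<Longrightarrow> v x = 0"
  using closure_subset[of "{x. v x \<noteq> 0}"] by (auto simp: test_functions_def)

lemma test_functions_bounded_support:
  assumes "v \<in> test_functions \<Omega>"
  obtains R where "\<And>x. x \<notin> cball 0 R \<Longrightarrow> v x = 0"
proof -
  have "bounded (closure {x. v x \<noteq> 0})"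
    using assms compact_imp_bounded by (auto simp: test_functions_def)
  then obtain R where "\<And>x. x \<in> closure {x. v x \<noteq> 0} \<Longrightarrow> dist 0 x \<le> R"
    unfolding bounded_any_center[where a=0] by auto
  then show ?thesis
    using that[of R] closure_subset[of "{x. v x \<noteq> 0}"] by (auto simp: subset_eq)
qed

lemma test_functionsI:
  assumes "\<And>k. C_k k v" "compact K" "K \<subseteq> \<Omega>" "\<And>x. x \<notin> K \<Longrightarrow> v x = 0"
  shows "v \<in> test_functions \<Omega>"
proof -
  have "closure {x. v x \<noteq> 0} \<subseteq> K"
    using assms(2,4) by (intro closure_minimal compact_imp_closed) auto
  moreover from this have "compact (closure {x. v x \<noteq> 0})"
    using compact_Int_closed[OF assms(2), of "closure {x. v x \<noteq> 0}"] by (simp add: Int_absorb1)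
  ultimately show ?thesis
    using assms(1,3) unfolding test_functions_def by auto
qed

lemma test_functions_compact:
  assumes "v \<in> test_functions \<Omega>"
  obtains K where "compact K" "K \<subseteq> \<Omega>" "\<And>x. x \<notin> K \<Longrightarrow> v x = 0"
proof (rule that)
  show "compact (closure {x. v x \<noteq> 0})" "closure {x. v x \<noteq> 0} \<subseteq> \<Omega>"
    using assms by (simp_all add: test_functions_def)
  show "v x = 0" if "x \<notin> closure {x. v x \<noteq> 0}" for x
    using closure_subset[of "{x. v x \<noteq> 0}"] that by blast
qed

lemma test_functions_add:
  assumes "v \<in> test_functions \<Omega>" "w \<in> test_functions \<Omega>"
  shows "(\<lambda>x. v x + w x) \<in> test_functions \<Omega>"
proof -
  obtain K L where "compact K" "K \<subseteq> \<Omega>" "\<And>x. x \<notin> K \<Longrightarrow> v x = 0" "compact L" "L \<subseteq> \<Omega>" "\<And>x. x \<notin> L \<Longrightarrow> w x = 0"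
    using test_functions_compact[OF assms(1)] test_functions_compact[OF assms(2)] by metis
  then show ?thesis
    by (intro test_functionsI[of _ "K \<union> L"] C_k_add test_functions_C_k[OF assms(1)] test_functions_C_k[OF assms(2)]) auto
qed

lemma test_functions_linear:
  assumes "v \<in> test_functions \<Omega>" and L: "bounded_linear L"
  shows "(\<lambda>x. L (v x)) \<in> test_functions \<Omega>"
proof -
  obtain K where "compact K" "K \<subseteq> \<Omega>" "\<And>x. x \<notin> K \<Longrightarrow> v x = 0"
    using test_functions_compact[OF assms(1)] by metis
  then show ?thesis
    using linear_0[OF bounded_linear.linear[OF L]]
    by (intro test_functionsI[of _ K] C_k_linear[OF L] test_functions_C_k[OF assms(1)]) auto
qed

lemma test_functions_cmult:
  "v \<in> test_functions \<Omega> \<Longrightarrow> (\<lambda>x. c * v x) \<in> test_functions \<Omega>" for c :: real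
  by (rule test_functions_linear[OF _ bounded_linear_mult_right])

lemma test_functions_mono: "v \<in> test_functions S \<Longrightarrow> S \<subseteq> T \<Longrightarrow> v \<in> test_functions T"
  by (auto simp: test_functions_def)

lemma test_functions_dd:
  fixes v :: "'a::euclidean_space \<Rightarrow> real"
  shows "v \<in> test_functions \<Omega> \<Longrightarrow> dd i v (partial_deriv i v)"
  by (rule C_k_imp_dd[of 0]) (rule test_functions_C_k)

lemma test_functions_partial:
  fixes v :: "'a::euclidean_space \<Rightarrow> real"
  assumes v: "v \<in> test_functions \<Omega>" and i: "i \<in> Basis"
  shows "partial_deriv i v \<in> test_functions \<Omega>"
proof -
  obtain K where K: "compact K" "K \<subseteq> \<Omega>" "\<And>x. x \<notin> K \<Longrightarrow> v x = 0"
    using test_functions_compact[OF v] by metis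
  have "C_k k (partial_deriv i v)" for k using test_functions_C_k[OF v, of "Suc k"] i by simp
  moreover have "partial_deriv i v x = 0" if "x \<notin> K" for x
    using dd_const_open[OF test_functions_dd[OF v], of "- K" 0 x] K that compact_imp_closed[OF K(1)] by (auto simp: open_Compl)
  ultimately show ?thesis using K by (intro test_functionsI[of _ K])
qed

lemma test_functions_commute:
  fixes v :: "'a::euclidean_space \<Rightarrow> real"
  assumes v: "v \<in> test_functions \<Omega>" and "i \<in> Basis" "j \<in> Basis"
  shows "partial_deriv i (partial_deriv j v) = partial_deriv j (partial_deriv i v)"
proof
  fix x
  note p = test_functions_partial[OF v]
  show "partial_deriv i (partial_deriv j v) x = partial_deriv j (partial_deriv i v) x"
    using assms
    by (intro dd_commute[OF test_functions_dd[OF v] test_functions_dd[OF v] test_functions_dd[OF p] test_functions_dd[OF p]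
        test_functions_continuous[OF test_functions_partial[OF p]] test_functions_continuous[OF test_functions_partial[OF p]]])
qed

definition laplacian :: "('a::euclidean_space \<Rightarrow> real) \<Rightarrow> 'a \<Rightarrow> real" where
  "laplacian v x = (\<Sum>i\<in>Basis. partial_deriv i (partial_deriv i v) x)"

lemma laplacian_continuous: "v \<in> test_functions \<Omega> \<Longrightarrow> continuous_on UNIV (laplacian v)"
  unfolding laplacian_def[abs_def] by (intro continuous_on_sum test_functions_continuous test_functions_partial)

lemma laplacian_zero: "v \<in> test_functions \<Omega> \<Longrightarrow> x \<notin> \<Omega> \<Longrightarrow> laplacian v x = 0"
  unfolding laplacian_def by (intro sum.neutral ballI test_functions_zero[of _ \<Omega>] test_functions_partial)

lemma laplacian_add_cmult:
  assumes v: "v \<in> test_functions \<Omega>" and w: "w \<in> test_functions \<Omega>"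
  shows "laplacian (\<lambda>x. v x + t * w x) x = laplacian v x + t * laplacian w x"
proof -
  have 1: "partial_deriv i (\<lambda>x. v x + t * w x) = (\<lambda>x. partial_deriv i v x + t * partial_deriv i w x)"
    if v: "v \<in> test_functions \<Omega>" and w: "w \<in> test_functions \<Omega>" for v w :: "'a \<Rightarrow> real" and i
    using dd_unique[OF test_functions_dd[OF test_functions_add[OF v test_functions_cmult[OF w, of t]], of i]
        dd_add[OF test_functions_dd[OF v, of i] dd_cmult[OF test_functions_dd[OF w, of i], of t]]] .
  have "partial_deriv i (partial_deriv i (\<lambda>x. v x + t * w x)) x
      = partial_deriv i (partial_deriv i v) x + t * partial_deriv i (partial_deriv i w) x" if "i \<in> Basis" for i
    unfolding 1[OF v w] 1[OF test_functions_partial[OF v that] test_functions_partial[OF w that]] ..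
  then show ?thesis by (simp add: laplacian_def sum.distrib sum_distrib_left)
qed

lemma integrable_test_mult:
  fixes v w :: "'a::euclidean_space \<Rightarrow> real"
  assumes "continuous_on UNIV v" "\<And>x. x \<notin> ball c R \<Longrightarrow> v x = 0" "continuous_on UNIV w"
  shows "integrable lborel (\<lambda>x. v x * w x)"
  by (rule integrable_compact_support[where c=c and R=R]) (use assms in \<open>auto intro!: continuous_intros\<close>)

lemma integral_test_dd_eq_0:
  fixes g :: "'a::euclidean_space \<Rightarrow> 'a \<Rightarrow> real"
  assumes "\<And>i. i \<in> Basis \<Longrightarrow> dd i (g i) (g' i)" "\<And>i. i \<in> Basis \<Longrightarrow> continuous_on UNIV (g i)"
    "\<And>i. i \<in> Basis \<Longrightarrow> continuous_on UNIV (g' i)"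
    and "\<And>i x. i \<in> Basis \<Longrightarrow> x \<notin> ball c R \<Longrightarrow> g i x = 0"
  shows "(LINT x|lborel. (\<Sum>i\<in>Basis. g' i x)) = 0"
  by (rule integral_sum_dd_eq_0(1)[of g g' c R]) (use assms in auto)

section \<open>Second-order estimates for test functions of a ball\<close>

lemma laplacian_energy:
  fixes v :: "'a::euclidean_space \<Rightarrow> real"
  assumes v: "v \<in> test_functions (ball c R)"
  shows "(LINT x|lborel. (\<Sum>i\<in>Basis. (partial_deriv i v x)\<^sup>2)) = - (LINT x|lborel. v x * laplacian v x)"
proof -
  note p = test_functions_partial[OF v]
  note cont = test_functions_continuous[OF v] test_functions_continuous[OF p]
    test_functions_continuous[OF test_functions_partial[OF p]]
  note zero = test_functions_zero[OF v] test_functions_zero[OF p]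
  have 0: "(LINT x|lborel. (\<Sum>i\<in>Basis. partial_deriv i v x * partial_deriv i v x + v x * partial_deriv i (partial_deriv i v) x)) = 0"
  proof (rule integral_test_dd_eq_0[where c=c and R=R])
    fix i :: 'a assume i: "i \<in> Basis"
    show "dd i (\<lambda>x. v x * partial_deriv i v x)
        (\<lambda>x. partial_deriv i v x * partial_deriv i v x + v x * partial_deriv i (partial_deriv i v) x)"
      by (rule dd_mult[OF test_functions_dd[OF v] test_functions_dd[OF p[OF i]]])
    show "continuous_on UNIV (\<lambda>x. v x * partial_deriv i v x)"
      using i by (intro continuous_intros cont)
    show "continuous_on UNIV (\<lambda>x. partial_deriv i v x * partial_deriv i v x + v x * partial_deriv i (partial_deriv i v) x)"
      using i by (intro continuous_intros cont)
    show "v x * partial_deriv i v x = 0" if "x \<notin> ball c R" for x using zero(1)[OF that] by simp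
  qed
  have i: "integrable lborel (\<lambda>x. \<Sum>i\<in>Basis. (partial_deriv i v x)\<^sup>2)" "integrable lborel (\<lambda>x. v x * laplacian v x)"
  proof -
    show "integrable lborel (\<lambda>x. \<Sum>i\<in>Basis. (partial_deriv i v x)\<^sup>2)"
      unfolding power2_eq_square
      by (intro Bochner_Integration.integrable_sum integrable_test_mult[where c=c and R=R] cont zero(2))
    show "integrable lborel (\<lambda>x. v x * laplacian v x)"
      by (intro integrable_test_mult[where c=c and R=R] cont zero(1) laplacian_continuous[OF v])
  qed
  have "(\<Sum>i\<in>Basis. partial_deriv i v x * partial_deriv i v x + v x * partial_deriv i (partial_deriv i v) x)
      = (\<Sum>i\<in>Basis. (partial_deriv i v x)\<^sup>2) + v x * laplacian v x" for x
    by (simp add: laplacian_def sum.distrib sum_distrib_left power2_eq_square)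
  with 0 i show ?thesis by simp
qed

text \<open>The field with components \<open>\<Sum>k. v_k * v_ki - v_i * v_kk\<close> (indices
  denoting derivatives) has as divergence the squared Hessian minus
  \<open>(laplacian v)\<^sup>2\<close>, because its third-order terms cancel by symmetry after
  summation.\<close>

lemma hessian_eq_laplacian:
  fixes v :: "'a::euclidean_space \<Rightarrow> real"
  assumes v: "v \<in> test_functions (ball c R)"
  shows "(LINT x|lborel. (\<Sum>i\<in>Basis. \<Sum>j\<in>Basis. (partial_deriv j (partial_deriv i v) x)\<^sup>2))
    = (LINT x|lborel. (laplacian v x)\<^sup>2)"
proof -
  let ?p = "\<lambda>i. partial_deriv i v" and ?q = "\<lambda>i j. partial_deriv j (partial_deriv i v)"
    and ?r = "\<lambda>i j k. partial_deriv k (partial_deriv j (partial_deriv i v))"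
  note p = test_functions_partial[OF v]
  note q = test_functions_partial[OF p]
  note r = test_functions_partial[OF q]
  note cont = test_functions_continuous[OF p] test_functions_continuous[OF q] test_functions_continuous[OF r]
  have sym: "?r j j i x = ?r i j j x" if "i \<in> Basis" "j \<in> Basis" for i j x
    using test_functions_commute[OF p[OF that(2)] that] test_functions_commute[OF v that] by simp
  have 0: "(LINT x|lborel. (\<Sum>i\<in>Basis. \<Sum>k\<in>Basis. (?q k i x * ?q k i x + ?p k x * ?r k i i x)
      - (?q i i x * ?q k k x + ?p i x * ?r k k i x))) = 0"
  proof (rule integral_test_dd_eq_0[where c=c and R=R])
    fix i :: 'a assume i: "i \<in> Basis"
    show "dd i (\<lambda>x. \<Sum>k\<in>Basis. ?p k x * ?q k i x - ?p i x * ?q k k x)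
       (\<lambda>x. \<Sum>k\<in>Basis. (?q k i x * ?q k i x + ?p k x * ?r k i i x) - (?q i i x * ?q k k x + ?p i x * ?r k k i x))"
      using i by (intro dd_sum dd_diff dd_mult test_functions_dd[OF p] test_functions_dd[OF q])
    show "continuous_on UNIV (\<lambda>x. \<Sum>k\<in>Basis. ?p k x * ?q k i x - ?p i x * ?q k k x)"
      using i by (intro continuous_intros cont)
    show "continuous_on UNIV (\<lambda>x. \<Sum>k\<in>Basis. (?q k i x * ?q k i x + ?p k x * ?r k i i x)
         - (?q i i x * ?q k k x + ?p i x * ?r k k i x))"
      using i by (intro continuous_intros cont)
    show "(\<Sum>k\<in>Basis. ?p k x * ?q k i x - ?p i x * ?q k k x) = 0" if "x \<notin> ball c R" for x
      using test_functions_zero[OF p that] i by (intro sum.neutral) simp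
  qed
  have "(\<Sum>i\<in>Basis. \<Sum>k\<in>Basis. (?q k i x * ?q k i x + ?p k x * ?r k i i x)
      - (?q i i x * ?q k k x + ?p i x * ?r k k i x))
     = (\<Sum>i\<in>Basis. \<Sum>j\<in>Basis. (?q i j x)\<^sup>2) - (laplacian v x)\<^sup>2" for x
  proof -
    have a: "(\<Sum>i\<in>Basis. \<Sum>k\<in>Basis. ?q k i x * ?q k i x) = (\<Sum>i\<in>Basis. \<Sum>j\<in>Basis. (?q i j x)\<^sup>2)"
      by (subst sum.swap) (simp add: power2_eq_square)
    have b: "(\<Sum>i\<in>Basis. \<Sum>k\<in>Basis. ?p k x * ?r k i i x) = (\<Sum>i\<in>Basis. \<Sum>k\<in>Basis. ?p i x * ?r k k i x)"
      by (subst sum.swap) (simp add: sym)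
    have d: "(\<Sum>i\<in>Basis. \<Sum>k\<in>Basis. ?q i i x * ?q k k x) = (laplacian v x)\<^sup>2"
      by (simp add: laplacian_def power2_eq_square sum_product)
    show ?thesis unfolding sum_subtractf sum.distrib a b d by simp
  qed
  with 0 have 1: "(LINT x|lborel. (\<Sum>i\<in>Basis. \<Sum>j\<in>Basis. (?q i j x)\<^sup>2) - (laplacian v x)\<^sup>2) = 0" by simp
  have "integrable lborel (\<lambda>x. \<Sum>i\<in>Basis. \<Sum>j\<in>Basis. (?q i j x)\<^sup>2)"
    unfolding power2_eq_square
    by (intro Bochner_Integration.integrable_sum integrable_test_mult[where c=c and R=R] cont test_functions_zero[OF q])
  moreover have "integrable lborel (\<lambda>x. (laplacian v x)\<^sup>2)"
    unfolding power2_eq_square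
    by (intro integrable_test_mult[where c=c and R=R] laplacian_continuous[OF v] laplacian_zero[OF v])
  ultimately show ?thesis using 1 by simp
qed

text \<open>Integrating the derivative of \<open>y * v\<^sup>2\<close>, with \<open>y\<close> a
  coordinate centred at \<open>c\<close>, shows that \<open>v\<^sup>2\<close> has the same integral
  as \<open>- 2 * y * v * p\<close>. As \<open>|y| \<le> R\<close> on the ball, Young's inequality
  lets the left side absorb half of the integral of \<open>v\<^sup>2\<close>.\<close>

lemma poincare:
  fixes v :: "'a::euclidean_space \<Rightarrow> real"
  assumes v: "v \<in> test_functions (ball c R)"
  shows "(LINT x|lborel. (v x)\<^sup>2) \<le> 4 * R\<^sup>2 * (LINT x|lborel. (\<Sum>i\<in>Basis. (partial_deriv i v x)\<^sup>2))"
proof -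
  obtain b :: 'a where b: "b \<in> Basis" using nonempty_Basis by blast
  define p where "p = partial_deriv b v"
  have pt: "p \<in> test_functions (ball c R)" unfolding p_def by (rule test_functions_partial[OF v b])
  note [continuous_intros] = test_functions_continuous[OF v] test_functions_continuous[OF pt]
    test_functions_continuous[OF test_functions_partial[OF v]]
  note zero = test_functions_zero[OF v] test_functions_zero[OF pt]
  define y where "y x = (x - c) \<bullet> b" for x
  have [continuous_intros]: "continuous_on UNIV y" unfolding y_def by (intro continuous_intros)
  have dy: "dd b y (\<lambda>x. 1)" unfolding y_def using dd_inner[of b c b] b by simp
  have dv: "dd b v p" unfolding p_def by (rule test_functions_dd[OF v])
  have 0: "(LINT x|lborel. 1 * (v x * v x) + y x * (p x * v x + v x * p x)) = 0"
    by (rule integral_dd_eq_0[of b "\<lambda>x. y x * (v x * v x)" _ c R])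
      (rule dd_mult[OF dy dd_mult[OF dv dv]], (intro continuous_intros)+, simp add: zero)
  have i: "integrable lborel (\<lambda>x. (v x)\<^sup>2)" "integrable lborel (\<lambda>x. 2 * R\<^sup>2 * (p x)\<^sup>2)"
     "integrable lborel (\<lambda>x. 1 * (v x * v x) + y x * (p x * v x + v x * p x))"
    by (rule integrable_compact_support[where c=c and R=R]; use zero in \<open>auto intro!: continuous_intros\<close>)+
  have i2: "integrable lborel (\<lambda>x. (v x)\<^sup>2 / 2 + 2 * R\<^sup>2 * (p x)\<^sup>2)" using i by simp
  have "(LINT x|lborel. (v x)\<^sup>2 - (1 * (v x * v x) + y x * (p x * v x + v x * p x))) \<le> (LINT x|lborel. (v x)\<^sup>2 / 2 + 2 * R\<^sup>2 * (p x)\<^sup>2)"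
  proof (intro integral_mono Bochner_Integration.integrable_diff i i2)
    show "(v x)\<^sup>2 - (1 * (v x * v x) + y x * (p x * v x + v x * p x)) \<le> (v x)\<^sup>2 / 2 + 2 * R\<^sup>2 * (p x)\<^sup>2" for x
    proof (cases "x \<in> ball c R")
      case True
      have "\<bar>y x\<bar> \<le> R" unfolding y_def using Basis_le_norm[OF b, of "x - c"] True
        by (simp add: dist_norm norm_minus_commute)
      then have "(y x)\<^sup>2 \<le> R\<^sup>2" by (metis abs_ge_zero power2_abs power_mono)
      then have "2 * ((y x)\<^sup>2 * (p x)\<^sup>2) \<le> 2 * (R\<^sup>2 * (p x)\<^sup>2)" by (intro mult_left_mono mult_right_mono) auto
      moreover have "0 \<le> (v x / 2 + y x * p x)\<^sup>2" by simp
      ultimately show ?thesis by (simp add: power2_eq_square algebra_simps)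
    qed (use zero in simp)
  qed
  then have 2: "(LINT x|lborel. (v x)\<^sup>2) \<le> 4 * R\<^sup>2 * (LINT x|lborel. (p x)\<^sup>2)"
    using 0 i by simp
  have "(LINT x|lborel. (p x)\<^sup>2) \<le> (LINT x|lborel. (\<Sum>i\<in>Basis. (partial_deriv i v x)\<^sup>2))"
  proof (rule integral_mono)
    show "integrable lborel (\<lambda>x. (p x)\<^sup>2)" "integrable lborel (\<lambda>x. (\<Sum>i\<in>Basis. (partial_deriv i v x)\<^sup>2))"
      unfolding power2_eq_square
      by (intro Bochner_Integration.integrable_sum integrable_test_mult[where c=c and R=R] continuous_intros
           zero test_functions_zero[OF test_functions_partial[OF v]]; simp)+
    show "(p x)\<^sup>2 \<le> (\<Sum>i\<in>Basis. (partial_deriv i v x)\<^sup>2)" for x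
      unfolding p_def using member_le_sum[of b Basis "\<lambda>i. (partial_deriv i v x)\<^sup>2"] b by simp
  qed
  then have "4 * R\<^sup>2 * (LINT x|lborel. (p x)\<^sup>2) \<le> 4 * R\<^sup>2 * (LINT x|lborel. (\<Sum>i\<in>Basis. (partial_deriv i v x)\<^sup>2))"
    by (intro mult_left_mono) auto
  with 2 show ?thesis by linarith
qed

text \<open>On a ball the Laplacian alone controls the full H2 norm of a test function. A bound in
  the dual norm thus becomes a bound by the L2 norm of \<open>laplacian v\<close>, and the
  functional to be minimised can use that norm alone.\<close>

lemma H2_estimate:
  fixes v :: "'a::euclidean_space \<Rightarrow> real"
  assumes v: "v \<in> test_functions (ball c R)" and R: "R > 0"
  defines "K \<equiv> 4 * R\<^sup>2"
  shows "(LINT x|lborel. (v x)\<^sup>2) + (\<Sum>i\<in>Basis. LINT x|lborel. (partial_deriv i v x)\<^sup>2)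
     + (\<Sum>i\<in>Basis. \<Sum>j\<in>Basis. LINT x|lborel. (partial_deriv j (partial_deriv i v) x)\<^sup>2)
    \<le> (K\<^sup>2 + K + 1) * (LINT x|lborel. (laplacian v x)\<^sup>2)"
proof -
  note p = test_functions_partial[OF v]
  note q = test_functions_partial[OF p]
  have K: "K > 0" using R by (simp add: K_def)
  have i: "integrable lborel (\<lambda>x. (v x)\<^sup>2)" "integrable lborel (\<lambda>x. (laplacian v x)\<^sup>2)" "integrable lborel (\<lambda>x. v x * laplacian v x)"
     by (rule integrable_compact_support[where c=c and R=R]; use laplacian_zero[OF v] test_functions_zero[OF v] in
       \<open>auto intro!: continuous_intros test_functions_continuous[OF v] laplacian_continuous[OF v]\<close>)+
  have ip: "integrable lborel (\<lambda>x. (partial_deriv i v x)\<^sup>2)" if "i \<in> Basis" for i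
     unfolding power2_eq_square using that
     by (intro integrable_test_mult[where c=c and R=R] test_functions_continuous[OF p] test_functions_zero[OF p])
  have iq: "integrable lborel (\<lambda>x. (partial_deriv j (partial_deriv i v) x)\<^sup>2)" if "i \<in> Basis" "j \<in> Basis" for i j
     unfolding power2_eq_square using that
     by (intro integrable_test_mult[where c=c and R=R] test_functions_continuous[OF q] test_functions_zero[OF q])
  define G where "G = (LINT x|lborel. (\<Sum>i\<in>Basis. (partial_deriv i v x)\<^sup>2))"
  define V where "V = (LINT x|lborel. (v x)\<^sup>2)"
  define D where "D = (LINT x|lborel. (laplacian v x)\<^sup>2)"
  have G: "G = (\<Sum>i\<in>Basis. LINT x|lborel. (partial_deriv i v x)\<^sup>2)"
    unfolding G_def by (rule Bochner_Integration.integral_sum) (rule ip)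
  have H: "(\<Sum>i\<in>Basis. \<Sum>j\<in>Basis. LINT x|lborel. (partial_deriv j (partial_deriv i v) x)\<^sup>2) = D"
    unfolding D_def hessian_eq_laplacian[OF v, symmetric]
    by (simp add: Bochner_Integration.integral_sum Bochner_Integration.integrable_sum iq)
  have VG: "V \<le> K * G" unfolding V_def G_def K_def by (rule poincare[OF v])
  \<comment> \<open>Young's inequality with weight \<open>K\<close>, so that the Poincare bound
    \<open>V \<le> K * G\<close> turns the first term into \<open>G / 2\<close>, which the left side
    absorbs.\<close>
  have "- (LINT x|lborel. v x * laplacian v x) \<le> (LINT x|lborel. (v x)\<^sup>2 / (2 * K) + K / 2 * (laplacian v x)\<^sup>2)"
    unfolding Bochner_Integration.integral_minus[symmetric]
  proof (rule integral_mono)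
    show "- (v x * laplacian v x) \<le> (v x)\<^sup>2 / (2 * K) + K / 2 * (laplacian v x)\<^sup>2" for x
    proof -
      have "0 \<le> (v x + K * laplacian v x)\<^sup>2 / (2 * K)" using K by simp
      also have "\<dots> = (v x)\<^sup>2 / (2 * K) + K / 2 * (laplacian v x)\<^sup>2 + v x * laplacian v x"
        using K by (simp add: power2_eq_square field_simps)
      finally show ?thesis by linarith
    qed
  qed (use i in auto)
  also have "\<dots> = V / (2 * K) + K / 2 * D" unfolding V_def D_def using i by simp
  finally have "G \<le> V / (2 * K) + K / 2 * D" unfolding G_def laplacian_energy[OF v] .
  also have "V / (2 * K) \<le> (K * G) / (2 * K)" using VG K by (intro divide_right_mono) auto
  also have "\<dots> = G / 2" using K by simp
  finally have GD: "G \<le> K * D" by simp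
  have "V \<le> K * (K * D)" using VG mult_left_mono[OF GD, of K] K by linarith
  then show ?thesis
    unfolding H G[symmetric] V_def[symmetric] D_def[symmetric] using GD by (simp add: power2_eq_square algebra_simps)
qed

section \<open>Minimisation up to a small error\<close>

text \<open>The discriminant condition for a quadratic in \<open>t\<close> that is bounded below by
  \<open>- d\<^sup>2 / 2\<close>. If \<open>q = 0\<close> the polynomial is affine, so boundedness
  below forces slope 0.\<close>

lemma quadratic_nonneg_imp:
  fixes e q d :: real
  assumes "\<And>t. 0 \<le> t * e + t\<^sup>2 / 2 * q + d\<^sup>2 / 2" "q \<ge> 0" "d \<ge> 0"
  shows "\<bar>e\<bar> \<le> d * sqrt q"
proof (cases "q = 0")
  case True
  have "e = 0"
  proof (rule ccontr)
    assume "e \<noteq> 0"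
    then show False using assms(1)[of "- (d\<^sup>2 + 1) / e"] True zero_le_power2[of d] by simp
  qed
  then show ?thesis using True by simp
next
  case False
  with assms have q: "q > 0" by simp
  have "0 \<le> - (e\<^sup>2 / (2 * q)) + d\<^sup>2 / 2"
    using assms(1)[of "- e / q"] q by (simp add: power2_eq_square field_simps)
  then have "e\<^sup>2 \<le> d\<^sup>2 * q" using q by (simp add: field_simps)
  then have "sqrt (e\<^sup>2) \<le> sqrt (d\<^sup>2 * q)" by (rule real_sqrt_le_mono)
  then show ?thesis using assms by (simp add: real_sqrt_mult)
qed

text \<open>An almost minimiser of \<open>\<parallel>\<Delta>v\<parallel>\<^sup>2 / 2 + F v\<close> plays the role of the solution of \<open>\<Delta>\<^sup>2 v = - F\<close>,
  whose existence would require a completion of the test functions.\<close>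

lemma almost_minimiser:
  fixes F :: "('a::euclidean_space \<Rightarrow> real) \<Rightarrow> real" and N \<delta> :: real
  assumes lin: "\<And>v w t. v \<in> test_functions (ball c R) \<Longrightarrow> w \<in> test_functions (ball c R) \<Longrightarrow>
      F (\<lambda>x. v x + t * w x) = F v + t * F w"
    and bd: "\<And>v. v \<in> test_functions (ball c R) \<Longrightarrow> \<bar>F v\<bar> \<le> N * sqrt (LINT x|lborel. (laplacian v x)\<^sup>2)"
    and N: "N \<ge> 0" and \<delta>: "\<delta> > 0"
  obtains v0 where "v0 \<in> test_functions (ball c R)" "(LINT x|lborel. (laplacian v0 x)\<^sup>2) \<le> (N + \<delta>)\<^sup>2"
    "\<And>v. v \<in> test_functions (ball c R) \<Longrightarrow>
      \<bar>F v + (LINT x|lborel. laplacian v0 x * laplacian v x)\<bar> \<le> \<delta> * sqrt (LINT x|lborel. (laplacian v x)\<^sup>2)"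
proof -
  define T where "T = (test_functions (ball c R) :: ('a \<Rightarrow> real) set)"
  define q where "q v = (LINT x|lborel. (laplacian v x)\<^sup>2)" for v :: "'a \<Rightarrow> real"
  define b where "b v w = (LINT x|lborel. laplacian v x * laplacian w x)" for v w :: "'a \<Rightarrow> real"
  define J where "J v = q v / 2 + F v" for v
  have i: "integrable lborel (\<lambda>x. laplacian v x * laplacian w x)" if "v \<in> T" "w \<in> T" for v w
    using that unfolding T_def
    by (intro integrable_test_mult[where c=c and R=R] laplacian_continuous[of _ "ball c R"] laplacian_zero[of _ "ball c R"])
  have q0: "q v \<ge> 0" for v unfolding q_def by (intro Bochner_Integration.integral_nonneg) auto
  have expand: "J (\<lambda>x. v x + t * w x) = J v + t * (F w + b v w) + t\<^sup>2 / 2 * q w" if "v \<in> T" "w \<in> T" for v w t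
  proof -
    have "(laplacian (\<lambda>x. v x + t * w x) x)\<^sup>2 = laplacian v x * laplacian v x + (2 * t * (laplacian v x * laplacian w x)
        + t\<^sup>2 * (laplacian w x * laplacian w x))" for x
      using laplacian_add_cmult[of v "ball c R" w t x] that unfolding T_def
      by (simp add: power2_eq_square algebra_simps)
    then have "q (\<lambda>x. v x + t * w x) = q v + 2 * t * b v w + t\<^sup>2 * q w"
      unfolding q_def b_def using i[OF that(1,1)] i[OF that] i[OF that(2,2)] by (simp add: power2_eq_square)
    then show ?thesis
      using lin[of v w t] that unfolding J_def T_def by (simp add: field_simps)
  qed
  have low: "J v \<ge> - (N\<^sup>2) / 2" if "v \<in> T" for v
  proof -
    define s where "s = sqrt (q v)"
    have "q v = s\<^sup>2" using q0 by (simp add: s_def)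
    moreover have "F v \<ge> - (N * s)" using bd[of v] that unfolding T_def s_def q_def by linarith
    moreover have "0 \<le> (s - N)\<^sup>2" by simp
    ultimately show ?thesis unfolding J_def by (simp add: power2_eq_square algebra_simps)
  qed
  have "(\<lambda>x. 0) \<in> T" unfolding T_def by (intro test_functionsI[of _ "{}"] C_k_const) auto
  then have ne: "J ` T \<noteq> {}" by blast
  have bb: "bdd_below (J ` T)" using low by (intro bdd_belowI2)
  define I where "I = Inf (J ` T)"
  \<comment> \<open>The slack \<open>\<delta>\<^sup>2 / 2\<close> is tuned to
    \<open>quadratic_nonneg_imp\<close>: it makes the first variation at \<open>v0\<close> at most
    \<open>\<delta>\<close> times the norm of the direction.\<close>
  obtain v0 where v0: "v0 \<in> T" "J v0 < I + \<delta>\<^sup>2 / 2"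
  proof -
    have "I < I + \<delta>\<^sup>2 / 2" using \<delta> by simp
    then have "\<exists>y\<in>J ` T. y < I + \<delta>\<^sup>2 / 2" using cInf_less_iff[OF ne bb] unfolding I_def by blast
    then show ?thesis using that by blast
  qed
  have key: "\<bar>F v + b v0 v\<bar> \<le> \<delta> * sqrt (q v)" if "v \<in> T" for v
  proof (rule quadratic_nonneg_imp[OF _ q0])
    fix t
    have "(\<lambda>x. v0 x + t * v x) \<in> T"
      using v0 that unfolding T_def by (intro test_functions_add test_functions_cmult)
    then have "I \<le> J (\<lambda>x. v0 x + t * v x)" unfolding I_def by (intro cInf_lower bb) auto
    then show "0 \<le> t * (F v + b v0 v) + t\<^sup>2 / 2 * q v + \<delta>\<^sup>2 / 2"
      unfolding expand[OF v0(1) that] using v0(2) by linarith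
  qed (use \<delta> in simp)
  \<comment> \<open>The approximate Euler-Lagrange identity tested with \<open>v0\<close>
    itself.\<close>
  have "q v0 \<le> (N + \<delta>)\<^sup>2"
  proof -
    define s where "s = sqrt (q v0)"
    have s: "s \<ge> 0" "q v0 = s\<^sup>2" using q0 by (auto simp: s_def)
    have "b v0 v0 = s\<^sup>2" unfolding s(2)[symmetric] b_def q_def by (simp add: power2_eq_square)
    then have "s\<^sup>2 \<le> \<delta> * s - F v0" using key[OF v0(1)] unfolding s_def by linarith
    moreover have "- F v0 \<le> N * s" using bd[of v0] v0(1) unfolding T_def s_def q_def by linarith
    ultimately have "s * s \<le> (N + \<delta>) * s" by (simp add: power2_eq_square algebra_simps)
    then have "s \<le> N + \<delta>" using s N \<delta> by (cases "s = 0") auto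
    then show ?thesis unfolding s(2) using s by (intro power_mono)
  qed
  then show ?thesis
    using that[of v0] v0(1) key unfolding T_def q_def b_def by blast
qed

section \<open>Mollification\<close>

text \<open>The kernel is evaluated at \<open>y - x\<close>, not at \<open>x - y\<close>: as a
  function of \<open>y\<close> it is literally a translate of \<open>k\<close>, hence a test
  function, whatever the symmetry of \<open>k\<close>. The price is a minus sign at each derivative;
  for second derivatives the signs cancel.\<close>

definition mollify :: "('a::euclidean_space \<Rightarrow> real) \<Rightarrow> ('a \<Rightarrow> real) \<Rightarrow> 'a \<Rightarrow> real" where
  "mollify k f x = (LINT y|lborel. f y * k (y - x))"

definition mollifier :: "real \<Rightarrow> ('a::euclidean_space \<Rightarrow> real) \<Rightarrow> bool" where
  "mollifier \<epsilon> k \<longleftrightarrow> (\<forall>n. C_k n k) \<and> (\<forall>x. 0 \<le> k x) \<and> (\<forall>x. x \<notin> ball 0 \<epsilon> \<longrightarrow> k x = 0) \<and>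
     (LINT x|lborel. k x) = 1"

lemma mollifierD:
  assumes "mollifier \<epsilon> k"
  shows "C_k n k" "0 \<le> k x" "x \<notin> ball 0 \<epsilon> \<Longrightarrow> k x = 0" "(LINT x|lborel. k x) = 1"
    "continuous_on UNIV k" "k \<in> borel_measurable borel"
  using assms C_k_continuous[of 0 k] unfolding mollifier_def
  by (auto intro: borel_measurable_continuous_onI)

lemma mollifier_zero: "mollifier \<epsilon> k \<Longrightarrow> x \<notin> cball 0 \<epsilon> \<Longrightarrow> k x = 0"
  using mollifierD(3)[of \<epsilon> k x] by auto

lemma mollifier_bounded:
  assumes "mollifier \<epsilon> k"
  obtains B where "\<And>x. \<bar>k x\<bar> \<le> B"
  using compact_support_bounded[OF mollifierD(5)[OF assms] mollifier_zero[OF assms]] by blast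

lemma mollifier_integrable: "mollifier \<epsilon> k \<Longrightarrow> integrable lborel k"
  by (rule integrable_compact_support[OF mollifierD(5) mollifier_zero])

lemma bounded_mult_integrable:
  fixes f k :: "'a::euclidean_space \<Rightarrow> real"
  assumes "integrable lborel f" "k \<in> borel_measurable borel" "\<And>x. \<bar>k x\<bar> \<le> B"
  shows "integrable lborel (\<lambda>y. f y * k (y - x))"
proof (rule Bochner_Integration.integrable_bound[where f="\<lambda>y. B * f y"])
  show "(\<lambda>y. f y * k (y - x)) \<in> borel_measurable lborel" using assms by measurable
  show "AE y in lborel. norm (f y * k (y - x)) \<le> norm (B * f y)"
  proof (rule AE_I2)
    fix y
    have "\<bar>k (y - x)\<bar> \<le> \<bar>B\<bar>" using assms(3)[of "y - x"] by linarith
    then have "\<bar>f y\<bar> * \<bar>k (y - x)\<bar> \<le> \<bar>f y\<bar> * \<bar>B\<bar>" by (intro mult_left_mono) auto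
    then show "norm (f y * k (y - x)) \<le> norm (B * f y)" by (simp add: abs_mult mult.commute)
  qed
qed (use assms in simp)

lemma continuous_mollify:
  assumes f: "integrable lborel f" and k: "continuous_on UNIV k" "\<And>x. \<bar>k x\<bar> \<le> B"
  shows "continuous_on UNIV (mollify k f)"
proof (rule continuous_on_sequentiallyI)
  fix X :: "nat \<Rightarrow> 'a" and x assume X: "X \<longlonglongrightarrow> x"
  have [measurable]: "k \<in> borel_measurable borel" using k by (intro borel_measurable_continuous_onI)
  have [measurable]: "f \<in> borel_measurable borel" using f by simp
  show "(\<lambda>n. mollify k f (X n)) \<longlonglongrightarrow> mollify k f x"
    unfolding mollify_def
  proof (rule integral_dominated_convergence[where w="\<lambda>y. B * \<bar>f y\<bar>"])
    show "AE y in lborel. (\<lambda>n. f y * k (y - X n)) \<longlonglongrightarrow> f y * k (y - x)"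
    proof (rule AE_I2)
      fix y
      have "isCont k (y - x)" using k(1) by (simp add: continuous_on_eq_continuous_at)
      moreover have "(\<lambda>n. y - X n) \<longlonglongrightarrow> y - x" by (intro tendsto_intros X)
      ultimately show "(\<lambda>n. f y * k (y - X n)) \<longlonglongrightarrow> f y * k (y - x)"
        by (intro tendsto_mult tendsto_const isCont_tendsto_compose[of _ k])
    qed
    show "AE y in lborel. norm (f y * k (y - X n)) \<le> B * \<bar>f y\<bar>" for n
      using mult_right_mono[OF k(2), of "\<bar>f _\<bar>"] by (auto simp: abs_mult mult.commute intro!: AE_I2)
  qed (use f in auto)
qed

lemma dd_mollify:
  assumes f: "integrable lborel f" and k: "continuous_on UNIV k" "\<And>x. \<bar>k x\<bar> \<le> B"
    and k': "dd i k k'" "continuous_on UNIV k'" "\<And>x. \<bar>k' x\<bar> \<le> B'"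
  shows "dd i (mollify k f) (\<lambda>x. - mollify k' f x)"
  unfolding dd_def DERIV_def
proof
  fix x
  have [measurable]: "k \<in> borel_measurable borel" "k' \<in> borel_measurable borel"
    using k k' by (auto intro: borel_measurable_continuous_onI)
  have [measurable]: "f \<in> borel_measurable borel" using f by simp
  have B': "B' \<ge> 0" using k'(3)[of 0] by linarith
  have inc: "\<bar>k (z + t *\<^sub>R i) - k z\<bar> \<le> B' * \<bar>t\<bar>" for z t
    using dd_increment_le[OF k'(1,3), of t z] dd_increment_le[OF k'(1,3), of "- t" "z + t *\<^sub>R i"]
    by (cases "t \<ge> 0") (auto simp: abs_minus_commute)
  show "((\<lambda>h. (mollify k f (x + (0 + h) *\<^sub>R i) - mollify k f (x + 0 *\<^sub>R i)) / h) \<longlongrightarrow> - mollify k' f x) (at 0)"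
    unfolding tendsto_at_iff_sequentially
  proof (intro allI impI)
    fix X :: "nat \<Rightarrow> real" assume X0: "\<forall>n. X n \<in> UNIV - {0}" and X: "X \<longlonglongrightarrow> 0"
    have ne: "X n \<noteq> 0" for n using X0 by auto
    let ?q = "\<lambda>n y. f y * ((k (y - x + (- X n) *\<^sub>R i) - k (y - x)) / X n)"
    have lim: "(\<lambda>n. LINT y|lborel. ?q n y) \<longlonglongrightarrow> (LINT y|lborel. f y * - k' (y - x))"
    proof (rule integral_dominated_convergence[where w="\<lambda>y. B' * \<bar>f y\<bar>"])
      show "AE y in lborel. (\<lambda>n. ?q n y) \<longlonglongrightarrow> f y * - k' (y - x)"
      proof (rule AE_I2)
        fix y
        have "((\<lambda>t. (k (y - x + t *\<^sub>R i) - k (y - x)) / t) \<longlongrightarrow> k' (y - x)) (at 0)"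
          using ddD[OF k'(1), of "y - x"] by (simp add: DERIV_def)
        moreover have "filterlim (\<lambda>n. - X n) (at 0) sequentially"
          unfolding filterlim_at using tendsto_minus[OF X] ne by auto
        ultimately have "(\<lambda>n. (k (y - x + (- X n) *\<^sub>R i) - k (y - x)) / (- X n)) \<longlonglongrightarrow> k' (y - x)"
          by (rule filterlim_compose)
        from tendsto_mult[OF tendsto_const tendsto_minus[OF this], of "f y"]
        show "(\<lambda>n. ?q n y) \<longlonglongrightarrow> f y * - k' (y - x)" by simp
      qed
      show "AE y in lborel. norm (?q n y) \<le> B' * \<bar>f y\<bar>" for n
      proof (rule AE_I2)
        fix y
        have "\<bar>(k (y - x + (- X n) *\<^sub>R i) - k (y - x)) / X n\<bar> \<le> B' * \<bar>X n\<bar> / \<bar>X n\<bar>"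
          unfolding abs_divide using inc[of "y - x" "- X n"] by (intro divide_right_mono) auto
        also have "\<dots> = B'" using ne by simp
        finally show "norm (?q n y) \<le> B' * \<bar>f y\<bar>"
          unfolding real_norm_def abs_mult by (subst mult.commute) (intro mult_right_mono, auto)
      qed
    qed (use f in auto)
    have val: "(LINT y|lborel. ?q n y) = (mollify k f (x + X n *\<^sub>R i) - mollify k f x) / X n" for n
    proof -
      have eq: "?q n y = (f y * k (y - (x + X n *\<^sub>R i)) - f y * k (y - x)) / X n" for y
        using ne[of n] by (simp add: diff_diff_eq2 algebra_simps diff_divide_distrib)
      have "(LINT y|lborel. ?q n y) = (LINT y|lborel. (f y * k (y - (x + X n *\<^sub>R i)) - f y * k (y - x)) / X n)"
        unfolding eq ..
      moreover have "integrable lborel (\<lambda>y. f y * k (y - z))" for z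
        by (rule bounded_mult_integrable[OF f _ k(2)]) measurable
      ultimately show ?thesis unfolding mollify_def by simp
    qed
    have "(\<lambda>n. (mollify k f (x + X n *\<^sub>R i) - mollify k f x) / X n) \<longlonglongrightarrow> - mollify k' f x"
      using lim unfolding val by (simp add: mollify_def)
    then show "((\<lambda>h. (mollify k f (x + (0 + h) *\<^sub>R i) - mollify k f (x + 0 *\<^sub>R i)) / h) \<circ> X) \<longlonglongrightarrow> - mollify k' f x"
      by (simp add: comp_def)
  qed
qed

lemma C2_mollify:
  assumes f: "integrable lborel f" and k: "C2 k k1 k2" "\<And>x. x \<notin> cball c R \<Longrightarrow> k x = 0"
  shows "C2 (mollify k f) (\<lambda>i x. - mollify (k1 i) f x) (\<lambda>i j. mollify (k2 i j) f)"
proof -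
  note D = C2D[OF k(1)]
  have z: "k1 i x = 0" "j \<in> Basis \<Longrightarrow> k2 i j x = 0" if "x \<notin> cball c R" "i \<in> Basis" for i j x
    using C2_zero_outside[OF k(1), of c R] k(2) that by blast+
  obtain B where B: "\<And>x. \<bar>k x\<bar> \<le> B" using compact_support_bounded[OF D(1) k(2)] by blast
  have B1: "\<exists>B. \<forall>x. \<bar>k1 i x\<bar> \<le> B" if "i \<in> Basis" for i
    using compact_support_bounded[OF D(3)[OF that] z(1)[OF _ that]] by blast
  have B2: "\<exists>B. \<forall>x. \<bar>k2 i j x\<bar> \<le> B" if "i \<in> Basis" "j \<in> Basis" for i j
    using compact_support_bounded[OF D(5)[OF that] z(2)[OF _ that]] by blast
  show ?thesis
    unfolding C2_def
  proof (intro conjI ballI)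
    show "continuous_on UNIV (mollify k f)" by (rule continuous_mollify[OF f D(1) B])
    fix i :: 'a assume i: "i \<in> Basis"
    obtain b1 where b1: "\<And>x. \<bar>k1 i x\<bar> \<le> b1" using B1[OF i] by blast
    show "dd i (mollify k f) (\<lambda>x. - mollify (k1 i) f x)"
      by (rule dd_mollify[OF f D(1) B D(2,3)[OF i] b1])
    show "continuous_on UNIV (\<lambda>x. - mollify (k1 i) f x)"
      by (intro continuous_on_minus continuous_mollify[OF f D(3)[OF i] b1])
    fix j :: 'a assume j: "j \<in> Basis"
    obtain b2 where b2: "\<And>x. \<bar>k2 i j x\<bar> \<le> b2" using B2[OF i j] by blast
    show "dd j (\<lambda>x. - mollify (k1 i) f x) (mollify (k2 i j) f)"
      using dd_minus[OF dd_mollify[OF f D(3)[OF i] b1 D(4,5)[OF i j] b2]] by simp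
    show "continuous_on UNIV (mollify (k2 i j) f)"
      by (rule continuous_mollify[OF f D(5)[OF i j] b2])
  qed
qed

section \<open>Convergence of mollifications in L1 and L2\<close>

lemma nn_integral_reflect:
  fixes k :: "'a::euclidean_space \<Rightarrow> ennreal"
  assumes [measurable]: "k \<in> borel_measurable borel"
  shows "(\<integral>\<^sup>+x. k (y - x) \<partial>lborel) = (\<integral>\<^sup>+x. k x \<partial>lborel)"
proof -
  have "lborel = distr lborel borel (\<lambda>x. y - x)"
    using lborel_affine[of "-1" y] by (simp add: density_1)
  then have "(\<integral>\<^sup>+x. k x \<partial>lborel) = (\<integral>\<^sup>+x. k x \<partial>distr lborel borel (\<lambda>x. y - x))"
    by (rule arg_cong)
  also have "\<dots> = (\<integral>\<^sup>+x. k (y - x) \<partial>lborel)"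
    by (rule nn_integral_distr) measurable
  finally show ?thesis by simp
qed

lemma two_power_ineq:
  fixes a b :: real
  assumes "p = 1 \<or> p = (2::nat)"
  shows "\<bar>a + b\<bar> ^ p \<le> 2 * \<bar>a\<bar> ^ p + 2 * \<bar>b\<bar> ^ p"
proof -
  have "(a + b)\<^sup>2 \<le> 2 * a\<^sup>2 + 2 * b\<^sup>2"
    using zero_le_power2[of "a - b"] by (simp add: power2_eq_square algebra_simps)
  moreover have "\<bar>a + b\<bar> \<le> 2 * \<bar>a\<bar> + 2 * \<bar>b\<bar>" by linarith
  ultimately show ?thesis using assms by auto
qed

text \<open>Jensen's inequality at each point followed by Tonelli, as \<open>k\<close> has integral
  1. The exponent 1 serves the uniqueness of weak derivatives, the exponent 2 the approximation of
  solutions.\<close>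

lemma mollify_contraction:
  fixes f :: "'a::euclidean_space \<Rightarrow> real"
  assumes k: "mollifier \<epsilon> k" and p: "p = 1 \<or> p = (2::nat)"
    and f: "integrable lborel f" "integrable lborel (\<lambda>x. \<bar>f x\<bar> ^ p)"
  shows "integrable lborel (\<lambda>x. \<bar>mollify k f x\<bar> ^ p)"
    and "(LINT x|lborel. \<bar>mollify k f x\<bar> ^ p) \<le> (LINT x|lborel. \<bar>f x\<bar> ^ p)"
proof -
  note kD = mollifierD[OF k]
  have [measurable]: "k \<in> borel_measurable borel" "f \<in> borel_measurable borel" using kD f by simp_all
  obtain B where B: "\<And>x. \<bar>k x\<bar> \<le> B"
    using mollifier_bounded[OF k] by blast
  have cont: "continuous_on UNIV (mollify k f)" by (rule continuous_mollify[OF f(1) kD(5) B])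
  then have [measurable]: "mollify k f \<in> borel_measurable borel" by (intro borel_measurable_continuous_onI)
  have k1: "(\<integral>\<^sup>+x. ennreal (k x) \<partial>lborel) = 1"
  proof -
    have "integrable lborel k" by (rule mollifier_integrable[OF k])
    then show ?thesis using kD by (subst nn_integral_eq_integral) auto
  qed
  have intk: "integrable lborel (\<lambda>y. k (y - x))" "(LINT y|lborel. k (y - x)) = 1" for x
  proof -
    have "integrable lborel k" by (rule mollifier_integrable[OF k])
    from lborel_integrable_translate[OF this, of "- x"] show "integrable lborel (\<lambda>y. k (y - x))" by simp
    show "(LINT y|lborel. k (y - x)) = 1"
      using lborel_integral_translate[of k "- x"] kD(4) by simp
  qed
  have i: "integrable lborel (\<lambda>y. \<bar>f y\<bar> ^ p * k (y - x))" "integrable lborel (\<lambda>y. f y * k (y - x))" for x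
    by (rule bounded_mult_integrable[OF f(2) kD(6) B], rule bounded_mult_integrable[OF f(1) kD(6) B])
  have jensen: "\<bar>mollify k f x\<bar> ^ p \<le> (LINT y|lborel. \<bar>f y\<bar> ^ p * k (y - x))" for x
    using p
  proof
    assume p: "p = 1"
    have "\<bar>mollify k f x\<bar> \<le> (LINT y|lborel. \<bar>f y * k (y - x)\<bar>)"
      unfolding mollify_def by (rule integral_abs_bound)
    then show ?thesis using kD(2) p by (simp add: abs_mult)
  next
    assume p: "p = 2"
    \<comment> \<open>\<open>m\<close> is the mean of \<open>f\<close> under the probability density
      \<open>k (y - x)\<close>, and Jensen's inequality is the nonnegativity of the
      variance.\<close>
    define m where "m = mollify k f x"
    have "0 \<le> (LINT y|lborel. (f y - m)\<^sup>2 * k (y - x))"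
      using kD(2) by (intro Bochner_Integration.integral_nonneg) auto
    also have "\<dots> = (LINT y|lborel. \<bar>f y\<bar> ^ p * k (y - x) - 2 * m * (f y * k (y - x)) + m\<^sup>2 * k (y - x))"
      using p by (simp add: power2_eq_square algebra_simps)
    also have "\<dots> = (LINT y|lborel. \<bar>f y\<bar> ^ p * k (y - x)) - 2 * m * m + m\<^sup>2 * 1"
      using i intk by (simp add: m_def mollify_def)
    finally show ?thesis using p by (simp add: m_def power2_eq_square)
  qed
  have "(\<integral>\<^sup>+x. ennreal (\<bar>mollify k f x\<bar> ^ p) \<partial>lborel) \<le> (\<integral>\<^sup>+x. (\<integral>\<^sup>+y. ennreal (\<bar>f y\<bar> ^ p * k (y - x)) \<partial>lborel) \<partial>lborel)"
  proof (rule nn_integral_mono)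
    fix x
    have "ennreal (\<bar>mollify k f x\<bar> ^ p) \<le> ennreal (LINT y|lborel. \<bar>f y\<bar> ^ p * k (y - x))"
      by (rule ennreal_leI[OF jensen])
    also have "\<dots> = (\<integral>\<^sup>+y. ennreal (\<bar>f y\<bar> ^ p * k (y - x)) \<partial>lborel)"
      using i(1) kD(2) by (subst nn_integral_eq_integral) auto
    finally show "ennreal (\<bar>mollify k f x\<bar> ^ p) \<le> (\<integral>\<^sup>+y. ennreal (\<bar>f y\<bar> ^ p * k (y - x)) \<partial>lborel)" .
  qed
  also have "\<dots> = (\<integral>\<^sup>+y. (\<integral>\<^sup>+x. ennreal (\<bar>f y\<bar> ^ p * k (y - x)) \<partial>lborel) \<partial>lborel)"
    by (rule lborel_pair.Fubini') measurable
  also have "\<dots> = (\<integral>\<^sup>+y. ennreal (\<bar>f y\<bar> ^ p) * (\<integral>\<^sup>+x. ennreal (k (y - x)) \<partial>lborel) \<partial>lborel)"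
    using kD(2) by (simp add: ennreal_mult nn_integral_cmult)
  also have "\<dots> = (\<integral>\<^sup>+y. ennreal (\<bar>f y\<bar> ^ p) \<partial>lborel)"
    using nn_integral_reflect[of "\<lambda>x. ennreal (k x)"] k1 by simp
  also have "\<dots> = ennreal (LINT x|lborel. \<bar>f x\<bar> ^ p)"
    using f(2) by (subst nn_integral_eq_integral) auto
  finally have le: "(\<integral>\<^sup>+x. ennreal (\<bar>mollify k f x\<bar> ^ p) \<partial>lborel) \<le> ennreal (LINT x|lborel. \<bar>f x\<bar> ^ p)" .
  show *: "integrable lborel (\<lambda>x. \<bar>mollify k f x\<bar> ^ p)"
    by (rule integrableI_bounded) (use le in \<open>auto simp: le_less_trans less_top[symmetric] top_unique\<close>)
  show "(LINT x|lborel. \<bar>mollify k f x\<bar> ^ p) \<le> (LINT x|lborel. \<bar>f x\<bar> ^ p)"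
    using le * by (subst (asm) nn_integral_eq_integral)
      (auto simp: ennreal_le_iff Bochner_Integration.integral_nonneg)
qed

text \<open>\<open>measurable_on\<close> supplies continuous \<open>G n\<close> converging almost
  everywhere to \<open>f\<close>, but without control of size or support. Truncating
  \<open>f\<close> at a height \<open>N\<close> first, and then clipping and cutting off
  \<open>G n\<close> accordingly, makes dominated convergence applicable.\<close>

lemma Lp_dense_continuous:
  fixes f :: "'a::euclidean_space \<Rightarrow> real"
  assumes p: "p = 1 \<or> p = (2::nat)" and R: "R > 0"
    and f: "f \<in> borel_measurable borel" "integrable lborel (\<lambda>x. \<bar>f x\<bar> ^ p)" "\<And>x. x \<notin> cball c R \<Longrightarrow> f x = 0"
    and \<theta>: "\<theta> > 0"
  obtains g where "continuous_on UNIV g" "\<And>x. x \<notin> cball c (R + 1) \<Longrightarrow> g x = 0"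
    "integrable lborel (\<lambda>x. \<bar>f x - g x\<bar> ^ p)" "(LINT x|lborel. \<bar>f x - g x\<bar> ^ p) < \<theta>"
proof -
  note [measurable] = f(1)
  have p0: "p > 0" using p by auto
  define F where "F N x = max (- real N) (min (real N) (f x))" for N :: nat and x
  have Fm [measurable]: "F N \<in> borel_measurable borel" for N unfolding F_def by measurable
  have Fle: "\<bar>f x - F N x\<bar> \<le> \<bar>f x\<bar>" for N x unfolding F_def by (auto simp: max_def min_def)
  have FN: "\<bar>F N x\<bar> \<le> real N" for N x unfolding F_def by (auto simp: max_def min_def)
  have iF: "integrable lborel (\<lambda>x. \<bar>f x - F N x\<bar> ^ p)" for N
    by (rule Bochner_Integration.integrable_bound[OF f(2)]) (use Fle in \<open>auto intro!: power_mono\<close>)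
  have "(\<lambda>N. LINT x|lborel. \<bar>f x - F N x\<bar> ^ p) \<longlonglongrightarrow> (LINT x|(lborel :: 'a measure). (0::real))"
  proof (rule integral_dominated_convergence[where w="\<lambda>x. \<bar>f x\<bar> ^ p"])
    show "AE x in lborel. (\<lambda>N. \<bar>f x - F N x\<bar> ^ p) \<longlonglongrightarrow> 0"
    proof (rule AE_I2)
      fix x
      obtain N0 :: nat where N0: "\<bar>f x\<bar> \<le> real N0" using real_arch_simple by blast
      have "\<forall>\<^sub>F N in sequentially. \<bar>f x - F N x\<bar> ^ p = 0"
        using eventually_ge_at_top[of N0]
      proof eventually_elim
        case (elim N)
        then have "\<bar>f x\<bar> \<le> real N" using N0 by linarith
        then show ?case using p0 by (auto simp: F_def max_def min_def)
      qed
      then show "(\<lambda>N. \<bar>f x - F N x\<bar> ^ p) \<longlonglongrightarrow> 0" by (rule tendsto_eventually)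
    qed
    show "AE x in lborel. norm (\<bar>f x - F N x\<bar> ^ p) \<le> \<bar>f x\<bar> ^ p" for N
      using Fle by (auto intro!: power_mono)
  qed (use f in auto)
  then have "\<forall>\<^sub>F N in sequentially. (LINT x|lborel. \<bar>f x - F N x\<bar> ^ p) < \<theta> / 4"
    by (rule order_tendstoD(2)) (use \<theta> in simp)
  then obtain N where N: "(LINT x|lborel. \<bar>f x - F N x\<bar> ^ p) < \<theta> / 4"
    by (auto simp: eventually_sequentially)
  have "f \<in> borel_measurable lebesgue" using f(1) by (auto intro: measurable_completion)
  then have "f measurable_on UNIV" by (intro lebesgue_measurable_imp_measurable_on_real) auto
  then obtain N0 G where NG: "negligible N0" "\<And>n. continuous_on UNIV (G n)"
    "\<And>x. x \<notin> N0 \<Longrightarrow> (\<lambda>n. G n x) \<longlonglongrightarrow> f x"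
    unfolding measurable_on_def by auto
  have ae: "AE x in lborel. x \<notin> N0"
  proof -
    have "N0 \<in> null_sets lebesgue" using NG(1) by (simp add: negligible_iff_null_sets)
    then have "AE x in lebesgue. x \<notin> N0" by (rule AE_not_in)
    then show ?thesis by (simp add: AE_completion_iff)
  qed
  have "R < R + 1" by simp
  with R obtain \<eta> :: "'a \<Rightarrow> real" where \<eta>: "\<And>k. C_k k \<eta>" "\<And>x. 0 \<le> \<eta> x" "\<And>x. \<eta> x \<le> 1"
    "\<And>x. x \<in> cball c R \<Longrightarrow> \<eta> x = 1" "\<And>x. x \<notin> ball c (R + 1) \<Longrightarrow> \<eta> x = 0"
    by (rule exists_cutoff[where c=c]) blast
  define H where "H n x = \<eta> x * max (- real N) (min (real N) (G n x))" for n x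
  have cH: "continuous_on UNIV (H n)" for n
    unfolding H_def by (intro continuous_intros NG(2) C_k_continuous[OF \<eta>(1)[of 0]])
  then have [measurable]: "H n \<in> borel_measurable borel" for n by (intro borel_measurable_continuous_onI)
  have zH: "H n x = 0" if "x \<notin> cball c (R + 1)" for n x using \<eta>(5)[of x] that by (simp add: H_def)
  have HN: "\<bar>H n x\<bar> \<le> real N" for n x
  proof -
    have "\<bar>H n x\<bar> \<le> 1 * real N"
      unfolding H_def abs_mult using \<eta>(2,3)[of x] by (intro mult_mono) (auto simp: max_def min_def)
    then show ?thesis by simp
  qed
  have zF: "F N x = 0" if "x \<notin> cball c R" for x using f(3)[OF that] by (simp add: F_def)
  have bnd: "\<bar>F N x - H n x\<bar> ^ p \<le> (2 * real N) ^ p * indicator (cball c (R + 1)) x" for n x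
  proof (cases "x \<in> cball c (R + 1)")
    case True
    have "\<bar>F N x - H n x\<bar> \<le> 2 * real N" using FN[of N x] HN[of n x] by linarith
    then have "\<bar>F N x - H n x\<bar> ^ p \<le> (2 * real N) ^ p" by (intro power_mono) auto
    then show ?thesis using True by simp
  next
    case False
    then show ?thesis using zF[of x] zH[of x] p0 by (auto simp: zero_power)
  qed
  have ib: "integrable lborel (\<lambda>x. (2 * real N) ^ p * indicator (cball c (R + 1)) x)"
    by (intro integrable_mult_right integrable_real_indicator) (auto intro!: emeasure_bounded_finite[unfolded infinity_ennreal_def])
  have "(\<lambda>n. LINT x|lborel. \<bar>F N x - H n x\<bar> ^ p) \<longlonglongrightarrow> (LINT x|(lborel :: 'a measure). (0::real))"
  proof (rule integral_dominated_convergence[where w="\<lambda>x. (2 * real N) ^ p * indicator (cball c (R + 1)) x"])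
    show "AE x in lborel. (\<lambda>n. \<bar>F N x - H n x\<bar> ^ p) \<longlonglongrightarrow> 0"
      using ae
    proof eventually_elim
      case (elim x)
      have "(\<lambda>n. H n x) \<longlonglongrightarrow> \<eta> x * max (- real N) (min (real N) (f x))"
        unfolding H_def by (intro tendsto_intros NG(3) elim)
      also have "\<eta> x * max (- real N) (min (real N) (f x)) = F N x"
        using \<eta>(4)[of x] zF[of x] by (cases "x \<in> cball c R") (auto simp: F_def)
      finally have "(\<lambda>n. \<bar>F N x - H n x\<bar> ^ p) \<longlonglongrightarrow> \<bar>F N x - F N x\<bar> ^ p"
        by (intro tendsto_intros)
      moreover have "\<bar>F N x - F N x\<bar> ^ p = 0" using p0 by (simp add: zero_power)
      ultimately show ?case by (simp only:)
    qed
  qed (use bnd ib in auto)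
  then have "\<forall>\<^sub>F n in sequentially. (LINT x|lborel. \<bar>F N x - H n x\<bar> ^ p) < \<theta> / 4"
    by (rule order_tendstoD(2)) (use \<theta> in simp)
  then obtain n where n: "(LINT x|lborel. \<bar>F N x - H n x\<bar> ^ p) < \<theta> / 4"
    by (auto simp: eventually_sequentially)
  have iH: "integrable lborel (\<lambda>x. \<bar>F N x - H n x\<bar> ^ p)"
    by (rule Bochner_Integration.integrable_bound[OF ib]) (use bnd in \<open>auto intro!: AE_I2 order_trans[OF _ abs_ge_self]\<close>)
  have i2: "integrable lborel (\<lambda>x. 2 * \<bar>f x - F N x\<bar> ^ p + 2 * \<bar>F N x - H n x\<bar> ^ p)" using iF iH by simp
  have le: "\<bar>f x - H n x\<bar> ^ p \<le> 2 * \<bar>f x - F N x\<bar> ^ p + 2 * \<bar>F N x - H n x\<bar> ^ p" for x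
    using two_power_ineq[OF p, of "f x - F N x" "F N x - H n x"] by simp
  show ?thesis
  proof (rule that[OF cH zH])
    show i: "integrable lborel (\<lambda>x. \<bar>f x - H n x\<bar> ^ p)"
      by (rule Bochner_Integration.integrable_bound[OF i2]) (use order_trans[OF le abs_ge_self] in \<open>auto\<close>)
    have "(LINT x|lborel. \<bar>f x - H n x\<bar> ^ p) \<le> (LINT x|lborel. 2 * \<bar>f x - F N x\<bar> ^ p + 2 * \<bar>F N x - H n x\<bar> ^ p)"
      by (intro integral_mono i i2 le)
    also have "\<dots> < \<theta>" using iF iH N n by simp
    finally show "(LINT x|lborel. \<bar>f x - H n x\<bar> ^ p) < \<theta>" .
  qed
qed

lemma mollify_uniform:
  fixes g :: "'a::euclidean_space \<Rightarrow> real"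
  assumes g: "continuous_on UNIV g" "\<And>x. x \<notin> cball c R \<Longrightarrow> g x = 0" and \<eta>: "\<eta> > 0"
  obtains \<epsilon>0 where "\<epsilon>0 > 0" "\<epsilon>0 \<le> 1" "\<And>\<epsilon> k x. \<epsilon> \<le> \<epsilon>0 \<Longrightarrow> mollifier \<epsilon> k \<Longrightarrow>
     \<bar>mollify k g x - g x\<bar> \<le> \<eta> * indicator (cball c (R + 1)) x"
proof -
  \<comment> \<open>The radius \<open>R + 2\<close> contains every point that a kernel of width at
    most 1 can see from \<open>cball c (R + 1)\<close>.\<close>
  have "uniformly_continuous_on (cball c (R + 2)) g"
    by (intro compact_uniformly_continuous continuous_on_subset[OF g(1)]) auto
  then obtain d where d: "d > 0" "\<And>x y. x \<in> cball c (R + 2) \<Longrightarrow> y \<in> cball c (R + 2) \<Longrightarrow> dist y x < d \<Longrightarrow> dist (g y) (g x) < \<eta>"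
    using \<eta> unfolding uniformly_continuous_on_def by metis
  have ig: "integrable lborel g" by (rule integrable_compact_support[OF g])
  show ?thesis
  proof (rule that[of "min d 1"])
    show "min d 1 > 0" "min d 1 \<le> 1" using d by auto
    fix \<epsilon> x and k :: "'a \<Rightarrow> real" assume \<epsilon>: "\<epsilon> \<le> min d 1" and k: "mollifier \<epsilon> k"
    note kD = mollifierD[OF k]
    obtain B where B: "\<And>x. \<bar>k x\<bar> \<le> B"
      using mollifier_bounded[OF k] by blast
    have "integrable lborel k" by (rule mollifier_integrable[OF k])
    from lborel_integrable_translate[OF this, of "- x"] have ik: "integrable lborel (\<lambda>y. k (y - x))" by simp
    have k1: "(LINT y|lborel. k (y - x)) = 1"
      using lborel_integral_translate[of k "- x"] kD(4,6) by simp
    have igk: "integrable lborel (\<lambda>y. g y * k (y - x))" by (rule bounded_mult_integrable[OF ig kD(6) B])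
    have "\<bar>mollify k g x - g x\<bar> = \<bar>LINT y|lborel. g y * k (y - x) - g x * k (y - x)\<bar>"
      using igk ik k1 by (simp add: mollify_def)
    also have "\<dots> \<le> (LINT y|lborel. \<bar>g y * k (y - x) - g x * k (y - x)\<bar>)" by (rule integral_abs_bound)
    also have "\<dots> \<le> (LINT y|lborel. (\<eta> * indicator (cball c (R + 1)) x) * k (y - x))"
    proof (rule integral_mono)
      show "integrable lborel (\<lambda>y. \<bar>g y * k (y - x) - g x * k (y - x)\<bar>)" using igk ik by simp
      show "integrable lborel (\<lambda>y. (\<eta> * indicator (cball c (R + 1)) x) * k (y - x))" using ik by simp
      fix y
      show "\<bar>g y * k (y - x) - g x * k (y - x)\<bar> \<le> (\<eta> * indicator (cball c (R + 1)) x) * k (y - x)"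
      proof (cases "dist y x < \<epsilon>")
        case False
        then have "k (y - x) = 0" by (intro kD(3)) (simp add: mem_ball_0 dist_norm del: mem_ball)
        then show ?thesis by simp
      next
        case True
        have "\<bar>g y - g x\<bar> \<le> \<eta> * indicator (cball c (R + 1)) x"
        proof (cases "x \<in> cball c (R + 1)")
          case x: True
          have "dist c y \<le> dist c x + dist y x" by (metis dist_commute dist_triangle)
          then have "y \<in> cball c (R + 2)" using x True \<epsilon> by simp
          then have "dist (g y) (g x) < \<eta>" using x True \<epsilon> by (intro d(2)) auto
          then show ?thesis using x by (simp add: dist_real_def)
        next
          case x: False
          have "dist c x \<le> dist c y + dist y x" by (metis dist_triangle)
          then have "y \<notin> cball c R" using x True \<epsilon> by simp
          then show ?thesis using g(2) x by auto
        qed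
        then have "\<bar>g y - g x\<bar> * k (y - x) \<le> (\<eta> * indicator (cball c (R + 1)) x) * k (y - x)"
          using kD(2) by (intro mult_right_mono) auto
        then show ?thesis using kD(2)[of "y - x"] by (simp add: left_diff_distrib[symmetric] abs_mult)
      qed
    qed
    also have "\<dots> = \<eta> * indicator (cball c (R + 1)) x" using k1 by simp
    finally show "\<bar>mollify k g x - g x\<bar> \<le> \<eta> * indicator (cball c (R + 1)) x" .
  qed
qed

text \<open>Comparison with a continuous \<open>g\<close>: the error \<open>f - g\<close> does not
  grow under mollification, and \<open>mollify k g\<close> converges to \<open>g\<close> uniformly
  on a bounded set outside of which both vanish.\<close>

lemma mollify_Lp:
  fixes f :: "'a::euclidean_space \<Rightarrow> real"
  assumes p: "p = 1 \<or> p = (2::nat)" and R: "R > 0"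
    and f: "integrable lborel f" "integrable lborel (\<lambda>x. \<bar>f x\<bar> ^ p)" "\<And>x. x \<notin> cball c R \<Longrightarrow> f x = 0"
    and \<theta>: "\<theta> > 0"
  obtains \<epsilon>0 where "\<epsilon>0 > 0" "\<And>\<epsilon> k. \<epsilon> \<le> \<epsilon>0 \<Longrightarrow> mollifier \<epsilon> k \<Longrightarrow>
     integrable lborel (\<lambda>x. \<bar>mollify k f x - f x\<bar> ^ p) \<and> (LINT x|lborel. \<bar>mollify k f x - f x\<bar> ^ p) \<le> \<theta>"
proof -
  have p0: "p > 0" using p by auto
  have \<theta>16: "\<theta> / 16 > 0" using \<theta> by simp
  have fm: "f \<in> borel_measurable borel" using f(1) by simp
  obtain g where g: "continuous_on UNIV g" "\<And>x. x \<notin> cball c (R + 1) \<Longrightarrow> g x = 0"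
    "integrable lborel (\<lambda>x. \<bar>f x - g x\<bar> ^ p)" "(LINT x|lborel. \<bar>f x - g x\<bar> ^ p) < \<theta> / 16"
    using Lp_dense_continuous[OF p R fm f(2,3) \<theta>16] by blast
  have ig: "integrable lborel g" by (rule integrable_compact_support[OF g(1,2)])
  define V where "V = measure lborel (cball c (R + 1 + 1))"
  have V: "V \<ge> 0" by (simp add: V_def)
  \<comment> \<open>The bound by 1 gives \<open>\<eta> ^ p \<le> \<eta>\<close> for both exponents;
    the other bound keeps \<open>\<eta>\<close> times the volume \<open>V\<close> at most
    \<open>\<theta> / 16\<close>.\<close>
  define \<eta> where "\<eta> = min 1 (\<theta> / (16 * (V + 1)))"
  have \<eta>: "\<eta> > 0" using \<theta> V by (simp add: \<eta>_def)
  obtain \<epsilon>0 where \<epsilon>0: "\<epsilon>0 > 0" "\<And>\<epsilon> k x. \<epsilon> \<le> \<epsilon>0 \<Longrightarrow> mollifier \<epsilon> k \<Longrightarrow>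
     \<bar>mollify k g x - g x\<bar> \<le> \<eta> * indicator (cball c (R + 1 + 1)) x"
    by (rule mollify_uniform[OF g(1) _ \<eta>, of c "R + 1"]) (use g(2) in blast, blast)
  show ?thesis
  proof (rule that[OF \<epsilon>0(1)])
    fix \<epsilon> and k :: "'a \<Rightarrow> real" assume \<epsilon>: "\<epsilon> \<le> \<epsilon>0" and k: "mollifier \<epsilon> k"
    note kD = mollifierD[OF k]
    obtain B where B: "\<And>x. \<bar>k x\<bar> \<le> B"
      using mollifier_bounded[OF k] by blast
    have ifg: "integrable lborel (\<lambda>x. f x - g x)" using f(1) ig by simp
    have mfg: "mollify k (\<lambda>x. f x - g x) x = mollify k f x - mollify k g x" for x
      unfolding mollify_def left_diff_distrib
      by (intro Bochner_Integration.integral_diff bounded_mult_integrable[OF _ kD(6) B] f ig)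
    note c = mollify_contraction[OF k p ifg g(3), unfolded mfg]
    have [measurable]: "mollify k f \<in> borel_measurable borel" "mollify k g \<in> borel_measurable borel"
      by (intro borel_measurable_continuous_onI continuous_mollify[OF _ kD(5) B] f ig)+
    have [measurable]: "g \<in> borel_measurable borel" using ig by simp
    note [measurable] = fm
    have "\<eta> \<le> 1" by (simp add: \<eta>_def)
    then have "\<eta> * \<eta> \<le> \<eta> * 1" using \<eta> by (intro mult_left_mono) auto
    then have \<eta>p: "\<eta> ^ p \<le> \<eta>" using p by (auto simp: power2_eq_square)
    have b2: "\<bar>mollify k g x - g x\<bar> ^ p \<le> \<eta> * indicator (cball c (R + 1 + 1)) x" for x
    proof -
      have "\<bar>mollify k g x - g x\<bar> ^ p \<le> (\<eta> * indicator (cball c (R + 1 + 1)) x) ^ p"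
        using \<epsilon>0(2)[OF \<epsilon> k] by (intro power_mono) auto
      also have "\<dots> \<le> \<eta> * indicator (cball c (R + 1 + 1)) x" using \<eta>p p0 by (auto simp: indicator_def zero_power)
      finally show ?thesis .
    qed
    have iV: "integrable lborel (\<lambda>x. \<eta> * indicator (cball c (R + 1 + 1)) x)"
      by (intro integrable_mult_right integrable_real_indicator) (auto intro!: emeasure_bounded_finite[unfolded infinity_ennreal_def])
    have i2: "integrable lborel (\<lambda>x. \<bar>mollify k g x - g x\<bar> ^ p)"
      by (rule Bochner_Integration.integrable_bound[OF iV]) (use order_trans[OF b2 abs_ge_self] in \<open>auto\<close>)
    have "(LINT x|lborel. \<bar>mollify k g x - g x\<bar> ^ p) \<le> (LINT x|lborel. \<eta> * indicator (cball c (R + 1 + 1)) x)"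
      by (intro integral_mono i2 iV b2)
    also have "\<dots> = \<eta> * V" by (simp add: V_def)
    also have "\<dots> \<le> \<theta> / (16 * (V + 1)) * V" using V by (intro mult_right_mono) (auto simp: \<eta>_def)
    also have "\<dots> \<le> \<theta> / 16" using V \<theta> by (simp add: field_simps)
    finally have I2: "(LINT x|lborel. \<bar>mollify k g x - g x\<bar> ^ p) \<le> \<theta> / 16" .
    let ?h = "\<lambda>x. 2 * \<bar>mollify k f x - mollify k g x\<bar> ^ p + 2 * (2 * \<bar>mollify k g x - g x\<bar> ^ p + 2 * \<bar>f x - g x\<bar> ^ p)"
    have le: "\<bar>mollify k f x - f x\<bar> ^ p \<le> ?h x" for x
    proof -
      have 1: "\<bar>mollify k f x - f x\<bar> ^ p \<le> 2 * \<bar>mollify k f x - mollify k g x\<bar> ^ p + 2 * \<bar>mollify k g x - f x\<bar> ^ p"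
        using two_power_ineq[OF p, of "mollify k f x - mollify k g x" "mollify k g x - f x"] by simp
      have 2: "\<bar>mollify k g x - f x\<bar> ^ p \<le> 2 * \<bar>mollify k g x - g x\<bar> ^ p + 2 * \<bar>f x - g x\<bar> ^ p"
        using two_power_ineq[OF p, of "mollify k g x - g x" "g x - f x"] by (simp add: abs_minus_commute)
      show ?thesis by (rule order_trans[OF 1 add_left_mono[OF mult_left_mono[OF 2]]]) simp
    qed
    have ih: "integrable lborel ?h" using c(1) i2 g(3) by simp
    have i: "integrable lborel (\<lambda>x. \<bar>mollify k f x - f x\<bar> ^ p)"
      by (rule Bochner_Integration.integrable_bound[OF ih]) (use order_trans[OF le abs_ge_self] in \<open>auto\<close>)
    have "(LINT x|lborel. \<bar>mollify k f x - f x\<bar> ^ p) \<le> (LINT x|lborel. ?h x)" by (intro integral_mono i ih le)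
    also have "\<dots> = 2 * (LINT x|lborel. \<bar>mollify k f x - mollify k g x\<bar> ^ p)
        + 2 * (2 * (LINT x|lborel. \<bar>mollify k g x - g x\<bar> ^ p) + 2 * (LINT x|lborel. \<bar>f x - g x\<bar> ^ p))"
      using c(1) i2 g(3) by simp
    also have "\<dots> \<le> 2 * (\<theta> / 16) + 2 * (2 * (\<theta> / 16) + 2 * (\<theta> / 16))"
      using c(2) g(4) I2 by (intro add_mono mult_left_mono) auto
    also have "\<dots> \<le> \<theta>" using \<theta> by simp
    finally show "integrable lborel (\<lambda>x. \<bar>mollify k f x - f x\<bar> ^ p) \<and> (LINT x|lborel. \<bar>mollify k f x - f x\<bar> ^ p) \<le> \<theta>"
      using i by simp
  qed
qed

section \<open>Reduction of weak solutions to C2 functions\<close>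

lemma translate_test_function:
  fixes k :: "'a::euclidean_space \<Rightarrow> real"
  assumes k: "mollifier \<epsilon> k" and sub: "cball x \<epsilon> \<subseteq> \<Omega>"
  shows "(\<lambda>y. k (y - x)) \<in> test_functions \<Omega>"
    and "laplacian (\<lambda>y. k (y - x)) y = laplacian k (y - x)"
proof -
  note kD = mollifierD[OF k]
  have d: "dd i (\<lambda>y. f (y - x)) (\<lambda>y. f' (y - x))" if "dd i f f'" for i f f'
    using that unfolding dd_def by (metis (no_types, lifting) add_diff_eq diff_add_eq ext)
  show "(\<lambda>y. k (y - x)) \<in> test_functions \<Omega>"
  proof (rule test_functionsI[of _ "cball x \<epsilon>"])
    show "cball x \<epsilon> \<subseteq> \<Omega>" by (rule sub)
    show "k (y - x) = 0" if "y \<notin> cball x \<epsilon>" for y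
      by (rule mollifier_zero[OF k]) (use that in \<open>simp add: dist_norm norm_minus_commute\<close>)
  qed (auto intro: C_k_translate kD(1))
  note t = this
  have 1: "partial_deriv i (\<lambda>y. k (y - x)) = (\<lambda>y. partial_deriv i k (y - x))" for i
    by (rule dd_unique[OF test_functions_dd[OF t] d[OF C_k_imp_dd[OF kD(1)[of "Suc 0"]]]])
  have 2: "partial_deriv i (\<lambda>y. partial_deriv i k (y - x)) y = partial_deriv i (partial_deriv i k) (y - x)" if i: "i \<in> Basis" for i
  proof -
    have "C_k (Suc 0) (partial_deriv i k)" using kD(1)[of "Suc (Suc 0)"] i by simp
    from dd_unique[OF test_functions_dd[OF test_functions_partial[OF t i, unfolded 1]] d[OF C_k_imp_dd[OF this]]]
    show ?thesis by (rule fun_cong)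
  qed
  show "laplacian (\<lambda>y. k (y - x)) y = laplacian k (y - x)"
    unfolding laplacian_def by (intro sum.cong refl) (simp only: 1 2)
qed

lemma ball_volume_bint:
  assumes "c1 \<ge> 0"
  shows "integrable lborel (\<lambda>x. indicator (ball c R) x * (c1::real))" "bint (ball c R) (\<lambda>x. c1) = c1 * measure lborel (ball c R)"
proof -
  show "integrable lborel (\<lambda>x. indicator (ball c R) x * (c1::real))" by (rule bint_integrable) auto
  show "bint (ball c R) (\<lambda>x. c1) = c1 * measure lborel (ball c R)" unfolding bint_def by simp
qed

lemma square_sum_le: "(a + b)\<^sup>2 \<le> 2 * a\<^sup>2 + 2 * (b::real)\<^sup>2"
  using zero_le_power2[of "a - b"] by (simp add: power2_eq_square algebra_simps)

lemma integrable_indicator_mult: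
  fixes f :: "'a::euclidean_space \<Rightarrow> real"
  shows "integrable lborel f \<Longrightarrow> S \<in> sets borel \<Longrightarrow> integrable lborel (\<lambda>x. indicator S x * f x)"
  using integrable_mult_indicator[of S lborel f] by simp

lemma bint_le_integral:
  assumes "integrable lborel f" "S \<in> sets borel" "\<And>x. 0 \<le> f x"
  shows "bint S f \<le> (LINT x|lborel. f x)"
  unfolding bint_def using assms
  by (intro integral_mono integrable_indicator_mult) (auto simp: indicator_def)

lemma square_integrable_imp_integrable:
  fixes u :: "'a::euclidean_space \<Rightarrow> real"
  assumes "u \<in> borel_measurable borel" "integrable lborel (\<lambda>x. (u x)\<^sup>2)" "\<And>x. x \<notin> ball c R \<Longrightarrow> u x = 0"
  shows "integrable lborel u"
proof (rule Bochner_Integration.integrable_bound[where f="\<lambda>x. indicator (ball c R) x * 1 + (u x)\<^sup>2"])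
  show "integrable lborel (\<lambda>x. indicator (ball c R) x * 1 + (u x)\<^sup>2)"
    using ball_volume_bint(1)[of 1 c R] assms(2) by simp
  have "\<bar>t\<bar> \<le> 1 + t\<^sup>2" for t :: real
    using zero_le_power2[of "\<bar>t\<bar> - 1"] by (simp add: power2_eq_square algebra_simps abs_mult_self_eq)
  then show "AE x in lborel. norm (u x) \<le> norm (indicator (ball c R) x * 1 + (u x)\<^sup>2)"
    using assms(3) by (auto simp: indicator_def intro!: AE_I2)
qed (use assms(1) in simp)

text \<open>Subtracting from \<open>u\<close> the Laplacian of an almost minimiser reduces the distributional equation to
  \<open>\<Delta>Z = P u\<close> up to an \<open>L\<^sup>2\<close> error, at the cost of an \<open>L\<^sup>2\<close> term controlled by the \<open>H\<^sup>-\<^sup>2\<close> norm.\<close>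

lemma smooth_approximation:
  fixes u P :: "'a::euclidean_space \<Rightarrow> real"
  assumes R: "0 < R'" "R' < R"
    and u: "u \<in> borel_measurable borel" "integrable lborel (\<lambda>x. (u x)\<^sup>2)" "\<And>x. x \<notin> ball c R \<Longrightarrow> u x = 0"
    and P: "P \<in> borel_measurable borel" "\<And>x. \<bar>P x\<bar> \<le> M"
    and N: "N \<ge> 0" "\<And>v. v \<in> test_functions (ball c R) \<Longrightarrow>
      \<bar>LINT x|lborel. u x * (P x * v x - laplacian v x)\<bar> \<le> N * sqrt (LINT x|lborel. (laplacian v x)\<^sup>2)"
    and \<theta>: "\<theta> > 0"
  obtains Z Z1 Z2 where "C2 Z Z1 Z2"
    "integrable lborel (\<lambda>x. indicator (ball c R') x * (Z x - u x)\<^sup>2)"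
    "bint (ball c R') (\<lambda>x. (Z x - u x)\<^sup>2) \<le> 4 * N\<^sup>2 + \<theta>"
    "integrable lborel (\<lambda>x. indicator (ball c R') x * ((\<Sum>i\<in>Basis. Z2 i i x) - P x * u x)\<^sup>2)"
    "bint (ball c R') (\<lambda>x. ((\<Sum>i\<in>Basis. Z2 i i x) - P x * u x)\<^sup>2) \<le> \<theta>"
proof -
  have R0: "R > 0" using R by simp
  note [measurable] = u(1) P(1)
  have M: "M \<ge> 0" using P(2)[of c] by linarith
  have u0: "u x = 0" if "x \<notin> cball c R" for x using u(3)[of x] that by auto
  define h where "h x = P x * u x" for x
  have h0: "h x = 0" if "x \<notin> cball c R" for x using u0[OF that] by (simp add: h_def)
  have [measurable]: "h \<in> borel_measurable borel" unfolding h_def by measurable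
  have ui: "integrable lborel u" by (rule square_integrable_imp_integrable[OF u])
  have hi: "integrable lborel h"
    by (rule Bochner_Integration.integrable_bound[where f="\<lambda>x. M * u x"])
      (use ui P(2) M in \<open>auto simp: h_def abs_mult intro!: AE_I2 mult_right_mono\<close>)
  have h2: "integrable lborel (\<lambda>x. (h x)\<^sup>2)"
  proof (rule Bochner_Integration.integrable_bound[where f="\<lambda>x. M\<^sup>2 * (u x)\<^sup>2"])
    have "(P x)\<^sup>2 \<le> M\<^sup>2" for x using P(2)[of x] by (metis abs_ge_zero power2_abs power_mono)
    then show "AE x in lborel. norm ((h x)\<^sup>2) \<le> norm (M\<^sup>2 * (u x)\<^sup>2)"
      by (auto simp: h_def power_mult_distrib intro!: AE_I2 mult_right_mono)
  qed (use u in auto)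
  have p2: "2 = 1 \<or> 2 = (2::nat)" by simp
  define V where "V = measure lborel (ball c R')"
  have V: "V \<ge> 0" by (simp add: V_def)
  \<comment> \<open>The first estimate spends \<open>2 * \<theta>' + 4 * \<delta>\<^sup>2\<close>,
    with \<open>\<delta>\<^sup>2 \<le> \<theta>'\<close>, and the second spends
    \<open>4 * \<theta>'\<close>.\<close>
  define \<theta>' where "\<theta>' = \<theta> / 8"
  have \<theta>': "\<theta>' > 0" using \<theta> by (simp add: \<theta>'_def)
  obtain \<epsilon>1 where \<epsilon>1: "\<epsilon>1 > 0" "\<And>\<epsilon> k. \<epsilon> \<le> \<epsilon>1 \<Longrightarrow> mollifier \<epsilon> k \<Longrightarrow>
     integrable lborel (\<lambda>x. \<bar>mollify k u x - u x\<bar> ^ 2) \<and> (LINT x|lborel. \<bar>mollify k u x - u x\<bar> ^ 2) \<le> \<theta>'"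
    by (rule mollify_Lp[OF p2 R0 ui _ _ \<theta>', of c]) (use u(2) u0 in auto)
  obtain \<epsilon>2 where \<epsilon>2: "\<epsilon>2 > 0" "\<And>\<epsilon> k. \<epsilon> \<le> \<epsilon>2 \<Longrightarrow> mollifier \<epsilon> k \<Longrightarrow>
     integrable lborel (\<lambda>x. \<bar>mollify k h x - h x\<bar> ^ 2) \<and> (LINT x|lborel. \<bar>mollify k h x - h x\<bar> ^ 2) \<le> \<theta>'"
    by (rule mollify_Lp[OF p2 R0 hi _ _ \<theta>', of c]) (use h2 h0 in auto)
  \<comment> \<open>The bound by \<open>R - R'\<close> keeps a kernel placed at a point of
    \<open>ball c R'\<close> supported in \<open>ball c R\<close>, where the weak equation can be
    tested.\<close>
  define \<epsilon> where "\<epsilon> = min (min \<epsilon>1 \<epsilon>2) (R - R')"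
  have \<epsilon>: "\<epsilon> > 0" "\<epsilon> \<le> \<epsilon>1" "\<epsilon> \<le> \<epsilon>2" "\<epsilon> \<le> R - R'" using \<epsilon>1 \<epsilon>2 R by (auto simp: \<epsilon>_def)
  obtain k :: "'a \<Rightarrow> real" where k: "mollifier \<epsilon> k"
    using exists_mollifier[OF \<epsilon>(1)] unfolding mollifier_def by metis
  note kD = mollifierD[OF k]
  obtain B where B: "\<And>x. \<bar>k x\<bar> \<le> B" using mollifier_bounded[OF k] by blast
  define k1 where "k1 = (\<lambda>i. partial_deriv i k)"
  define k2 where "k2 = (\<lambda>i j. partial_deriv j (partial_deriv i k))"
  have kC2: "C2 k k1 k2" unfolding k1_def k2_def by (rule C_k_imp_C2[OF kD(1)])
  have k20: "k2 i i x = 0" if "x \<notin> cball 0 \<epsilon>" "i \<in> Basis" for i x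
    using C2_zero_outside(2)[OF kC2, of 0 \<epsilon>] mollifier_zero[OF k] that by blast
  have klap: "laplacian k x = (\<Sum>i\<in>Basis. k2 i i x)" for x unfolding laplacian_def k2_def ..
  have clk: "continuous_on UNIV (laplacian k)"
    unfolding klap[abs_def] by (intro continuous_on_sum C2D(5)[OF kC2])
  \<comment> \<open>The almost minimiser is chosen after the kernel: its accuracy
    \<open>\<delta>\<close> has to compensate \<open>sqrt \<mu>\<close>, which depends on the
    kernel, so that the pointwise error stays below \<open>e\<close>. In turn
    \<open>e\<^sup>2\<close> times the volume of \<open>ball c R'\<close> is at most
    \<open>\<theta>'\<close>.\<close>
  define \<mu> where "\<mu> = (LINT x|lborel. (laplacian k x)\<^sup>2)"
  have \<mu>: "\<mu> \<ge> 0" unfolding \<mu>_def by (intro Bochner_Integration.integral_nonneg) auto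
  define e where "e = sqrt (\<theta>' / (V + 1))"
  have e: "e > 0" using \<theta>' V by (simp add: e_def)
  define \<delta> where "\<delta> = min (sqrt \<theta>') (e / (sqrt \<mu> + 1))"
  have s\<mu>: "sqrt \<mu> + 1 > 0" using \<mu> by (smt (verit) real_sqrt_ge_zero)
  have \<delta>: "\<delta> > 0" using e s\<mu> \<theta>' by (simp add: \<delta>_def)
  have \<delta>\<theta>: "\<delta>\<^sup>2 \<le> \<theta>'"
  proof -
    have "\<delta>\<^sup>2 \<le> (sqrt \<theta>')\<^sup>2" using \<delta> by (intro power_mono) (auto simp: \<delta>_def)
    then show ?thesis using \<theta>' by simp
  qed
  have \<delta>\<mu>: "\<delta> * sqrt \<mu> \<le> e"
  proof -
    have "\<delta> * sqrt \<mu> \<le> e / (sqrt \<mu> + 1) * (sqrt \<mu> + 1)"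
      using \<delta> s\<mu> e \<mu> by (intro mult_mono) (auto simp: \<delta>_def)
    then show ?thesis using s\<mu> by simp
  qed
  define F where "F v = (LINT x|lborel. u x * (P x * v x - laplacian v x))" for v
  have iF: "integrable lborel (\<lambda>x. h x * v x)" "integrable lborel (\<lambda>x. u x * laplacian v x)"
    if v: "v \<in> test_functions (ball c R)" for v
  proof -
    have z: "v x = 0" "laplacian v x = 0" if "x \<notin> cball c R" for x
      using test_functions_zero[OF v, of x] laplacian_zero[OF v, of x] that by auto
    obtain B1 where "\<And>x. \<bar>v x\<bar> \<le> B1" using compact_support_bounded[OF test_functions_continuous[OF v] z(1)] by blast
    then show "integrable lborel (\<lambda>x. h x * v x)"
      using bounded_mult_integrable[OF hi, of v B1 0] test_functions_continuous[OF v]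
      by (simp add: borel_measurable_continuous_onI)
    obtain B2 where "\<And>x. \<bar>laplacian v x\<bar> \<le> B2" using compact_support_bounded[OF laplacian_continuous[OF v] z(2)] by blast
    then show "integrable lborel (\<lambda>x. u x * laplacian v x)"
      using bounded_mult_integrable[OF ui, of "laplacian v" B2 0] laplacian_continuous[OF v]
      by (simp add: borel_measurable_continuous_onI)
  qed
  have Feq: "F v = (LINT x|lborel. h x * v x) - (LINT x|lborel. u x * laplacian v x)"
    if v: "v \<in> test_functions (ball c R)" for v
  proof -
    have "F v = (LINT x|lborel. h x * v x - u x * laplacian v x)"
      unfolding F_def h_def by (simp add: algebra_simps)
    then show ?thesis using iF[OF v] by simp
  qed
  have Flin: "F (\<lambda>x. v x + t * w x) = F v + t * F w"
    if v: "v \<in> test_functions (ball c R)" and w: "w \<in> test_functions (ball c R)" for v w t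
  proof -
    have vw: "(\<lambda>x. v x + t * w x) \<in> test_functions (ball c R)"
      by (intro test_functions_add test_functions_cmult v w)
    have "(LINT x|lborel. h x * (v x + t * w x)) = (LINT x|lborel. h x * v x + t * (h x * w x))"
      by (simp add: algebra_simps)
    moreover have "(LINT x|lborel. u x * laplacian (\<lambda>x. v x + t * w x) x)
        = (LINT x|lborel. u x * laplacian v x + t * (u x * laplacian w x))"
      unfolding laplacian_add_cmult[OF v w] by (simp add: algebra_simps)
    ultimately show ?thesis
      unfolding Feq[OF vw] Feq[OF v] Feq[OF w] using iF[OF v] iF[OF w] by (simp add: algebra_simps)
  qed
  have Fbd: "\<bar>F v\<bar> \<le> N * sqrt (LINT x|lborel. (laplacian v x)\<^sup>2)" if "v \<in> test_functions (ball c R)" for v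
    unfolding F_def by (rule N(2)[OF that])
  obtain v0 where v0: "v0 \<in> test_functions (ball c R)" "(LINT x|lborel. (laplacian v0 x)\<^sup>2) \<le> (N + \<delta>)\<^sup>2"
    "\<And>v. v \<in> test_functions (ball c R) \<Longrightarrow>
      \<bar>F v + (LINT x|lborel. laplacian v0 x * laplacian v x)\<bar> \<le> \<delta> * sqrt (LINT x|lborel. (laplacian v x)\<^sup>2)"
    using almost_minimiser[of c R F N \<delta>, OF Flin Fbd N(1) \<delta>] by blast
  define w where "w = laplacian v0"
  have cw: "continuous_on UNIV w" unfolding w_def by (rule laplacian_continuous[OF v0(1)])
  have w0: "w x = 0" if "x \<notin> cball c R" for x
    unfolding w_def using laplacian_zero[OF v0(1), of x] that by auto
  have wi: "integrable lborel w" by (rule integrable_compact_support[OF cw w0])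
  have w2: "integrable lborel (\<lambda>x. (w x)\<^sup>2)"
    by (rule integrable_compact_support[where c=c and R=R]) (use w0 in \<open>auto intro!: continuous_intros cw\<close>)
  define z where "z x = u x - w x" for x
  have zi: "integrable lborel z" unfolding z_def using ui wi by simp
  define Z where "Z = mollify k z"
  define Z2 where "Z2 = (\<lambda>i j. mollify (k2 i j) z)"
  have ZC2: "C2 Z (\<lambda>i x. - mollify (k1 i) z x) Z2"
    unfolding Z_def Z2_def by (rule C2_mollify[OF zi kC2 mollifier_zero[OF k]])
  have cZ: "continuous_on UNIV Z" by (rule C2D(1)[OF ZC2])
  define L where "L x = (\<Sum>i\<in>Basis. Z2 i i x)" for x
  have cL: "continuous_on UNIV L" unfolding L_def by (intro continuous_on_sum C2D(5)[OF ZC2])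
  have [measurable]: "Z \<in> borel_measurable borel" "L \<in> borel_measurable borel" "w \<in> borel_measurable borel" "z \<in> borel_measurable borel"
    using cZ cL cw zi by (auto intro: borel_measurable_continuous_onI)
  have cm: "continuous_on UNIV (mollify k f)" if "integrable lborel f" for f
    by (rule continuous_mollify[OF that kD(5) B])
  have [measurable]: "mollify k h \<in> borel_measurable borel" "mollify k u \<in> borel_measurable borel" "mollify k w \<in> borel_measurable borel"
    using cm hi ui wi by (auto intro: borel_measurable_continuous_onI)
  have Lint: "L x = (LINT y|lborel. z y * laplacian k (y - x))" for x
  proof -
    have "integrable lborel (\<lambda>y. z y * k2 i i (y - x))" if i: "i \<in> Basis" for i
    proof -
      obtain b where "\<And>x. \<bar>k2 i i x\<bar> \<le> b"
        using compact_support_bounded[OF C2D(5)[OF kC2 i i] k20[OF _ i]] by blast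
      then show ?thesis
        using bounded_mult_integrable[OF zi borel_measurable_continuous_onI[OF C2D(5)[OF kC2 i i]]] by blast
    qed
    then show ?thesis
      unfolding L_def Z2_def mollify_def klap sum_distrib_left
      by (subst Bochner_Integration.integral_sum) auto
  qed
  \<comment> \<open>Testing the approximate Euler-Lagrange identity with the kernel translated to
    \<open>x\<close> makes it pointwise: the Laplacian of \<open>Z\<close> at \<open>x\<close>
    differs from \<open>mollify k h x\<close> by at most
    \<open>\<delta> * sqrt \<mu>\<close>.\<close>
  have Lh: "\<bar>L x - mollify k h x\<bar> \<le> e" if x: "x \<in> ball c R'" for x
  proof -
    have sub: "cball x \<epsilon> \<subseteq> ball c R"
    proof
      fix y assume "y \<in> cball x \<epsilon>"
      moreover have "dist c y \<le> dist c x + dist x y" by (rule dist_triangle)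
      ultimately show "y \<in> ball c R" using x \<epsilon>(4) by simp
    qed
    define \<eta> where "\<eta> = (\<lambda>y. k (y - x))"
    have \<eta>: "\<eta> \<in> test_functions (ball c R)" unfolding \<eta>_def by (rule translate_test_function(1)[OF k sub])
    have l\<eta>: "laplacian \<eta> y = laplacian k (y - x)" for y
      unfolding \<eta>_def by (rule translate_test_function(2)[OF k sub])
    have iw: "integrable lborel (\<lambda>y. w y * laplacian \<eta> y)"
      by (rule integrable_compact_support[where c=c and R=R])
        (use w0 in \<open>auto intro!: continuous_intros cw laplacian_continuous[OF \<eta>]\<close>)
    have "L x = (LINT y|lborel. u y * laplacian \<eta> y - w y * laplacian \<eta> y)"
      unfolding Lint l\<eta> z_def by (simp add: algebra_simps)
    also have "\<dots> = (LINT y|lborel. u y * laplacian \<eta> y) - (LINT y|lborel. w y * laplacian \<eta> y)"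
      using iF(2)[OF \<eta>] iw by simp
    also have "\<dots> = mollify k h x - (F \<eta> + (LINT y|lborel. w y * laplacian \<eta> y))"
      unfolding Feq[OF \<eta>] by (simp add: mollify_def \<eta>_def)
    finally have "\<bar>L x - mollify k h x\<bar> = \<bar>F \<eta> + (LINT y|lborel. w y * laplacian \<eta> y)\<bar>" by simp
    also have "\<dots> \<le> \<delta> * sqrt (LINT y|lborel. (laplacian \<eta> y)\<^sup>2)" unfolding w_def by (rule v0(3)[OF \<eta>])
    also have "(LINT y|lborel. (laplacian \<eta> y)\<^sup>2) = \<mu>"
      unfolding l\<eta> \<mu>_def using lborel_integral_translate[of "\<lambda>y. (laplacian k y)\<^sup>2" "- x"]
        borel_measurable_continuous_onI[OF clk] by simp
    also have "\<delta> * sqrt \<mu> \<le> e" by (rule \<delta>\<mu>)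
    finally show ?thesis .
  qed
  have mh: "integrable lborel (\<lambda>x. (mollify k h x - h x)\<^sup>2)" "(LINT x|lborel. (mollify k h x - h x)\<^sup>2) \<le> \<theta>'"
    using \<epsilon>2(2)[OF \<epsilon>(3) k] by simp_all
  have mu: "integrable lborel (\<lambda>x. (mollify k u x - u x)\<^sup>2)" "(LINT x|lborel. (mollify k u x - u x)\<^sup>2) \<le> \<theta>'"
    using \<epsilon>1(2)[OF \<epsilon>(2) k] by simp_all
  have mw: "integrable lborel (\<lambda>x. (mollify k w x)\<^sup>2)" "(LINT x|lborel. (mollify k w x)\<^sup>2) \<le> (N + \<delta>)\<^sup>2"
    using mollify_contraction[OF k p2 wi] w2 v0(2) by (auto simp: w_def)
  show ?thesis
  proof (rule that[OF ZC2])
    let ?f = "\<lambda>x. 2 * (mollify k u x - u x)\<^sup>2 + 2 * (mollify k w x)\<^sup>2"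
    have Zeq: "Z x = mollify k u x - mollify k w x" for x
      unfolding Z_def mollify_def z_def left_diff_distrib
      by (intro Bochner_Integration.integral_diff bounded_mult_integrable[OF _ kD(6) B] ui wi)
    have fle: "(Z x - u x)\<^sup>2 \<le> ?f x" for x
      using square_sum_le[of "mollify k u x - u x" "- mollify k w x"] by (simp add: Zeq algebra_simps)
    have if1: "integrable lborel ?f" using mu mw by simp
    have if2: "integrable lborel (\<lambda>x. (Z x - u x)\<^sup>2)"
      by (rule Bochner_Integration.integrable_bound[OF if1]) (use order_trans[OF fle abs_ge_self] in auto)
    then show "integrable lborel (\<lambda>x. indicator (ball c R') x * (Z x - u x)\<^sup>2)"
      by (rule integrable_indicator_mult) simp
    have "bint (ball c R') (\<lambda>x. (Z x - u x)\<^sup>2) \<le> (LINT x|lborel. (Z x - u x)\<^sup>2)"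
      by (rule bint_le_integral[OF if2]) auto
    also have "\<dots> \<le> (LINT x|lborel. ?f x)" by (intro integral_mono if1 if2 fle)
    also have "\<dots> = 2 * (LINT x|lborel. (mollify k u x - u x)\<^sup>2) + 2 * (LINT x|lborel. (mollify k w x)\<^sup>2)"
      using mu mw by simp
    also have "\<dots> \<le> 2 * \<theta>' + 2 * (N + \<delta>)\<^sup>2" using mu(2) mw(2) by (intro add_mono mult_left_mono) auto
    also have "\<dots> \<le> 2 * \<theta>' + 2 * (2 * N\<^sup>2 + 2 * \<delta>\<^sup>2)" by (intro add_left_mono mult_left_mono square_sum_le) simp
    also have "\<dots> \<le> 4 * N\<^sup>2 + \<theta>" using \<delta>\<theta> \<theta> by (simp add: \<theta>'_def)
    finally show "bint (ball c R') (\<lambda>x. (Z x - u x)\<^sup>2) \<le> 4 * N\<^sup>2 + \<theta>" .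
    let ?g = "\<lambda>x. 2 * (mollify k h x - h x)\<^sup>2 + indicator (ball c R') x * (2 * e\<^sup>2)"
    have gle: "indicator (ball c R') x * (L x - h x)\<^sup>2 \<le> ?g x" for x
    proof (cases "x \<in> ball c R'")
      case True
      have "(L x - mollify k h x)\<^sup>2 \<le> e\<^sup>2" using Lh[OF True] by (metis abs_ge_zero power2_abs power_mono)
      then show ?thesis
        using True square_sum_le[of "mollify k h x - h x" "L x - mollify k h x"] by simp
    qed simp
    have ig1: "integrable lborel ?g" using mh ball_volume_bint(1)[of "2 * e\<^sup>2" c R'] by simp
    have ig2: "integrable lborel (\<lambda>x. indicator (ball c R') x * (L x - h x)\<^sup>2)"
    proof (rule Bochner_Integration.integrable_bound[OF ig1])
      have [measurable]: "ball c R' \<in> sets borel" by simp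
      show "(\<lambda>x. indicator (ball c R') x * (L x - h x)\<^sup>2) \<in> borel_measurable lborel" by measurable
    qed (use order_trans[OF gle abs_ge_self] in \<open>auto simp: abs_mult\<close>)
    then show "integrable lborel (\<lambda>x. indicator (ball c R') x * ((\<Sum>i\<in>Basis. Z2 i i x) - P x * u x)\<^sup>2)"
      unfolding L_def h_def .
    have "bint (ball c R') (\<lambda>x. (L x - h x)\<^sup>2) \<le> (LINT x|lborel. ?g x)"
      unfolding bint_def by (intro integral_mono ig1 ig2 gle)
    also have "\<dots> = 2 * (LINT x|lborel. (mollify k h x - h x)\<^sup>2) + 2 * e\<^sup>2 * V"
      using mh ball_volume_bint[of "2 * e\<^sup>2" c R'] by (simp add: V_def bint_def)
    also have "\<dots> \<le> 2 * \<theta>' + 2 * \<theta>'"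
    proof (intro add_mono)
      have "e\<^sup>2 * V = \<theta>' / (V + 1) * V" using \<theta>' V by (simp add: e_def)
      also have "\<dots> \<le> \<theta>'" using \<theta>' V by (simp add: field_simps)
      finally show "2 * e\<^sup>2 * V \<le> 2 * \<theta>'" by simp
    qed (use mh in simp)
    also have "\<dots> \<le> \<theta>" using \<theta> by (simp add: \<theta>'_def)
    finally show "bint (ball c R') (\<lambda>x. ((\<Sum>i\<in>Basis. Z2 i i x) - P x * u x)\<^sup>2) \<le> \<theta>"
      unfolding L_def h_def .
  qed
qed

section \<open>Three balls for square integrable functions\<close>

text \<open>\<open>Z\<close> from \<open>smooth_approximation\<close> enters
  \<open>three_balls_C2\<close> on an intermediate ball. Its excess is at most
  \<open>|Delta Z - P * u| + M * |Z - u|\<close>, so it is controlled by the dual bound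
  \<open>N\<close> and by a parameter \<open>\<theta>\<close> that enters linearly and can be sent
  to zero.\<close>

lemma three_balls_L2:
  fixes c :: "'a::euclidean_space"
  assumes r: "0 < r1" "r1 < r2" "r2 < R"
  obtains a C t0 where "a > 0" "C \<ge> 0" "t0 \<ge> 1"
    "\<And>u P M N \<tau>. u \<in> borel_measurable borel \<Longrightarrow> integrable lborel (\<lambda>x. (u x)\<^sup>2) \<Longrightarrow>
       (\<And>x. x \<notin> ball c R \<Longrightarrow> u x = 0) \<Longrightarrow> P \<in> borel_measurable borel \<Longrightarrow> (\<And>x. \<bar>P x\<bar> \<le> M) \<Longrightarrow> N \<ge> 0 \<Longrightarrow>
       (\<And>v. v \<in> test_functions (ball c R) \<Longrightarrow>
         \<bar>LINT x|lborel. u x * (P x * v x - laplacian v x)\<bar> \<le> N * sqrt (LINT x|lborel. (laplacian v x)\<^sup>2)) \<Longrightarrow>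
       \<tau> \<ge> t0 * (1 + M powr (2/3)) \<Longrightarrow>
       bint (ball c r2) (\<lambda>x. (u x)\<^sup>2) \<le> C * (exp (3 * \<tau>) * (bint (ball c r1) (\<lambda>x. (u x)\<^sup>2) + N\<^sup>2)
         + exp (- 2 * a * \<tau>) * (LINT x|lborel. (u x)\<^sup>2))"
proof -
  define R' where "R' = (r2 + R) / 2"
  have R': "r2 < R'" "R' < R" "0 < R'" using r by (auto simp: R'_def)
  obtain a C0 t0 where C0: "a > 0" "C0 \<ge> 0" "t0 \<ge> 1" and tb:
    "\<And>Z Z1 Z2 M \<tau>. C2 Z Z1 Z2 \<Longrightarrow> M \<ge> 0 \<Longrightarrow> \<tau> \<ge> t0 * (1 + M powr (2/3)) \<Longrightarrow>
       bint (ball c r2) (\<lambda>x. (Z x)\<^sup>2) \<le> C0 * (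
         exp (2 * \<tau>) * (bint (ball c r1) (\<lambda>x. (Z x)\<^sup>2)
            + bint (ball c R') (\<lambda>x. (max 0 (\<bar>\<Sum>i\<in>Basis. Z2 i i x\<bar> - M * \<bar>Z x\<bar>))\<^sup>2))
       + exp (- 2 * a * \<tau>) * (bint (ball c R') (\<lambda>x. (Z x)\<^sup>2)
            + bint (ball c R') (\<lambda>x. (max 0 (\<bar>\<Sum>i\<in>Basis. Z2 i i x\<bar> - M * \<bar>Z x\<bar>))\<^sup>2)))"
    using r(1,2) R'(1) by (rule three_balls_C2[where c=c]) blast
  show ?thesis
  \<comment> \<open>The constant 192 is 4 times 48: the dual bound enters as
    \<open>4 * N\<^sup>2\<close>, and \<open>8 * (1 + M\<^sup>2) \<le> 48 * exp \<tau>\<close>. The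
    summand 8 is 2 times 4, from comparing \<open>u\<close> with \<open>Z\<close> on
    \<open>ball c r2\<close>.\<close>
  proof (rule that[of a "192 * C0 + 8" t0])
    fix u P :: "'a \<Rightarrow> real" and M N \<tau> :: real
    assume u: "u \<in> borel_measurable borel" "integrable lborel (\<lambda>x. (u x)\<^sup>2)" "\<And>x. x \<notin> ball c R \<Longrightarrow> u x = 0"
      and P: "P \<in> borel_measurable borel" "\<And>x. \<bar>P x\<bar> \<le> M"
      and N: "N \<ge> 0" "\<And>v. v \<in> test_functions (ball c R) \<Longrightarrow>
         \<bar>LINT x|lborel. u x * (P x * v x - laplacian v x)\<bar> \<le> N * sqrt (LINT x|lborel. (laplacian v x)\<^sup>2)"
      and \<tau>: "\<tau> \<ge> t0 * (1 + M powr (2/3))"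
    have M: "M \<ge> 0" using P(2)[of c] by linarith
    note \<tau>1 = two_thirds_scale(1)[OF C0(3) M \<tau>] and t3 = two_thirds_scale(2)[OF C0(3) M \<tau>]
    define U1 where "U1 = bint (ball c r1) (\<lambda>x. (u x)\<^sup>2)"
    define U where "U = (LINT x|lborel. (u x)\<^sup>2)"
    define X where "X = bint (ball c r2) (\<lambda>x. (u x)\<^sup>2)"
    define E where "E = exp (2 * \<tau>)"
    define D where "D = exp (- 2 * a * \<tau>)"
    have ED: "D \<le> E" "1 \<le> E" "0 \<le> D"
      unfolding D_def E_def using \<tau>1 C0(1) by (auto simp: order_trans[of _ 0])
    have U0: "U \<ge> 0" "U1 \<ge> 0" unfolding U_def U1_def
      by (auto intro: Bochner_Integration.integral_nonneg bint_nonneg)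
    have step: "X \<le> (4 * C0 * E * U1 + 4 * C0 * D * U + (8 * C0 * E * (1 + M\<^sup>2) + 2) * (4 * N\<^sup>2))
        + \<theta> * (2 * C0 * E * (8 + 4 * M\<^sup>2) + 2)" if \<theta>: "\<theta> > 0" for \<theta>
    proof -
      define p where "p = 4 * N\<^sup>2 + \<theta>"
      obtain Z Z1 Z2 where Z: "C2 Z Z1 Z2"
        "integrable lborel (\<lambda>x. indicator (ball c R') x * (Z x - u x)\<^sup>2)"
        "bint (ball c R') (\<lambda>x. (Z x - u x)\<^sup>2) \<le> 4 * N\<^sup>2 + \<theta>"
        "integrable lborel (\<lambda>x. indicator (ball c R') x * ((\<Sum>i\<in>Basis. Z2 i i x) - P x * u x)\<^sup>2)"
        "bint (ball c R') (\<lambda>x. ((\<Sum>i\<in>Basis. Z2 i i x) - P x * u x)\<^sup>2) \<le> \<theta>"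
        using R'(3,2) u P N \<theta> by (rule smooth_approximation[of R' R u c P M N \<theta>]) blast
      note [continuous_intros] = C2D(1,3,5)[OF Z(1)]
      define L where "L x = (\<Sum>i\<in>Basis. Z2 i i x)" for x
      have [continuous_intros]: "continuous_on UNIV L" unfolding L_def by (intro continuous_intros)
      define g where "g x = max 0 (\<bar>L x\<bar> - M * \<bar>Z x\<bar>)" for x
      have [continuous_intros]: "continuous_on UNIV g" unfolding g_def by (intro continuous_intros)
      have p0: "p \<ge> 0" using \<theta> by (simp add: p_def)
      have sub: "integrable lborel (\<lambda>x. indicator (ball c s) x * (Z x - u x)\<^sup>2)"
        "bint (ball c s) (\<lambda>x. (Z x - u x)\<^sup>2) \<le> p" if s: "s \<le> R'" for s
      proof -
        have "(\<lambda>x. indicator (ball c s) x * (indicator (ball c R') x * (Z x - u x)\<^sup>2)) = (\<lambda>x. indicator (ball c s) x * (Z x - u x)\<^sup>2)"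
          using s by (auto simp: fun_eq_iff indicator_def)
        then show i: "integrable lborel (\<lambda>x. indicator (ball c s) x * (Z x - u x)\<^sup>2)"
          using integrable_indicator_mult[OF Z(2), of "ball c s"] by simp
        have "bint (ball c s) (\<lambda>x. (Z x - u x)\<^sup>2) \<le> bint (ball c R') (\<lambda>x. (Z x - u x)\<^sup>2)"
          using s by (intro bint_mono i Z(2)) auto
        then show "bint (ball c s) (\<lambda>x. (Z x - u x)\<^sup>2) \<le> p" using Z(3) by (simp add: p_def)
      qed
      have iu: "integrable lborel (\<lambda>x. indicator (ball c s) x * (u x)\<^sup>2)" for s
        by (rule integrable_indicator_mult[OF u(2)]) simp
      have iZ: "integrable lborel (\<lambda>x. indicator (ball c s) x * (Z x)\<^sup>2)" "integrable lborel (\<lambda>x. indicator (ball c s) x * (g x)\<^sup>2)" for s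
        by (intro bint_integrable continuous_intros; simp)+
      have dbl: "bint (ball c s) f \<le> 2 * bint (ball c s) h1 + 2 * bint (ball c s) h2"
        if "integrable lborel (\<lambda>x. indicator (ball c s) x * f x)" "integrable lborel (\<lambda>x. indicator (ball c s) x * h1 x)"
          "integrable lborel (\<lambda>x. indicator (ball c s) x * h2 x)" "\<And>x. f x \<le> 2 * h1 x + 2 * h2 x" for s f h1 h2
      proof -
        have "bint (ball c s) f \<le> (LINT x|lborel. 2 * (indicator (ball c s) x * h1 x) + 2 * (indicator (ball c s) x * h2 x))"
          unfolding bint_def using that by (intro integral_mono) (auto simp: indicator_def)
        also have "\<dots> = 2 * bint (ball c s) h1 + 2 * bint (ball c s) h2"
          unfolding bint_def using that by simp
        finally show ?thesis .
      qed
      have Zu: "bint (ball c s) (\<lambda>x. (Z x)\<^sup>2) \<le> 2 * bint (ball c s) (\<lambda>x. (u x)\<^sup>2) + 2 * p" if s: "s \<le> R'" for s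
      proof -
        have "(Z x)\<^sup>2 \<le> 2 * (u x)\<^sup>2 + 2 * (Z x - u x)\<^sup>2" for x using square_sum_le[of "u x" "Z x - u x"] by simp
        from dbl[OF iZ(1) iu sub(1)[OF s] this] show ?thesis using sub(2)[OF s] by linarith
      qed
      have XZ: "X \<le> 2 * bint (ball c r2) (\<lambda>x. (Z x)\<^sup>2) + 2 * p"
      proof -
        have s: "r2 \<le> R'" using R' by simp
        have "(u x)\<^sup>2 \<le> 2 * (Z x)\<^sup>2 + 2 * (Z x - u x)\<^sup>2" for x
          using square_sum_le[of "Z x" "u x - Z x"] by (simp add: power2_commute)
        from dbl[OF iu iZ(1) sub(1)[OF s] this] show ?thesis using sub(2)[OF s] unfolding X_def by linarith
      qed
      define \<gamma> where "\<gamma> = bint (ball c R') (\<lambda>x. (g x)\<^sup>2)"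
      have \<gamma>0: "\<gamma> \<ge> 0" unfolding \<gamma>_def by (intro bint_nonneg) simp
      have \<gamma>: "\<gamma> \<le> 2 * \<theta> + 2 * (M\<^sup>2 * p)"
      proof -
        have gle: "(g x)\<^sup>2 \<le> 2 * (L x - P x * u x)\<^sup>2 + 2 * (M\<^sup>2 * (Z x - u x)\<^sup>2)" for x
        proof -
          have "\<bar>P x * u x\<bar> \<le> M * \<bar>u x\<bar>" unfolding abs_mult by (intro mult_right_mono P(2)) simp
          moreover have "M * \<bar>u x\<bar> \<le> M * (\<bar>Z x\<bar> + \<bar>Z x - u x\<bar>)" using M by (intro mult_left_mono) auto
          ultimately have "g x \<le> \<bar>L x - P x * u x\<bar> + M * \<bar>Z x - u x\<bar>"
            unfolding g_def using M by (auto simp: distrib_left intro!: add_nonneg_nonneg mult_nonneg_nonneg)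
          then have "(g x)\<^sup>2 \<le> (\<bar>L x - P x * u x\<bar> + M * \<bar>Z x - u x\<bar>)\<^sup>2"
            by (intro power_mono) (auto simp: g_def)
          also have "\<dots> \<le> 2 * \<bar>L x - P x * u x\<bar>\<^sup>2 + 2 * (M * \<bar>Z x - u x\<bar>)\<^sup>2" by (rule square_sum_le)
          finally show ?thesis by (simp add: power_mult_distrib)
        qed
        have i3: "integrable lborel (\<lambda>x. indicator (ball c R') x * (M\<^sup>2 * (Z x - u x)\<^sup>2))"
          using integrable_mult_right[OF Z(2), of "M\<^sup>2"] by (simp add: mult.left_commute)
        have "\<gamma> \<le> 2 * bint (ball c R') (\<lambda>x. (L x - P x * u x)\<^sup>2) + 2 * bint (ball c R') (\<lambda>x. M\<^sup>2 * (Z x - u x)\<^sup>2)"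
          unfolding \<gamma>_def by (rule dbl[OF iZ(2) Z(4)[folded L_def] i3 gle])
        also have "\<dots> \<le> 2 * \<theta> + 2 * (M\<^sup>2 * p)"
          unfolding bint_cmult using Z(5) sub(2)[of R'] unfolding L_def
          by (intro add_mono mult_left_mono) auto
        finally show ?thesis .
      qed
      have U1Z: "bint (ball c r1) (\<lambda>x. (Z x)\<^sup>2) \<le> 2 * U1 + 2 * p"
        unfolding U1_def using r R' by (intro Zu) simp
      have UZ: "bint (ball c R') (\<lambda>x. (Z x)\<^sup>2) \<le> 2 * U + 2 * p"
        using Zu[of R'] bint_le_integral[OF u(2), of "ball c R'"] unfolding U_def by simp
      have "bint (ball c r2) (\<lambda>x. (Z x)\<^sup>2) \<le> C0 * (E * (bint (ball c r1) (\<lambda>x. (Z x)\<^sup>2) + \<gamma>)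
          + D * (bint (ball c R') (\<lambda>x. (Z x)\<^sup>2) + \<gamma>))"
        unfolding E_def D_def \<gamma>_def g_def L_def by (rule tb[OF Z(1) M \<tau>])
      also have "\<dots> \<le> C0 * (E * (2 * U1 + 2 * p + \<gamma>) + D * (2 * U + 2 * p + \<gamma>))"
        using U1Z UZ C0(2) ED by (intro mult_left_mono add_mono) auto
      also have "\<dots> = C0 * (E * (2 * U1) + D * (2 * U) + (E * (2 * p + \<gamma>) + D * (2 * p + \<gamma>)))"
        by (simp add: algebra_simps)
      also have "\<dots> \<le> C0 * (E * (2 * U1) + D * (2 * U) + (E * (2 * p + \<gamma>) + E * (2 * p + \<gamma>)))"
        using C0(2) ED p0 \<gamma>0 by (intro mult_left_mono add_mono mult_right_mono) auto
      also have "\<dots> \<le> C0 * (E * (2 * U1) + D * (2 * U) + (E * (2 * p + (2 * \<theta> + 2 * (M\<^sup>2 * p))) + E * (2 * p + (2 * \<theta> + 2 * (M\<^sup>2 * p)))))"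
        using C0(2) ED \<gamma> by (intro mult_left_mono add_mono) auto
      finally have "bint (ball c r2) (\<lambda>x. (Z x)\<^sup>2) \<le> \<dots>" .
      then have "X \<le> 2 * (C0 * (E * (2 * U1) + D * (2 * U) + (E * (2 * p + (2 * \<theta> + 2 * (M\<^sup>2 * p))) + E * (2 * p + (2 * \<theta> + 2 * (M\<^sup>2 * p))))))
          + 2 * p"
        using XZ by linarith
      also have "\<dots> = (4 * C0 * E * U1 + 4 * C0 * D * U + (8 * C0 * E * (1 + M\<^sup>2) + 2) * (4 * N\<^sup>2))
        + \<theta> * (2 * C0 * E * (8 + 4 * M\<^sup>2) + 2)"
        unfolding p_def by (simp add: algebra_simps)
      finally show ?thesis .
    qed
    \<comment> \<open>The coefficient of \<open>\<theta>\<close>; taking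
      \<open>\<theta> = e / Q\<close> makes the error equal to \<open>e\<close>.\<close>
    define Q where "Q = 2 * C0 * E * (8 + 4 * M\<^sup>2) + 2"
    have Q: "Q > 0" unfolding Q_def using C0(2) ED by (intro add_nonneg_pos mult_nonneg_nonneg) auto
    have "X \<le> 4 * C0 * E * U1 + 4 * C0 * D * U + (8 * C0 * E * (1 + M\<^sup>2) + 2) * (4 * N\<^sup>2)"
    proof (rule field_le_epsilon)
      fix e :: real assume "e > 0"
      then show "X \<le> 4 * C0 * E * U1 + 4 * C0 * D * U + (8 * C0 * E * (1 + M\<^sup>2) + 2) * (4 * N\<^sup>2) + e"
        using step[of "e / Q"] Q unfolding Q_def[symmetric] by simp
    qed
    also have "\<dots> \<le> (192 * C0 + 8) * (exp (3 * \<tau>) * U1) + (192 * C0 + 8) * (D * U) + (192 * C0 + 8) * (exp (3 * \<tau>) * N\<^sup>2)"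
    proof (intro add_mono)
      have E3: "E \<le> exp (3 * \<tau>)" unfolding E_def using \<tau>1 by simp
      then have "4 * C0 * (E * U1) \<le> (192 * C0 + 8) * (exp (3 * \<tau>) * U1)"
        using C0(2) U0 ED by (intro mult_mono) auto
      then show "4 * C0 * E * U1 \<le> (192 * C0 + 8) * (exp (3 * \<tau>) * U1)" by (simp add: mult.assoc)
      have "4 * C0 * (D * U) \<le> (192 * C0 + 8) * (D * U)" using C0(2) U0 ED by (intro mult_right_mono) auto
      then show "4 * C0 * D * U \<le> (192 * C0 + 8) * (D * U)" by (simp add: mult.assoc)
      \<comment> \<open>Since \<open>1 + M\<^sup>2 \<le> \<tau> ^ 3 \<le> 6 * exp \<tau>\<close>,
        this is where \<open>exp (2 * \<tau>)\<close> turns into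
        \<open>exp (3 * \<tau>)\<close>.\<close>
      have "1 + M\<^sup>2 \<le> 6 * exp \<tau>" using t3 power_le_fact_exp[of \<tau> 3] \<tau>1 by (simp add: fact_numeral)
      then have "8 * C0 * E * (1 + M\<^sup>2) \<le> 8 * C0 * E * (6 * exp \<tau>)" using C0(2) ED by (intro mult_left_mono) auto
      also have "\<dots> = 48 * C0 * exp (3 * \<tau>)" unfolding E_def by (simp add: exp_add[symmetric])
      finally have "8 * C0 * E * (1 + M\<^sup>2) + 2 \<le> 48 * C0 * exp (3 * \<tau>) + 2 * exp (3 * \<tau>)"
        using \<tau>1 by (intro add_mono) auto
      then have "(8 * C0 * E * (1 + M\<^sup>2) + 2) * (4 * N\<^sup>2) \<le> (48 * C0 * exp (3 * \<tau>) + 2 * exp (3 * \<tau>)) * (4 * N\<^sup>2)"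
        by (intro mult_right_mono) auto
      then show "(8 * C0 * E * (1 + M\<^sup>2) + 2) * (4 * N\<^sup>2) \<le> (192 * C0 + 8) * (exp (3 * \<tau>) * N\<^sup>2)"
        by (simp add: algebra_simps)
    qed
    also have "\<dots> = (192 * C0 + 8) * (exp (3 * \<tau>) * (U1 + N\<^sup>2) + D * U)" by (simp add: algebra_simps)
    finally show "bint (ball c r2) (\<lambda>x. (u x)\<^sup>2) \<le> (192 * C0 + 8) * (exp (3 * \<tau>) * (bint (ball c r1) (\<lambda>x. (u x)\<^sup>2) + N\<^sup>2)
         + exp (- 2 * a * \<tau>) * (LINT x|lborel. (u x)\<^sup>2))"
      unfolding X_def U1_def U_def D_def .
  qed (use C0 in auto)
qed

section \<open>Optimising over the Carleman parameter\<close>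

text \<open>The two exponential terms balance at one value of \<open>\<tau>\<close>, where both
  equal the square of the interpolated product. If that value is below the admissible range,
  \<open>\<alpha>\<close> and \<open>\<beta>\<close> are comparable up to the exponential of a
  multiple of \<open>\<mu>\<close>, and the trivial bound \<open>x \<le> \<beta>\<close> is good
  enough.\<close>

lemma powr_interpolation:
  fixes x \<alpha> \<beta> :: real
  assumes a: "a > 0" and C: "C \<ge> 0" and t0: "t0 \<ge> 1" and \<mu>: "\<mu> \<ge> 1"
    and nn: "0 \<le> x" "0 \<le> \<alpha>" "\<alpha> \<le> \<beta>" "x \<le> \<beta>"
    and le: "\<And>\<tau>. \<tau> \<ge> t0 * \<mu> \<Longrightarrow> x\<^sup>2 \<le> C * (exp (3 * \<tau>) * \<alpha>\<^sup>2 + exp (- 2 * a * \<tau>) * \<beta>\<^sup>2)"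
  defines "\<kappa> \<equiv> 2 * a / (3 + 2 * a)"
  shows "x \<le> exp ((C + a * t0) * \<mu>) * \<alpha> powr \<kappa> * \<beta> powr (1 - \<kappa>)"
proof (cases "\<alpha> = 0")
  case True
  \<comment> \<open>The right side of the claim is 0 because \<open>0 powr \<kappa> = 0\<close>, so
    \<open>x\<close> has to vanish; this follows by letting \<open>\<tau>\<close> tend to
    infinity.\<close>
  have "x\<^sup>2 \<le> 0"
  proof (rule tendsto_lowerbound)
    have "filterlim (\<lambda>\<tau>::real. (2 * a) * \<tau>) at_top at_top"
      using a by (intro filterlim_tendsto_pos_mult_at_top[OF tendsto_const]) (auto simp: filterlim_ident)
    then have "((\<lambda>\<tau>::real. exp (- ((2 * a) * \<tau>))) \<longlongrightarrow> 0) at_top"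
      by (intro filterlim_compose[OF exp_at_bot] filterlim_compose[OF filterlim_uminus_at_bot_at_top])
    then have "((\<lambda>\<tau>::real. C * (exp (- ((2 * a) * \<tau>)) * \<beta>\<^sup>2)) \<longlongrightarrow> C * (0 * \<beta>\<^sup>2)) at_top"
      by (intro tendsto_intros)
    then show "((\<lambda>\<tau>::real. C * (exp (- 2 * a * \<tau>) * \<beta>\<^sup>2)) \<longlongrightarrow> 0) at_top" by simp
    show "\<forall>\<^sub>F \<tau> in at_top. x\<^sup>2 \<le> C * (exp (- 2 * a * \<tau>) * \<beta>\<^sup>2)"
      using eventually_ge_at_top[of "t0 * \<mu>"] by eventually_elim (use le True in fastforce)
  qed simp
  then show ?thesis using nn by simp
next
  case False
  with nn have pos: "\<alpha> > 0" "\<beta> > 0" by auto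
  have \<kappa>: "0 < \<kappa>" "\<kappa> < 1" using a by (auto simp: \<kappa>_def field_simps)
  define W where "W = \<alpha> powr \<kappa> * \<beta> powr (1 - \<kappa>)"
  have W: "W > 0" using pos by (simp add: W_def)
  have Wexp: "W = exp (\<kappa> * ln \<alpha> + (1 - \<kappa>) * ln \<beta>)"
    unfolding W_def using pos by (simp add: powr_def exp_add)
  define D where "D = 3 + 2 * a"
  have D: "D > 0" "a = (D - 3) / 2" using a by (simp_all add: D_def)
  \<comment> \<open>The balancing value, the solution of \<open>exp (3 * s) * \<alpha>\<^sup>2 = exp
    (- 2 * a * s) * \<beta>\<^sup>2\<close>.\<close>
  define s where "s = 2 * (ln \<beta> - ln \<alpha>) / D"
  have \<kappa>D: "\<kappa> = (D - 3) / D" "1 - \<kappa> = 3 / D" using a by (simp_all add: \<kappa>_def D_def field_simps)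
  have "x \<le> exp ((C + a * t0) * \<mu>) * W"
  proof (cases "s \<ge> t0 * \<mu>")
    case True
    have "exp (3 * s) * \<alpha>\<^sup>2 = W\<^sup>2" "exp (- 2 * a * s) * \<beta>\<^sup>2 = W\<^sup>2"
    proof -
      have "\<alpha>\<^sup>2 = exp (2 * ln \<alpha>)" "\<beta>\<^sup>2 = exp (2 * ln \<beta>)" using pos by (simp_all add: exp_double)
      moreover have "W\<^sup>2 = exp (2 * (\<kappa> * ln \<alpha> + (1 - \<kappa>) * ln \<beta>))" unfolding Wexp by (rule exp_double[symmetric])
      moreover have "3 * s + 2 * ln \<alpha> = 2 * (\<kappa> * ln \<alpha> + (1 - \<kappa>) * ln \<beta>)"
        "- 2 * a * s + 2 * ln \<beta> = 2 * (\<kappa> * ln \<alpha> + (1 - \<kappa>) * ln \<beta>)"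
        unfolding s_def \<kappa>D D(2) using D(1) by (simp_all add: field_simps)
      ultimately show "exp (3 * s) * \<alpha>\<^sup>2 = W\<^sup>2" "exp (- 2 * a * s) * \<beta>\<^sup>2 = W\<^sup>2"
        by (simp_all only: exp_add[symmetric])
    qed
    then have "x\<^sup>2 \<le> (2 * C) * W\<^sup>2" using le[OF True] by simp
    also have "\<dots> \<le> exp (2 * C) * W\<^sup>2"
    proof (rule mult_right_mono)
      show "2 * C \<le> exp (2 * C)" using exp_ge_add_one_self[of "2 * C"] by linarith
    qed simp
    also have "\<dots> = (exp C * W)\<^sup>2" by (simp add: power_mult_distrib exp_double)
    finally have "x \<le> exp C * W" by (rule power2_le_imp_le) (use W in simp)
    also have "\<dots> \<le> exp ((C + a * t0) * \<mu>) * W"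
    proof (intro mult_right_mono)
      have "C * 1 \<le> (C + a * t0) * \<mu>" using C a t0 \<mu> by (intro mult_mono) auto
      then show "exp C \<le> exp ((C + a * t0) * \<mu>)" by simp
    qed (use W in simp)
    finally show ?thesis .
  next
    case False
    \<comment> \<open>The quotient of \<open>\<beta>\<close> by \<open>W\<close> is
      \<open>exp (a * s)\<close>, and here \<open>s\<close> is below the threshold
      \<open>t0 * \<mu>\<close>.\<close>
    have "ln \<beta> - (\<kappa> * ln \<alpha> + (1 - \<kappa>) * ln \<beta>) = a * s"
      unfolding s_def \<kappa>D D(2) using D(1) by (simp add: field_simps)
    also have "\<dots> \<le> a * (t0 * \<mu>)" using False a by (intro mult_left_mono) auto
    also have "\<dots> \<le> (C + a * t0) * \<mu>" using C \<mu> by (simp add: algebra_simps)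
    finally have "exp (ln \<beta>) \<le> exp ((C + a * t0) * \<mu> + (\<kappa> * ln \<alpha> + (1 - \<kappa>) * ln \<beta>))" by simp
    also have "\<dots> = exp ((C + a * t0) * \<mu>) * W" unfolding Wexp by (rule exp_add)
    finally show ?thesis using nn(4) pos by simp
  qed
  then show ?thesis by (simp add: W_def mult.assoc)
qed

section \<open>Weak derivatives\<close>

text \<open>\<open>lebesgue\<close> is complete, so measurability itself passes along
  almost-everywhere equality.\<close>

lemma integrable_lebesgue_AE:
  fixes f g :: "'a::euclidean_space \<Rightarrow> 'b::euclidean_space"
  assumes "integrable lebesgue f" "AE x in lebesgue. f x = g x"
  shows "integrable lebesgue g" "integral\<^sup>L lebesgue g = integral\<^sup>L lebesgue f"
proof -
  have g: "g \<in> borel_measurable lebesgue"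
    using borel_measurable_AE[of f g] assms by auto
  show "integrable lebesgue g" by (rule integrable_cong_AE_imp[OF assms(1) g assms(2)])
  show "integral\<^sup>L lebesgue g = integral\<^sup>L lebesgue f"
    using assms by (intro integral_cong_AE g) auto
qed

lemma lebesgue_on_simps:
  fixes f :: "'a::euclidean_space \<Rightarrow> 'b::euclidean_space"
  assumes "open \<Omega>"
  shows "integrable (lebesgue_on \<Omega>) f \<longleftrightarrow> integrable lebesgue (\<lambda>x. indicator \<Omega> x *\<^sub>R f x)"
    and "integral\<^sup>L (lebesgue_on \<Omega>) f = integral\<^sup>L lebesgue (\<lambda>x. indicator \<Omega> x *\<^sub>R f x)"
    and "f \<in> borel_measurable (lebesgue_on \<Omega>) \<longleftrightarrow> (\<lambda>x. indicator \<Omega> x *\<^sub>R f x) \<in> borel_measurable lebesgue"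
    and "(AE x in lebesgue_on \<Omega>. Q x) \<longleftrightarrow> (AE x in lebesgue. x \<in> \<Omega> \<longrightarrow> Q x)"
proof -
  have s: "\<Omega> \<inter> space lebesgue \<in> sets lebesgue" using assms by simp
  show "integrable (lebesgue_on \<Omega>) f \<longleftrightarrow> integrable lebesgue (\<lambda>x. indicator \<Omega> x *\<^sub>R f x)"
    by (rule integrable_restrict_space[OF s])
  show "integral\<^sup>L (lebesgue_on \<Omega>) f = integral\<^sup>L lebesgue (\<lambda>x. indicator \<Omega> x *\<^sub>R f x)"
    by (rule integral_restrict_space[OF s])
  show "f \<in> borel_measurable (lebesgue_on \<Omega>) \<longleftrightarrow> (\<lambda>x. indicator \<Omega> x *\<^sub>R f x) \<in> borel_measurable lebesgue"
    by (rule borel_measurable_restrict_space_iff[OF s])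
  show "(AE x in lebesgue_on \<Omega>. Q x) \<longleftrightarrow> (AE x in lebesgue. x \<in> \<Omega> \<longrightarrow> Q x)"
    by (rule AE_restrict_space_iff[OF s])
qed

lemma lebesgue_on_AE:
  fixes f g :: "'a::euclidean_space \<Rightarrow> 'b::euclidean_space"
  assumes \<Omega>: "open \<Omega>" and ae: "AE x in lebesgue_on \<Omega>. f x = g x"
  shows "integral\<^sup>L (lebesgue_on \<Omega>) f = integral\<^sup>L (lebesgue_on \<Omega>) g"
    and "integrable (lebesgue_on \<Omega>) f \<Longrightarrow> integrable (lebesgue_on \<Omega>) g"
    and "f \<in> borel_measurable (lebesgue_on \<Omega>) \<Longrightarrow> g \<in> borel_measurable (lebesgue_on \<Omega>)"
proof -
  have ae': "AE x in lebesgue. indicator \<Omega> x *\<^sub>R f x = indicator \<Omega> x *\<^sub>R g x"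
    using ae unfolding lebesgue_on_simps(4)[OF \<Omega>] by (auto simp: indicator_def)
  then have ae'': "AE x in lebesgue. indicator \<Omega> x *\<^sub>R g x = indicator \<Omega> x *\<^sub>R f x" by auto
  show i: "integrable (lebesgue_on \<Omega>) g" if "integrable (lebesgue_on \<Omega>) f"
    using integrable_lebesgue_AE(1)[OF _ ae'] that unfolding lebesgue_on_simps[OF \<Omega>] .
  show "g \<in> borel_measurable (lebesgue_on \<Omega>)" if "f \<in> borel_measurable (lebesgue_on \<Omega>)"
    using borel_measurable_AE[OF _ ae'] that unfolding lebesgue_on_simps[OF \<Omega>] .
  show "integral\<^sup>L (lebesgue_on \<Omega>) f = integral\<^sup>L (lebesgue_on \<Omega>) g"
  proof (cases "integrable (lebesgue_on \<Omega>) f")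
    case True
    then show ?thesis
      using integrable_lebesgue_AE(2)[OF _ ae'] unfolding lebesgue_on_simps[OF \<Omega>] by simp
  next
    \<comment> \<open>If one function fails to be integrable so does the other, and both integrals
      are 0 by convention.\<close>
    case False
    moreover have "\<not> integrable (lebesgue_on \<Omega>) g"
      using False integrable_lebesgue_AE(1)[OF _ ae''] unfolding lebesgue_on_simps[OF \<Omega>] by blast
    ultimately show ?thesis by (simp add: not_integrable_integral_eq)
  qed
qed

lemma integrable_test_scaleR:
  fixes v :: "'a::euclidean_space \<Rightarrow> 'b::euclidean_space" and \<phi> :: "'a \<Rightarrow> real"
  assumes \<Omega>: "open \<Omega>" and \<phi>: "\<phi> \<in> test_functions \<Omega>" and v: "locally_integrable \<Omega> v"
  shows "integrable (lebesgue_on \<Omega>) (\<lambda>x. \<phi> x *\<^sub>R v x)"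
proof -
  obtain K where K: "compact K" "K \<subseteq> \<Omega>" "\<And>x. x \<notin> K \<Longrightarrow> \<phi> x = 0"
    using test_functions_compact[OF \<phi>] by metis
  have c: "continuous_on UNIV \<phi>" by (rule test_functions_continuous[OF \<phi>])
  obtain r where r: "\<And>x. x \<notin> cball 0 r \<Longrightarrow> \<phi> x = 0" using test_functions_bounded_support[OF \<phi>] by blast
  obtain B where B: "B \<ge> 0" "\<And>x. \<bar>\<phi> x\<bar> \<le> B" using compact_support_bounded[OF c r] by blast
  have iv: "integrable lebesgue (\<lambda>x. indicator K x *\<^sub>R v x)"
    using v K unfolding locally_integrable_def set_integrable_def by blast
  have [measurable]: "\<phi> \<in> borel_measurable lebesgue"
    using borel_measurable_continuous_onI[OF c] by (intro measurable_completion) simp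
  have [measurable]: "(\<lambda>x. indicator K x *\<^sub>R v x) \<in> borel_measurable lebesgue" using iv by simp
  have "integrable lebesgue (\<lambda>x. \<phi> x *\<^sub>R (indicator K x *\<^sub>R v x))"
  proof (rule Bochner_Integration.integrable_bound[where f="\<lambda>x. B *\<^sub>R (indicator K x *\<^sub>R v x)"])
    show "AE x in lebesgue. norm (\<phi> x *\<^sub>R (indicator K x *\<^sub>R v x)) \<le> norm (B *\<^sub>R (indicator K x *\<^sub>R v x))"
    proof (rule AE_I2)
      fix x
      have "\<bar>\<phi> x\<bar> \<le> \<bar>B\<bar>" using B(2)[of x] by linarith
      then show "norm (\<phi> x *\<^sub>R (indicator K x *\<^sub>R v x)) \<le> norm (B *\<^sub>R (indicator K x *\<^sub>R v x))"
        unfolding norm_scaleR[of "\<phi> x"] norm_scaleR[of B] by (intro mult_right_mono) auto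
    qed
    show "(\<lambda>x. \<phi> x *\<^sub>R (indicator K x *\<^sub>R v x)) \<in> borel_measurable lebesgue" by measurable
  qed (intro integrable_scaleR_right iv)
  moreover have "(\<lambda>x. \<phi> x *\<^sub>R (indicator K x *\<^sub>R v x)) = (\<lambda>x. indicator \<Omega> x *\<^sub>R (\<phi> x *\<^sub>R v x))"
    using K by (auto simp: fun_eq_iff indicator_def)
  ultimately show ?thesis unfolding lebesgue_on_simps[OF \<Omega>] by simp
qed

lemma locally_integrable_AE:
  fixes v w :: "'a::euclidean_space \<Rightarrow> 'b::euclidean_space"
  assumes \<Omega>: "open \<Omega>" and v: "locally_integrable \<Omega> v" and ae: "AE x in lebesgue_on \<Omega>. v x = w x"
  shows "locally_integrable \<Omega> w"
  unfolding locally_integrable_def set_integrable_def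
proof (intro allI impI)
  fix K assume K: "compact K \<and> K \<subseteq> \<Omega>"
  have "integrable lebesgue (\<lambda>x. indicator K x *\<^sub>R v x)"
    using v K unfolding locally_integrable_def set_integrable_def by blast
  moreover have "AE x in lebesgue. indicator K x *\<^sub>R v x = indicator K x *\<^sub>R w x"
    using ae K unfolding lebesgue_on_simps(4)[OF \<Omega>] by (auto simp: indicator_def)
  ultimately show "integrable lebesgue (\<lambda>x. indicator K x *\<^sub>R w x)" by (rule integrable_lebesgue_AE(1))
qed

lemma locally_integrable_linear:
  fixes v w :: "'a::euclidean_space \<Rightarrow> 'b::euclidean_space"
  assumes "locally_integrable \<Omega> v" "locally_integrable \<Omega> w"
  shows "locally_integrable \<Omega> (\<lambda>x. (v x - w x) \<bullet> b)"
  unfolding locally_integrable_def set_integrable_def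
proof (intro allI impI)
  fix K assume K: "compact K \<and> K \<subseteq> \<Omega>"
  have "integrable lebesgue (\<lambda>x. indicator K x *\<^sub>R v x)" "integrable lebesgue (\<lambda>x. indicator K x *\<^sub>R w x)"
    using assms K unfolding locally_integrable_def set_integrable_def by blast+
  then have "integrable lebesgue (\<lambda>x. (indicator K x *\<^sub>R v x - indicator K x *\<^sub>R w x) \<bullet> b)"
    by (intro integrable_inner_left Bochner_Integration.integrable_diff)
  then show "integrable lebesgue (\<lambda>x. indicator K x *\<^sub>R ((v x - w x) \<bullet> b))"
    by (simp add: inner_diff_left right_diff_distrib)
qed

section \<open>Uniqueness of weak derivatives\<close>

text \<open>Translated kernels are test functions, so the mollification of \<open>g\<close> vanishes
  on a compact \<open>K\<close> once the kernel is narrow. As it also converges to \<open>g\<close>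
  in L1, \<open>g\<close> vanishes almost everywhere on \<open>K\<close>.\<close>

lemma du_Bois_Reymond_real:
  fixes g :: "'a::euclidean_space \<Rightarrow> real"
  assumes \<Omega>: "open \<Omega>" and g: "locally_integrable \<Omega> g"
    and 0: "\<And>\<phi>. \<phi> \<in> test_functions \<Omega> \<Longrightarrow> (LINT x|lebesgue_on \<Omega>. \<phi> x * g x) = 0"
  shows "AE x in lebesgue_on \<Omega>. g x = 0"
proof -
  have loc: "AE x in lebesgue. x \<in> K \<longrightarrow> g x = 0" if K: "compact K" "K \<subseteq> \<Omega>" for K
  proof -
    obtain e where e: "e > 0" "(\<Union>x\<in>K. cball x e) \<subseteq> \<Omega>"
      using compact_subset_open_imp_cball_epsilon_subset[OF K(1) \<Omega> K(2)] by blast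
    \<comment> \<open>\<open>K\<close> thickened by \<open>e\<close> is still compact and inside
      \<open>\<Omega>\<close>. It contains the support of every narrow kernel placed at a point of
      \<open>K\<close>, so cutting \<open>g\<close> off outside \<open>L\<close> does not affect
      these mollifications.\<close>
    define L where "L = (\<Union>x\<in>K. \<Union>y\<in>cball 0 e. {x + y})"
    have cL: "compact L" unfolding L_def by (intro compact_sums' K(1) compact_cball)
    have ball: "cball x e \<subseteq> L" if "x \<in> K" for x
    proof
      fix y assume "y \<in> cball x e"
      then have "y - x \<in> cball 0 e" by (simp add: dist_norm norm_minus_commute)
      moreover have "y = x + (y - x)" by simp
      ultimately show "y \<in> L" unfolding L_def using that by blast
    qed
    have L\<Omega>: "L \<subseteq> \<Omega>"
    proof
      fix z assume "z \<in> L"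
      then obtain x y where "x \<in> K" "y \<in> cball 0 e" "z = x + y" unfolding L_def by blast
      then show "z \<in> \<Omega>" using e(2) by (auto simp: dist_norm subset_eq)
    qed
    obtain r0 where r0: "L \<subseteq> cball 0 r0"
      using compact_imp_bounded[OF cL] unfolding bounded_any_center[where a=0] by (auto simp: subset_eq)
    define r where "r = max r0 1"
    have r: "L \<subseteq> cball 0 r" "r > 0" using r0 by (auto simp: r_def)
    have ig: "integrable lebesgue (\<lambda>x. indicator L x *\<^sub>R g x)"
      using g cL L\<Omega> unfolding locally_integrable_def set_integrable_def by blast
    then obtain f where f: "f \<in> borel_measurable lborel" "AE x in lborel. indicator L x *\<^sub>R g x = f x"
      using completion_ex_borel_measurable_real[of "\<lambda>x. indicator L x *\<^sub>R g x" lborel] by auto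
    \<comment> \<open>A Borel representative is required because \<open>mollify\<close> integrates
      over \<open>lborel\<close>. The indicator makes it vanish everywhere off
      \<open>cball 0 r\<close>, where \<open>f\<close> is known to be 0 only almost
      everywhere.\<close>
    define F where "F x = indicator (cball 0 r) x * f x" for x
    have F [measurable]: "F \<in> borel_measurable borel" 
      unfolding F_def using f(1) by (intro borel_measurable_times borel_measurable_indicator) auto
    have aeF: "AE x in lebesgue. indicator L x *\<^sub>R g x = F x"
      unfolding AE_completion_iff using f(2)
    proof eventually_elim
      case (elim x)
      then show ?case using r(1) by (cases "x \<in> L") (auto simp: F_def subset_eq indicator_def)
    qed
    have F0: "F x = 0" if "x \<notin> cball 0 r" for x using that by (simp add: F_def)
    have iF: "integrable lborel F"
    proof -
      have "integrable lebesgue F" by (rule integrable_lebesgue_AE(1)[OF ig aeF])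
      then show ?thesis using integrable_completion[of F lborel] F by simp
    qed
    have mF: "mollify k F x = 0" if x: "x \<in> K" and k: "mollifier \<epsilon> k" "\<epsilon> \<le> e" for x \<epsilon> and k :: "'a \<Rightarrow> real"
    proof -
      note kD = mollifierD[OF k(1)]
      have sub: "cball x \<epsilon> \<subseteq> L" using ball[OF x] k(2) by auto
      have \<phi>: "(\<lambda>y. k (y - x)) \<in> test_functions \<Omega>"
        by (rule translate_test_function(1)[OF k(1)]) (use sub L\<Omega> in blast)
      have [measurable]: "k \<in> borel_measurable borel" by (rule kD)
      have m: "(\<lambda>y. F y * k (y - x)) \<in> borel_measurable lborel" by measurable
      obtain B where B: "\<And>x. \<bar>k x\<bar> \<le> B" using mollifier_bounded[OF k(1)] by blast
      have i1: "integrable lebesgue (\<lambda>y. F y * k (y - x))"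
        using bounded_mult_integrable[OF iF kD(6) B] m by (simp add: integrable_completion)
      have eq: "indicator \<Omega> y *\<^sub>R (k (y - x) * g y) = (indicator L y *\<^sub>R g y) * k (y - x)" for y
      proof (cases "y \<in> L")
        case False
        then have "k (y - x) = 0"
          using sub by (intro mollifier_zero[OF k(1)]) (auto simp: dist_norm norm_minus_commute)
        then show ?thesis by simp
      qed (use L\<Omega> in auto)
      have "mollify k F x = (LINT y|lebesgue. F y * k (y - x))"
        unfolding mollify_def using integral_completion[OF m] by simp
      also have "\<dots> = (LINT y|lebesgue. indicator \<Omega> y *\<^sub>R (k (y - x) * g y))"
        unfolding eq by (rule integrable_lebesgue_AE(2)[symmetric, OF i1]) (use aeF in eventually_elim, simp)
      also have "\<dots> = 0" using 0[OF \<phi>] unfolding lebesgue_on_simps[OF \<Omega>] .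
      finally show ?thesis .
    qed
    have Kb: "K \<in> sets borel" using K(1) by (simp add: compact_imp_closed)
    have iK: "integrable lborel (\<lambda>x. indicator K x * \<bar>F x\<bar>)"
      by (rule integrable_indicator_mult) (use iF Kb in auto)
    have small: "(LINT x|lborel. indicator K x * \<bar>F x\<bar>) \<le> 0 + \<theta>" if \<theta>: "\<theta> > 0" for \<theta>
    proof -
      have p1: "1 = 1 \<or> 1 = (2::nat)" by simp
      obtain \<epsilon>0 where \<epsilon>0: "\<epsilon>0 > 0" "\<And>\<epsilon> k. \<epsilon> \<le> \<epsilon>0 \<Longrightarrow> mollifier \<epsilon> k \<Longrightarrow>
          integrable lborel (\<lambda>x. \<bar>mollify k F x - F x\<bar> ^ 1) \<and> (LINT x|lborel. \<bar>mollify k F x - F x\<bar> ^ 1) \<le> \<theta>"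
        by (rule mollify_Lp[OF p1 r(2) iF _ _ \<theta>, of 0]) (use iF F0 in auto)
      define \<epsilon> where "\<epsilon> = min \<epsilon>0 e"
      have \<epsilon>: "\<epsilon> > 0" "\<epsilon> \<le> \<epsilon>0" "\<epsilon> \<le> e" using \<epsilon>0 e by (auto simp: \<epsilon>_def)
      obtain k :: "'a \<Rightarrow> real" where k: "mollifier \<epsilon> k"
        using exists_mollifier[OF \<epsilon>(1)] unfolding mollifier_def by metis
      have "(LINT x|lborel. indicator K x * \<bar>F x\<bar>) \<le> (LINT x|lborel. \<bar>mollify k F x - F x\<bar> ^ 1)"
        using \<epsilon>0(2)[OF \<epsilon>(2) k] mF[OF _ k \<epsilon>(3)] by (intro integral_mono iK) (auto simp: indicator_def)
      then show ?thesis using \<epsilon>0(2)[OF \<epsilon>(2) k] by linarith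
    qed
    have "(LINT x|lborel. indicator K x * \<bar>F x\<bar>) \<le> 0" by (rule field_le_epsilon[OF small])
    moreover have "(LINT x|lborel. indicator K x * \<bar>F x\<bar>) \<ge> 0"
      by (intro Bochner_Integration.integral_nonneg) simp
    ultimately have "(LINT x|lborel. indicator K x * \<bar>F x\<bar>) = 0" by linarith
    then have "AE x in lborel. indicator K x * \<bar>F x\<bar> = 0"
      using integral_nonneg_eq_0_iff_AE[OF iK] by simp
    then have "AE x in lebesgue. indicator K x * \<bar>F x\<bar> = 0" by (simp add: AE_completion_iff)
    with aeF show ?thesis
    proof eventually_elim
      case (elim x)
      have "x \<in> L" if "x \<in> K" using ball[OF that] e(1) by auto
      then show ?case using elim by (auto simp: indicator_def split: if_splits)
    qed
  qed
  obtain \<D> where D: "countable \<D>" "\<D> \<subseteq> Pow \<Omega>" "\<And>X. X \<in> \<D> \<Longrightarrow> \<exists>a b. X = cbox a b" "\<Union>\<D> = \<Omega>"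
    using open_countable_Union_open_cbox[OF \<Omega>] by blast
  have "AE x in lebesgue. \<forall>X\<in>\<D>. x \<in> X \<longrightarrow> g x = 0"
    unfolding AE_ball_countable[OF D(1)]
  proof
    fix X assume X: "X \<in> \<D>"
    obtain a b where "X = cbox a b" using D(3)[OF X] by blast
    then have "compact X" "X \<subseteq> \<Omega>" using D(2) X by (auto simp: compact_cbox)
    then show "AE x in lebesgue. x \<in> X \<longrightarrow> g x = 0" by (rule loc)
  qed
  then show ?thesis
    unfolding lebesgue_on_simps(4)[OF \<Omega>] by eventually_elim (use D(4) in blast)
qed

text \<open>Letting \<open>v\<close> and \<open>w\<close> differ on a null set makes iterated weak
  derivatives manageable: \<open>weak_partial\<close> picks a representative by choice, and the
  second derivative is taken of that pick. The vector-valued claim reduces to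
  \<open>du_Bois_Reymond_real\<close> coordinate by coordinate.\<close>

lemma weak_partial_unique:
  fixes v w g h :: "'a::euclidean_space \<Rightarrow> 'b::euclidean_space"
  assumes \<Omega>: "open \<Omega>" and i: "i \<in> Basis"
    and g: "has_weak_partial \<Omega> i v g" and h: "has_weak_partial \<Omega> i w h"
    and ae: "AE x in lebesgue_on \<Omega>. v x = w x"
  shows "AE x in lebesgue_on \<Omega>. g x = h x"
proof -
  have l: "locally_integrable \<Omega> v" "locally_integrable \<Omega> w" "locally_integrable \<Omega> g" "locally_integrable \<Omega> h"
    using g h by (auto simp: has_weak_partial_def)
  have "AE x in lebesgue_on \<Omega>. (g x - h x) \<bullet> b = 0" for b
  proof (rule du_Bois_Reymond_real[OF \<Omega> locally_integrable_linear[OF l(3,4)]])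
    fix \<phi> :: "'a \<Rightarrow> real" assume \<phi>: "\<phi> \<in> test_functions \<Omega>"
    note int = integrable_test_scaleR[OF \<Omega> \<phi> l(3)] integrable_test_scaleR[OF \<Omega> \<phi> l(4)]
    have "(LINT x|lebesgue_on \<Omega>. partial_deriv i \<phi> x *\<^sub>R v x) = (LINT x|lebesgue_on \<Omega>. partial_deriv i \<phi> x *\<^sub>R w x)"
      by (rule lebesgue_on_AE(1)[OF \<Omega>]) (use ae in eventually_elim, simp)
    then have "(LINT x|lebesgue_on \<Omega>. \<phi> x *\<^sub>R g x) = (LINT x|lebesgue_on \<Omega>. \<phi> x *\<^sub>R h x)"
      using g h \<phi> unfolding has_weak_partial_def by (metis neg_equal_iff_equal)
    then have "(LINT x|lebesgue_on \<Omega>. \<phi> x *\<^sub>R g x - \<phi> x *\<^sub>R h x) = 0" using int by simp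
    moreover have "(LINT x|lebesgue_on \<Omega>. \<phi> x * ((g x - h x) \<bullet> b)) = (LINT x|lebesgue_on \<Omega>. \<phi> x *\<^sub>R g x - \<phi> x *\<^sub>R h x) \<bullet> b"
      using int by (subst integral_inner_left[symmetric]) (auto simp: inner_diff_left right_diff_distrib)
    ultimately show "(LINT x|lebesgue_on \<Omega>. \<phi> x * ((g x - h x) \<bullet> b)) = 0" by simp
  qed
  then have "AE x in lebesgue_on \<Omega>. \<forall>b\<in>Basis. (g x - h x) \<bullet> b = 0"
    by (subst AE_ball_countable) (auto intro: countable_finite)
  then show ?thesis
    by eventually_elim (auto simp: inner_diff_left intro: euclidean_eqI)
qed

lemma has_weak_partial_AE:
  fixes v w g h :: "'a::euclidean_space \<Rightarrow> 'b::euclidean_space"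
  assumes \<Omega>: "open \<Omega>" and g: "has_weak_partial \<Omega> i v g" and ae: "AE x in lebesgue_on \<Omega>. v x = w x"
  shows "has_weak_partial \<Omega> i w g"
proof -
  have "(LINT x|lebesgue_on \<Omega>. partial_deriv i \<phi> x *\<^sub>R v x) = (LINT x|lebesgue_on \<Omega>. partial_deriv i \<phi> x *\<^sub>R w x)"
    for \<phi> :: "'a \<Rightarrow> real"
    by (rule lebesgue_on_AE(1)[OF \<Omega>]) (use ae in eventually_elim, simp)
  then show ?thesis
    using g locally_integrable_AE[OF \<Omega> _ ae] unfolding has_weak_partial_def by simp
qed

lemma weak_partial_AE:
  fixes v g :: "'a::euclidean_space \<Rightarrow> 'b::euclidean_space"
  assumes \<Omega>: "open \<Omega>" and i: "i \<in> Basis" and g: "has_weak_partial \<Omega> i v g"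
  shows "AE x in lebesgue_on \<Omega>. g x = weak_partial \<Omega> i v x"
proof -
  have "has_weak_partial \<Omega> i v (weak_partial \<Omega> i v)"
    unfolding weak_partial_def by (rule someI[of "has_weak_partial \<Omega> i v", OF g])
  then show ?thesis by (rule weak_partial_unique[OF \<Omega> i g]) simp
qed

lemma weak_partial_weak_partial_AE:
  fixes v g h :: "'a::euclidean_space \<Rightarrow> 'b::euclidean_space"
  assumes \<Omega>: "open \<Omega>" and ij: "i \<in> Basis" "j \<in> Basis"
    and g: "has_weak_partial \<Omega> i v g" and h: "has_weak_partial \<Omega> j g h"
  shows "AE x in lebesgue_on \<Omega>. h x = weak_partial \<Omega> j (weak_partial \<Omega> i v) x"
  by (rule weak_partial_AE[OF \<Omega> ij(2) has_weak_partial_AE[OF \<Omega> h weak_partial_AE[OF \<Omega> ij(1) g]]])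

lemma L2_AE:
  fixes f g :: "'a::euclidean_space \<Rightarrow> 'b::euclidean_space"
  assumes \<Omega>: "open \<Omega>" and ae: "AE x in lebesgue_on \<Omega>. f x = g x"
  shows "f \<in> L2 \<Omega> \<Longrightarrow> g \<in> L2 \<Omega>" "L2_norm \<Omega> f = L2_norm \<Omega> g"
proof -
  have "AE x in lebesgue_on \<Omega>. (norm (f x))\<^sup>2 = (norm (g x))\<^sup>2" using ae by eventually_elim simp
  note ae2 = lebesgue_on_AE[OF \<Omega> this]
  show "L2_norm \<Omega> f = L2_norm \<Omega> g" unfolding L2_norm_def by (simp add: ae2(1))
  show "f \<in> L2 \<Omega> \<Longrightarrow> g \<in> L2 \<Omega>" unfolding L2_def using ae2(2) lebesgue_on_AE(3)[OF \<Omega> ae] by auto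
qed

lemma L2_norm_power2: "(L2_norm \<Omega> f)\<^sup>2 = (LINT x|lebesgue_on \<Omega>. (norm (f x))\<^sup>2)"
  unfolding L2_norm_def by (intro real_sqrt_pow2 Bochner_Integration.integral_nonneg) auto

lemma L2_norm_nonneg: "L2_norm \<Omega> f \<ge> 0"
  unfolding L2_norm_def by (intro real_sqrt_ge_zero Bochner_Integration.integral_nonneg) auto

section \<open>Test functions in the Sobolev space\<close>

lemma integral_lebesgue_on_continuous:
  fixes f :: "'a::euclidean_space \<Rightarrow> real" and e :: "'b::euclidean_space"
  assumes \<Omega>: "open \<Omega>" and f: "continuous_on UNIV f" "\<And>x. x \<notin> \<Omega> \<Longrightarrow> f x = 0" "\<And>x. x \<notin> cball c R \<Longrightarrow> f x = 0"
  shows "integrable (lebesgue_on \<Omega>) (\<lambda>x. f x *\<^sub>R e)"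
    and "(LINT x|lebesgue_on \<Omega>. f x *\<^sub>R e) = (LINT x|lborel. f x) *\<^sub>R e"
proof -
  have [measurable]: "f \<in> borel_measurable borel" using f(1) by (rule borel_measurable_continuous_onI)
  have i: "integrable lborel f" by (rule integrable_compact_support[OF f(1,3)])
  then have i': "integrable lebesgue f" by (simp add: integrable_completion)
  have eq: "(\<lambda>x. indicator \<Omega> x *\<^sub>R (f x *\<^sub>R e)) = (\<lambda>x. f x *\<^sub>R e)"
    using f(2) by (auto simp: fun_eq_iff indicator_def)
  show "integrable (lebesgue_on \<Omega>) (\<lambda>x. f x *\<^sub>R e)" unfolding lebesgue_on_simps[OF \<Omega>] eq using i' by simp
  show "(LINT x|lebesgue_on \<Omega>. f x *\<^sub>R e) = (LINT x|lborel. f x) *\<^sub>R e"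
    unfolding lebesgue_on_simps[OF \<Omega>] eq using i' by (simp add: integral_completion)
qed

lemma locally_integrable_continuous:
  fixes f :: "'a::euclidean_space \<Rightarrow> 'b::euclidean_space"
  assumes "continuous_on UNIV f"
  shows "locally_integrable \<Omega> f"
  unfolding locally_integrable_def set_integrable_def
proof (intro allI impI)
  fix K :: "'a set" assume "compact K \<and> K \<subseteq> \<Omega>"
  then have K: "compact K" by simp
  have "integrable lborel (\<lambda>x. indicator K x *\<^sub>R f x)"
    by (intro borel_integrable_compact K continuous_on_subset[OF assms]) auto
  then show "integrable lebesgue (\<lambda>x. indicator K x *\<^sub>R f x)"
    using integrable_completion[of "\<lambda>x. indicator K x *\<^sub>R f x" lborel] by auto
qed

lemma test_function_weak_partial:
  fixes \<phi> :: "'a::euclidean_space \<Rightarrow> real" and e :: "'b::euclidean_space"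
  assumes \<Omega>: "open \<Omega>" and \<phi>: "\<phi> \<in> test_functions \<Omega>" and i: "i \<in> Basis"
  shows "has_weak_partial \<Omega> i (\<lambda>x. \<phi> x *\<^sub>R e) (\<lambda>x. partial_deriv i \<phi> x *\<^sub>R e)"
proof -
  note p = test_functions_partial[OF \<phi> i]
  note [continuous_intros] = test_functions_continuous[OF \<phi>] test_functions_continuous[OF p]
  have "(LINT x|lebesgue_on \<Omega>. partial_deriv i \<psi> x *\<^sub>R (\<phi> x *\<^sub>R e)) = - (LINT x|lebesgue_on \<Omega>. \<psi> x *\<^sub>R (partial_deriv i \<phi> x *\<^sub>R e))"
    if \<psi>: "\<psi> \<in> test_functions \<Omega>" for \<psi> :: "'a \<Rightarrow> real"
  proof -
    note q = test_functions_partial[OF \<psi> i]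
    note [continuous_intros] = test_functions_continuous[OF \<psi>] test_functions_continuous[OF q]
    obtain r where r: "\<And>x. x \<notin> cball 0 r \<Longrightarrow> \<phi> x = 0" using test_functions_bounded_support[OF \<phi>] by blast
    obtain s where s: "\<And>x. x \<notin> cball 0 s \<Longrightarrow> \<psi> x = 0" using test_functions_bounded_support[OF \<psi>] by blast
    have 0: "(LINT x|lborel. partial_deriv i \<psi> x * \<phi> x + \<psi> x * partial_deriv i \<phi> x) = 0"
      by (rule integral_dd_eq_0[OF dd_mult[OF test_functions_dd[OF \<psi>] test_functions_dd[OF \<phi>]], where c=0 and R=r])
        (auto intro!: continuous_intros simp: r)
    have i1: "integrable lborel (\<lambda>x. partial_deriv i \<psi> x * \<phi> x)"
      by (rule integrable_compact_support[where c=0 and R=r]) (auto intro!: continuous_intros simp: r)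
    have i2: "integrable lborel (\<lambda>x. \<psi> x * partial_deriv i \<phi> x)"
      by (rule integrable_compact_support[where c=0 and R=s]) (auto intro!: continuous_intros simp: s)
    have "(LINT x|lebesgue_on \<Omega>. (partial_deriv i \<psi> x * \<phi> x) *\<^sub>R e) = (LINT x|lborel. partial_deriv i \<psi> x * \<phi> x) *\<^sub>R e"
      by (rule integral_lebesgue_on_continuous(2)[OF \<Omega>, where c=0 and R=r])
        (auto intro!: continuous_intros simp: r test_functions_zero[OF \<phi>])
    moreover have "(LINT x|lebesgue_on \<Omega>. (\<psi> x * partial_deriv i \<phi> x) *\<^sub>R e) = (LINT x|lborel. \<psi> x * partial_deriv i \<phi> x) *\<^sub>R e"
      by (rule integral_lebesgue_on_continuous(2)[OF \<Omega>, where c=0 and R=s])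
        (auto intro!: continuous_intros simp: s test_functions_zero[OF \<psi>])
    moreover have "(LINT x|lborel. partial_deriv i \<psi> x * \<phi> x) = - (LINT x|lborel. \<psi> x * partial_deriv i \<phi> x)"
      using 0 i1 i2 by simp
    ultimately show ?thesis by simp
  qed
  then show ?thesis
    unfolding has_weak_partial_def by (auto intro!: locally_integrable_continuous continuous_intros)
qed

lemma test_function_L2:
  fixes \<phi> :: "'a::euclidean_space \<Rightarrow> real" and e :: "'b::euclidean_space"
  assumes \<Omega>: "open \<Omega>" and \<phi>: "\<phi> \<in> test_functions \<Omega>" and e: "norm e = 1"
  shows "(\<lambda>x. \<phi> x *\<^sub>R e) \<in> L2 \<Omega>" "(L2_norm \<Omega> (\<lambda>x. \<phi> x *\<^sub>R e))\<^sup>2 = (LINT x|lborel. (\<phi> x)\<^sup>2)"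
proof -
  have c: "continuous_on UNIV \<phi>" by (rule test_functions_continuous[OF \<phi>])
  obtain r where r: "\<And>x. x \<notin> cball 0 r \<Longrightarrow> \<phi> x = 0" using test_functions_bounded_support[OF \<phi>] by blast
  have n: "(norm (\<phi> x *\<^sub>R e))\<^sup>2 = (\<phi> x)\<^sup>2 *\<^sub>R 1" for x using e by simp
  note s = integral_lebesgue_on_continuous[OF \<Omega>, of "\<lambda>x. (\<phi> x)\<^sup>2" 0 r "1::real"]
  have 1: "integrable (lebesgue_on \<Omega>) (\<lambda>x. (\<phi> x)\<^sup>2 *\<^sub>R (1::real))"
    by (rule s(1)) (auto intro!: continuous_intros c simp: r test_functions_zero[OF \<phi>])
  have 2: "(LINT x|lebesgue_on \<Omega>. (\<phi> x)\<^sup>2 *\<^sub>R 1) = (LINT x|lborel. (\<phi> x)\<^sup>2) *\<^sub>R (1::real)"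
    by (rule s(2)) (auto intro!: continuous_intros c simp: r test_functions_zero[OF \<phi>])
  show "(L2_norm \<Omega> (\<lambda>x. \<phi> x *\<^sub>R e))\<^sup>2 = (LINT x|lborel. (\<phi> x)\<^sup>2)"
    unfolding L2_norm_power2 n 2 by simp
  have "(\<lambda>x. \<phi> x *\<^sub>R e) \<in> borel_measurable borel"
    by (intro borel_measurable_continuous_onI continuous_intros c)
  then have "(\<lambda>x. \<phi> x *\<^sub>R e) \<in> borel_measurable (lebesgue_on \<Omega>)"
    by (intro measurable_restrict_space1 measurable_completion) simp
  then show "(\<lambda>x. \<phi> x *\<^sub>R e) \<in> L2 \<Omega>" unfolding L2_def mem_Collect_eq n using 1 by blast
qed

text \<open>The squared H2 norm of a real test function, formed with classical derivatives over
  \<open>lborel\<close>. Multiplication by a unit vector \<open>e\<close> carries real test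
  functions to vector-valued ones and preserves all norms involved.\<close>

definition H2_square :: "('a::euclidean_space \<Rightarrow> real) \<Rightarrow> real" where
  "H2_square v = (LINT x|lborel. (v x)\<^sup>2) + (\<Sum>i\<in>Basis. LINT x|lborel. (partial_deriv i v x)\<^sup>2)
     + (\<Sum>i\<in>Basis. \<Sum>j\<in>Basis. LINT x|lborel. (partial_deriv j (partial_deriv i v) x)\<^sup>2)"

lemma H2_square_nonneg: "H2_square v \<ge> 0"
  unfolding H2_square_def
  by (intro add_nonneg_nonneg sum_nonneg Bochner_Integration.integral_nonneg) auto

lemma partial_deriv_cmult_test:
  fixes v :: "'a::euclidean_space \<Rightarrow> real"
  assumes "v \<in> test_functions \<Omega>"
  shows "partial_deriv i (\<lambda>x. c * v x) = (\<lambda>x. c * partial_deriv i v x)"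
  by (rule dd_unique[OF test_functions_dd[OF test_functions_cmult[OF assms]] dd_cmult[OF test_functions_dd[OF assms]]])

lemma H2_square_cmult:
  assumes v: "v \<in> test_functions \<Omega>"
  shows "H2_square (\<lambda>x. c * v x) = c\<^sup>2 * H2_square v"
  unfolding H2_square_def
  by (simp add: partial_deriv_cmult_test[OF v] partial_deriv_cmult_test[OF test_functions_partial[OF v]]
      power_mult_distrib sum_distrib_left distrib_left cong: sum.cong)

lemma laplacian_cmult:
  assumes v: "v \<in> test_functions \<Omega>"
  shows "laplacian (\<lambda>x. c * v x) x = c * laplacian v x"
  unfolding laplacian_def
  by (simp add: partial_deriv_cmult_test[OF v] partial_deriv_cmult_test[OF test_functions_partial[OF v]]
      sum_distrib_left cong: sum.cong)

text \<open>The representatives picked by \<open>weak_partial\<close> agree almost everywhere with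
  the classical derivatives, so the Sobolev norm and the weak Laplacian of a test function can be
  computed classically.\<close>

lemma H2_norm_test:
  fixes \<phi> :: "'a::euclidean_space \<Rightarrow> real" and e :: "'b::euclidean_space"
  assumes \<Omega>: "open \<Omega>" and \<phi>: "\<phi> \<in> test_functions \<Omega>" and e: "norm e = 1"
  shows "(\<lambda>x. \<phi> x *\<^sub>R e) \<in> H2 \<Omega>"
    and "H2_norm \<Omega> (\<lambda>x. \<phi> x *\<^sub>R e) = sqrt (H2_square \<phi>)"
    and "AE x in lebesgue_on \<Omega>. laplacian \<phi> x *\<^sub>R e = weak_laplacian \<Omega> (\<lambda>x. \<phi> x *\<^sub>R e) x"
proof -
  note p = test_functions_partial[OF \<phi>]
  note q = test_functions_partial[OF p]
  note w1 = test_function_weak_partial[OF \<Omega> \<phi>, of _ e]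
  note w2 = test_function_weak_partial[OF \<Omega> p, of _ _ e]
  show "(\<lambda>x. \<phi> x *\<^sub>R e) \<in> H2 \<Omega>"
    unfolding H2_def
    using test_function_L2(1)[OF \<Omega> \<phi> e] test_function_L2(1)[OF \<Omega> p e] test_function_L2(1)[OF \<Omega> q e] w1 w2 by blast
  have ae2: "AE x in lebesgue_on \<Omega>. partial_deriv j (partial_deriv i \<phi>) x *\<^sub>R e = weak_partial \<Omega> j (weak_partial \<Omega> i (\<lambda>x. \<phi> x *\<^sub>R e)) x"
    if "i \<in> Basis" "j \<in> Basis" for i j
    by (rule weak_partial_weak_partial_AE[OF \<Omega> that w1[OF that(1)] w2[OF that]])
  have n1: "(L2_norm \<Omega> (weak_partial \<Omega> i (\<lambda>x. \<phi> x *\<^sub>R e)))\<^sup>2 = (LINT x|lborel. (partial_deriv i \<phi> x)\<^sup>2)"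
    if "i \<in> Basis" for i
    using L2_AE(2)[OF \<Omega> weak_partial_AE[OF \<Omega> that w1[OF that]]] test_function_L2(2)[OF \<Omega> p[OF that] e] by simp
  have n2: "(L2_norm \<Omega> (weak_partial \<Omega> j (weak_partial \<Omega> i (\<lambda>x. \<phi> x *\<^sub>R e))))\<^sup>2 = (LINT x|lborel. (partial_deriv j (partial_deriv i \<phi>) x)\<^sup>2)"
    if "i \<in> Basis" "j \<in> Basis" for i j
    using L2_AE(2)[OF \<Omega> ae2[OF that]] test_function_L2(2)[OF \<Omega> q[OF that] e] by simp
  show "H2_norm \<Omega> (\<lambda>x. \<phi> x *\<^sub>R e) = sqrt (H2_square \<phi>)"
    unfolding H2_norm_def H2_square_def test_function_L2(2)[OF \<Omega> \<phi> e] by (simp add: n1 n2)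
  have "AE x in lebesgue_on \<Omega>. \<forall>i\<in>Basis. partial_deriv i (partial_deriv i \<phi>) x *\<^sub>R e = weak_partial \<Omega> i (weak_partial \<Omega> i (\<lambda>x. \<phi> x *\<^sub>R e)) x"
    using ae2 by (subst AE_ball_countable) (auto intro: countable_finite)
  then show "AE x in lebesgue_on \<Omega>. laplacian \<phi> x *\<^sub>R e = weak_laplacian \<Omega> (\<lambda>x. \<phi> x *\<^sub>R e) x"
    by eventually_elim (simp add: laplacian_def weak_laplacian_def scaleR_sum_left)
qed

lemma test_function_H2_0:
  fixes \<phi> :: "'a::euclidean_space \<Rightarrow> real" and e :: "'b::euclidean_space"
  assumes \<Omega>: "open \<Omega>" and \<phi>: "\<phi> \<in> test_functions \<Omega>" and e: "norm e = 1"
  shows "(\<lambda>x. \<phi> x *\<^sub>R e) \<in> H2_0 \<Omega>"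
proof -
  have z: "(\<lambda>x. 0::real) \<in> test_functions \<Omega>" using test_functions_cmult[OF \<phi>, of 0] by simp
  \<comment> \<open>A constant sequence approximates. The norm of the difference still has to be
    computed, as the weak derivatives chosen for the zero function are known to vanish only almost
    everywhere.\<close>
  have "H2_square (\<lambda>x::'a. 0) = 0" using H2_square_cmult[OF \<phi>, of 0] by simp
  then have "H2_norm \<Omega> (\<lambda>x. \<phi> x *\<^sub>R e - \<phi> x *\<^sub>R e) = 0"
    using H2_norm_test(2)[OF \<Omega> z e] by simp
  moreover have "(\<lambda>x. \<phi> x *\<^sub>R e) \<in> test_functions \<Omega>"
    by (rule test_functions_linear[OF \<phi> bounded_linear_scaleR_left])
  ultimately show ?thesis
    unfolding H2_0_def using H2_norm_test(1)[OF \<Omega> \<phi> e]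
    by (auto intro!: exI[of _ "\<lambda>k x. \<phi> x *\<^sub>R e"])
qed

lemma H2_weak_partial_L2:
  assumes \<Omega>: "open \<Omega>" and v: "v \<in> H2 \<Omega>" and ij: "i \<in> Basis" "j \<in> Basis"
  shows "weak_partial \<Omega> j (weak_partial \<Omega> i v) \<in> L2 \<Omega>"
proof -
  obtain g where g: "g \<in> L2 \<Omega>" "has_weak_partial \<Omega> i v g" "\<forall>j\<in>Basis. \<exists>h\<in>L2 \<Omega>. has_weak_partial \<Omega> j g h"
    using v ij(1) unfolding H2_def by blast
  then obtain h where h: "h \<in> L2 \<Omega>" "has_weak_partial \<Omega> j g h" using ij(2) by blast
  show ?thesis
    by (rule L2_AE(1)[OF \<Omega> weak_partial_weak_partial_AE[OF \<Omega> ij g(2) h(2)] h(1)])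
qed

section \<open>The dual norm tested with smooth functions\<close>

text \<open>A nonempty open set is not negligible, which forces the essential supremum of the
  absolute value of \<open>P\<close> to be nonnegative; being also finite, it survives
  \<open>real_of_ereal\<close>.\<close>

lemma Linf_AE:
  assumes \<Omega>: "open \<Omega>" "\<Omega> \<noteq> {}" and P: "P \<in> Linf \<Omega>"
  shows "Linf_norm \<Omega> P \<ge> 0" "AE x in lebesgue_on \<Omega>. \<bar>P x\<bar> \<le> Linf_norm \<Omega> P"
proof -
  define s where "s = esssup (lebesgue_on \<Omega>) (\<lambda>x. ereal \<bar>P x\<bar>)"
  have ae: "AE x in lebesgue_on \<Omega>. ereal \<bar>P x\<bar> \<le> s" unfolding s_def by (rule esssup_AE)
  have "s < \<infinity>" using P by (simp add: Linf_def s_def)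
  have "s \<ge> 0"
  proof (rule ccontr)
    assume "\<not> 0 \<le> s"
    have "AE x in lebesgue_on \<Omega>. False"
      using ae
    proof eventually_elim
      case (elim x)
      have "(0::ereal) \<le> ereal \<bar>P x\<bar>" by simp
      then show ?case using elim \<open>\<not> 0 \<le> s\<close> by (meson order_trans)
    qed
    then have "AE x in lebesgue. x \<notin> \<Omega>" unfolding lebesgue_on_simps(4)[OF \<Omega>(1)] by simp
    then have "\<Omega> \<in> null_sets lebesgue" using \<Omega>(1) by (subst AE_iff_null_sets) auto
    then show False using open_not_negligible[OF \<Omega>] by (simp add: negligible_iff_null_sets)
  qed
  with \<open>s < \<infinity>\<close> obtain r where r: "s = ereal r" "r \<ge> 0" by (cases s) auto
  then show "Linf_norm \<Omega> P \<ge> 0" "AE x in lebesgue_on \<Omega>. \<bar>P x\<bar> \<le> Linf_norm \<Omega> P"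
    using ae unfolding Linf_norm_def s_def[symmetric] by simp_all
qed

text \<open>\<open>Hm2_norm\<close> is a real supremum, so its set must be bounded before an element
  can be compared with it. Any bound will do, and the crude
  \<open>a * b \<le> a\<^sup>2 + b\<^sup>2\<close> under the integral gives one.\<close>

lemma schroedinger_bounded:
  fixes u :: "'a::euclidean_space \<Rightarrow> 'b::{real_normed_field,euclidean_space}"
  assumes \<Omega>: "open \<Omega>" "\<Omega> \<noteq> {}" and P: "P \<in> Linf \<Omega>" and u: "u \<in> L2 \<Omega>"
  shows "bdd_above ((\<lambda>v. norm (schroedinger \<Omega> P u v)) ` {v \<in> H2_0 \<Omega>. H2_norm \<Omega> v \<le> 1})"
proof (rule bdd_aboveI2)
  define M where "M = Linf_norm \<Omega> P"
  define n where "n = real DIM('a)"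
  note PM = Linf_AE[OF \<Omega> P, folded M_def]
  fix v :: "'a \<Rightarrow> 'b" assume "v \<in> {v \<in> H2_0 \<Omega>. H2_norm \<Omega> v \<le> 1}"
  then have v: "v \<in> H2 \<Omega>" "H2_norm \<Omega> v \<le> 1" by (auto simp: H2_0_def)
  have vL: "v \<in> L2 \<Omega>" using v by (simp add: H2_def)
  define w where "w i = weak_partial \<Omega> i (weak_partial \<Omega> i v)" for i
  have wL: "w i \<in> L2 \<Omega>" if "i \<in> Basis" for i unfolding w_def by (rule H2_weak_partial_L2[OF \<Omega>(1) v(1) that that])
  define S where "S = (L2_norm \<Omega> v)\<^sup>2
     + (\<Sum>i\<in>Basis. (L2_norm \<Omega> (weak_partial \<Omega> i v))\<^sup>2)
     + (\<Sum>i\<in>Basis. \<Sum>j\<in>Basis. (L2_norm \<Omega> (weak_partial \<Omega> j (weak_partial \<Omega> i v)))\<^sup>2)"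
  have "sqrt S \<le> 1" using v(2) by (simp add: H2_norm_def S_def)
  then have S1: "S \<le> 1" by simp
  have nn: "0 \<le> (\<Sum>i\<in>Basis. (L2_norm \<Omega> (weak_partial \<Omega> i v))\<^sup>2)"
    "0 \<le> (\<Sum>j\<in>Basis. (L2_norm \<Omega> (weak_partial \<Omega> j (weak_partial \<Omega> i v)))\<^sup>2)"
    "0 \<le> (\<Sum>i\<in>Basis. \<Sum>j\<in>Basis. (L2_norm \<Omega> (weak_partial \<Omega> j (weak_partial \<Omega> i v)))\<^sup>2)" for i
    by (intro sum_nonneg; simp)+
  have v1: "(L2_norm \<Omega> v)\<^sup>2 \<le> 1"
    using S1 nn(1,3) unfolding S_def by linarith
  have w1: "(\<Sum>i\<in>Basis. (L2_norm \<Omega> (w i))\<^sup>2) \<le> 1"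
  proof -
    have "(L2_norm \<Omega> (w i))\<^sup>2 \<le> (\<Sum>j\<in>Basis. (L2_norm \<Omega> (weak_partial \<Omega> j (weak_partial \<Omega> i v)))\<^sup>2)" if "i \<in> Basis" for i
      unfolding w_def using that
      by (intro member_le_sum[where f="\<lambda>j. (L2_norm \<Omega> (weak_partial \<Omega> j (weak_partial \<Omega> i v)))\<^sup>2"]) auto
    then have "(\<Sum>i\<in>Basis. (L2_norm \<Omega> (w i))\<^sup>2) \<le> (\<Sum>i\<in>Basis. \<Sum>j\<in>Basis. (L2_norm \<Omega> (weak_partial \<Omega> j (weak_partial \<Omega> i v)))\<^sup>2)"
      by (intro sum_mono)
    then show ?thesis using S1 nn(1) zero_le_power2[of "L2_norm \<Omega> v"] unfolding S_def by linarith
  qed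
  have i: "integrable (lebesgue_on \<Omega>) (\<lambda>x. (norm (u x))\<^sup>2)" "integrable (lebesgue_on \<Omega>) (\<lambda>x. (norm (v x))\<^sup>2)"
    "i \<in> Basis \<Longrightarrow> integrable (lebesgue_on \<Omega>) (\<lambda>x. (norm (w i x))\<^sup>2)" for i
    using u vL wL by (auto simp: L2_def)
  let ?g = "\<lambda>x. (n + M) * (norm (u x))\<^sup>2 + (\<Sum>i\<in>Basis. (norm (w i x))\<^sup>2) + M * (norm (v x))\<^sup>2"
  have ig: "integrable (lebesgue_on \<Omega>) ?g" using i by auto
  have ab: "a * b \<le> a\<^sup>2 + b\<^sup>2" for a b :: real
    using sum_squares_bound[of a b] sum_power2_ge_zero[of a b] by linarith
  have "norm (schroedinger \<Omega> P u v) \<le> (LINT x|lebesgue_on \<Omega>. norm (u x * (- weak_laplacian \<Omega> v x + P x *\<^sub>R v x)))"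
    unfolding schroedinger_def by (rule integral_norm_bound)
  also have "\<dots> \<le> (LINT x|lebesgue_on \<Omega>. ?g x)"
  proof (rule integral_mono_AE'[OF ig])
    show "AE x in lebesgue_on \<Omega>. norm (u x * (- weak_laplacian \<Omega> v x + P x *\<^sub>R v x)) \<le> ?g x"
      using PM(2)
    proof eventually_elim
      case (elim x)
      have "norm (- weak_laplacian \<Omega> v x + P x *\<^sub>R v x) \<le> norm (weak_laplacian \<Omega> v x) + \<bar>P x\<bar> * norm (v x)"
        by (rule order_trans[OF norm_triangle_ineq]) simp
      also have "\<dots> \<le> (\<Sum>i\<in>Basis. norm (w i x)) + M * norm (v x)"
        unfolding weak_laplacian_def w_def using elim by (intro add_mono norm_sum mult_right_mono) auto
      finally have "norm (u x) * norm (- weak_laplacian \<Omega> v x + P x *\<^sub>R v x) \<le> norm (u x) * ((\<Sum>i\<in>Basis. norm (w i x)) + M * norm (v x))"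
        by (intro mult_left_mono) auto
      also have "\<dots> = (\<Sum>i\<in>Basis. norm (u x) * norm (w i x)) + M * (norm (u x) * norm (v x))"
        by (simp add: sum_distrib_left algebra_simps)
      also have "\<dots> \<le> (\<Sum>i\<in>Basis. (norm (u x))\<^sup>2 + (norm (w i x))\<^sup>2) + M * ((norm (u x))\<^sup>2 + (norm (v x))\<^sup>2)"
        using PM(1) by (intro add_mono sum_mono mult_left_mono ab) auto
      also have "\<dots> = ?g x" by (simp add: sum.distrib n_def algebra_simps)
      finally show ?case by (simp add: norm_mult)
    qed
    show "AE x in lebesgue_on \<Omega>. 0 \<le> ?g x"
      using PM(1) by (intro AE_I2) (auto intro!: add_nonneg_nonneg sum_nonneg mult_nonneg_nonneg simp: n_def)
  qed
  also have "\<dots> = (n + M) * (L2_norm \<Omega> u)\<^sup>2 + (\<Sum>i\<in>Basis. (L2_norm \<Omega> (w i))\<^sup>2) + M * (L2_norm \<Omega> v)\<^sup>2"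
    unfolding L2_norm_power2 using i by (simp add: Bochner_Integration.integral_sum)
  also have "\<dots> \<le> (n + M) * (L2_norm \<Omega> u)\<^sup>2 + 1 + M * 1"
    using v1 w1 PM(1) by (intro add_mono mult_left_mono) (auto simp: n_def)
  finally show "norm (schroedinger \<Omega> P u v) \<le> (n + M) * (L2_norm \<Omega> u)\<^sup>2 + 1 + M * 1" .
qed

lemma schroedinger_test:
  fixes u :: "'a::euclidean_space \<Rightarrow> 'b::{real_normed_field,euclidean_space}"
  assumes \<Omega>: "open \<Omega>" and \<phi>: "\<phi> \<in> test_functions \<Omega>"
  shows "schroedinger \<Omega> P u (\<lambda>x. \<phi> x *\<^sub>R 1) = (LINT x|lebesgue_on \<Omega>. (P x * \<phi> x - laplacian \<phi> x) *\<^sub>R u x)"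
  unfolding schroedinger_def
proof (rule lebesgue_on_AE(1)[OF \<Omega>])
  have "norm (1::'b) = 1" by simp
  from H2_norm_test(3)[OF \<Omega> \<phi> this]
  show "AE x in lebesgue_on \<Omega>. u x * (- weak_laplacian \<Omega> (\<lambda>x. \<phi> x *\<^sub>R 1) x + P x *\<^sub>R \<phi> x *\<^sub>R 1) = (P x * \<phi> x - laplacian \<phi> x) *\<^sub>R u x"
  proof eventually_elim
    case (elim x)
    show ?case unfolding elim[symmetric] by (simp add: algebra_simps scaleR_diff_left)
  qed
qed

text \<open>The supremum runs over a unit ball; homogeneity extends the bound to all test
  functions.\<close>

lemma Hm2_norm_test:
  fixes u :: "'a::euclidean_space \<Rightarrow> 'b::{real_normed_field,euclidean_space}"
  assumes \<Omega>: "open \<Omega>" "\<Omega> \<noteq> {}" and P: "P \<in> Linf \<Omega>" and u: "u \<in> L2 \<Omega>"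
  shows "Hm2_norm \<Omega> (schroedinger \<Omega> P u) \<ge> 0"
    and "\<phi> \<in> test_functions \<Omega> \<Longrightarrow> norm (LINT x|lebesgue_on \<Omega>. (P x * \<phi> x - laplacian \<phi> x) *\<^sub>R u x)
      \<le> Hm2_norm \<Omega> (schroedinger \<Omega> P u) * sqrt (H2_square \<phi>)"
proof -
  define F where "F \<phi> = (LINT x|lebesgue_on \<Omega>. (P x * \<phi> x - laplacian \<phi> x) *\<^sub>R u x)" for \<phi>
  define H where "H = Hm2_norm \<Omega> (schroedinger \<Omega> P u)"
  have one: "norm (1::'b) = 1" by simp
  have unit: "norm (F \<phi>) \<le> H" if \<phi>: "\<phi> \<in> test_functions \<Omega>" and le: "H2_square \<phi> \<le> 1" for \<phi>
  proof -
    have "norm (schroedinger \<Omega> P u (\<lambda>x. \<phi> x *\<^sub>R 1)) \<le> H"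
      unfolding H_def Hm2_norm_def
    proof (rule cSUP_upper[OF _ schroedinger_bounded[OF \<Omega> P u]])
      show "(\<lambda>x. \<phi> x *\<^sub>R (1::'b)) \<in> {v \<in> H2_0 \<Omega>. H2_norm \<Omega> v \<le> 1}"
        using test_function_H2_0[OF \<Omega>(1) \<phi> one] H2_norm_test(2)[OF \<Omega>(1) \<phi> one] le by simp
    qed
    then show ?thesis unfolding F_def schroedinger_test[OF \<Omega>(1) \<phi>] .
  qed
  have z: "(\<lambda>x. 0::real) \<in> test_functions \<Omega>" by (rule test_functionsI[of _ "{}"]) (auto intro: C_k_const)
  have "H2_square (\<lambda>x::'a. 0) = 0" using H2_square_cmult[OF z, of 0] by simp
  then have "norm (F (\<lambda>x. 0)) \<le> H" by (intro unit z) simp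
  then show H0: "Hm2_norm \<Omega> (schroedinger \<Omega> P u) \<ge> 0" unfolding H_def by (meson norm_ge_zero order_trans)
  show "norm (LINT x|lebesgue_on \<Omega>. (P x * \<phi> x - laplacian \<phi> x) *\<^sub>R u x)
      \<le> Hm2_norm \<Omega> (schroedinger \<Omega> P u) * sqrt (H2_square \<phi>)" if \<phi>: "\<phi> \<in> test_functions \<Omega>"
    unfolding H_def[symmetric] F_def[symmetric]
  proof (rule field_le_epsilon)
    fix e :: real assume e: "e > 0"
    have H1: "H + 1 > 0" using H0 by (simp add: H_def)
    \<comment> \<open>Slightly more than the norm of \<open>\<phi>\<close>, so that dividing by
      \<open>t\<close> is legitimate even if \<open>H2_square \<phi> = 0\<close>; the surplus costs
      at most \<open>e\<close>.\<close>
    define t where "t = sqrt (H2_square \<phi>) + e / (H + 1)"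
    have t: "t > 0" "sqrt (H2_square \<phi>) \<le> t"
      using e H1 H2_square_nonneg[of \<phi>] by (auto simp: t_def intro!: add_nonneg_pos)
    have "H2_square \<phi> = (sqrt (H2_square \<phi>))\<^sup>2" using H2_square_nonneg[of \<phi>] by simp
    also have "\<dots> \<le> t\<^sup>2" using t H2_square_nonneg[of \<phi>] by (intro power_mono) auto
    finally have "H2_square (\<lambda>x. (1 / t) * \<phi> x) \<le> 1"
      unfolding H2_square_cmult[OF \<phi>] using t by (simp add: power_divide)
    then have "norm (F (\<lambda>x. (1 / t) * \<phi> x)) \<le> H" by (intro unit test_functions_cmult \<phi>)
    moreover have "F (\<lambda>x. (1 / t) * \<phi> x) = (1 / t) *\<^sub>R F \<phi>"
    proof -
      have eq: "(P x * ((1 / t) * \<phi> x) - laplacian (\<lambda>x. (1 / t) * \<phi> x) x) *\<^sub>R u x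
          = (1 / t) *\<^sub>R ((P x * \<phi> x - laplacian \<phi> x) *\<^sub>R u x)" for x
        unfolding laplacian_cmult[OF \<phi>] by (simp add: algebra_simps diff_divide_distrib)
      show ?thesis unfolding F_def eq by (rule integral_scaleR_right)
    qed
    ultimately have "norm (F \<phi>) \<le> H * t" using t by (simp add: field_simps)
    also have "\<dots> = H * sqrt (H2_square \<phi>) + H / (H + 1) * e" by (simp add: t_def algebra_simps)
    also have "H / (H + 1) * e \<le> 1 * e"
      using H1 H0 e by (intro mult_right_mono) (auto simp: H_def)
    finally show "norm (F \<phi>) \<le> H * sqrt (H2_square \<phi>) + e" by simp
  qed
qed

section \<open>The three balls inequality\<close>

lemma L2_subset:
  fixes u :: "'a::euclidean_space \<Rightarrow> 'b::euclidean_space"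
  assumes "open S" "open \<Omega>" "S \<subseteq> \<Omega>" and u: "u \<in> L2 \<Omega>"
  shows "u \<in> L2 S" "L2_norm S u \<le> L2_norm \<Omega> u"
proof -
  have S: "S \<in> sets lebesgue" using assms(1) by simp
  have eq: "indicator S x *\<^sub>R (indicator \<Omega> x *\<^sub>R u x) = indicator S x *\<^sub>R u x"
    "indicator S x *\<^sub>R (indicator \<Omega> x *\<^sub>R (norm (u x))\<^sup>2) = indicator S x *\<^sub>R (norm (u x))\<^sup>2" for x
    using assms(3) by (auto simp: indicator_def)
  have m: "(\<lambda>x. indicator \<Omega> x *\<^sub>R u x) \<in> borel_measurable lebesgue"
    and i: "integrable lebesgue (\<lambda>x. indicator \<Omega> x *\<^sub>R (norm (u x))\<^sup>2)"
    using u unfolding L2_def lebesgue_on_simps[OF assms(2)] by auto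
  have m': "(\<lambda>x. indicator S x *\<^sub>R u x) \<in> borel_measurable lebesgue"
    using borel_measurable_scaleR[OF borel_measurable_indicator[OF S] m] unfolding eq .
  have i': "integrable lebesgue (\<lambda>x. indicator S x *\<^sub>R (norm (u x))\<^sup>2)"
    using integrable_mult_indicator[OF S i] unfolding eq .
  show "u \<in> L2 S" unfolding L2_def lebesgue_on_simps[OF assms(1)] using m' i' by simp
  show "L2_norm S u \<le> L2_norm \<Omega> u"
    unfolding L2_norm_def lebesgue_on_simps[OF assms(1)] lebesgue_on_simps[OF assms(2)] using assms(3)
    by (intro real_sqrt_le_mono integral_mono i i') (auto simp: indicator_def)
qed

text \<open>The estimates for real functions ask for a Borel potential bounded by \<open>M\<close>
  at every point; clipping a Borel representative achieves this without changing it at almost all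
  points of \<open>\<Omega>\<close>.\<close>

lemma exists_clipped_borel:
  fixes P :: "'a::euclidean_space \<Rightarrow> real"
  assumes \<Omega>: "open \<Omega>" and P: "P \<in> borel_measurable (lebesgue_on \<Omega>)" "AE x in lebesgue_on \<Omega>. \<bar>P x\<bar> \<le> M" and M: "M \<ge> 0"
  obtains Q where "Q \<in> borel_measurable borel" "\<And>x. \<bar>Q x\<bar> \<le> M" "AE x in lebesgue. x \<in> \<Omega> \<longrightarrow> P x = Q x"
proof -
  have "(\<lambda>x. indicator \<Omega> x *\<^sub>R P x) \<in> borel_measurable lebesgue"
    using P(1) unfolding lebesgue_on_simps[OF \<Omega>] .
  then obtain q where q: "q \<in> borel_measurable lborel" "AE x in lborel. indicator \<Omega> x *\<^sub>R P x = q x"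
    using completion_ex_borel_measurable_real by blast
  have "AE x in lebesgue. indicator \<Omega> x *\<^sub>R P x = q x" using q(2) by (simp add: AE_completion_iff)
  with P(2)[unfolded lebesgue_on_simps(4)[OF \<Omega>]]
  have "AE x in lebesgue. x \<in> \<Omega> \<longrightarrow> P x = max (- M) (min M (q x))"
    by eventually_elim (auto simp: max_def min_def)
  moreover have "(\<lambda>x. max (- M) (min M (q x))) \<in> borel_measurable borel" using q(1) by simp
  moreover have "\<bar>max (- M) (min M (q x))\<bar> \<le> M" for x using M by (auto simp: max_def min_def)
  ultimately show ?thesis by (intro that)
qed

lemma exists_borel_component:
  fixes u :: "'a::euclidean_space \<Rightarrow> 'b::euclidean_space"
  assumes u: "u \<in> L2 (ball c R)"
  obtains f where "f \<in> borel_measurable borel" "\<And>x. x \<notin> ball c R \<Longrightarrow> f x = 0"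
    "AE x in lebesgue. x \<in> ball c R \<longrightarrow> u x \<bullet> b = f x" "integrable lborel (\<lambda>x. (f x)\<^sup>2)"
proof -
  have o: "open (ball c R)" by simp
  have m: "(\<lambda>x. indicator (ball c R) x *\<^sub>R u x) \<in> borel_measurable lebesgue"
    and i: "integrable lebesgue (\<lambda>x. indicator (ball c R) x *\<^sub>R (norm (u x))\<^sup>2)"
    using u unfolding L2_def lebesgue_on_simps[OF o] by auto
  have "(\<lambda>x. (indicator (ball c R) x *\<^sub>R u x) \<bullet> b) \<in> borel_measurable lebesgue"
    by (rule borel_measurable_inner[OF m borel_measurable_const])
  then obtain q where q: "q \<in> borel_measurable lborel" "AE x in lborel. (indicator (ball c R) x *\<^sub>R u x) \<bullet> b = q x"
    using completion_ex_borel_measurable_real by blast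
  define f where "f x = indicator (ball c R) x * q x" for x
  have f [measurable]: "f \<in> borel_measurable borel"
    unfolding f_def using q(1) by (intro borel_measurable_times borel_measurable_indicator) auto
  have "AE x in lebesgue. (indicator (ball c R) x *\<^sub>R u x) \<bullet> b = q x" using q(2) by (simp add: AE_completion_iff)
  then have ae: "AE x in lebesgue. x \<in> ball c R \<longrightarrow> u x \<bullet> b = f x"
  proof eventually_elim
    case (elim x)
    then show ?case by (cases "x \<in> ball c R") (simp_all add: f_def)
  qed
  have "integrable lebesgue (\<lambda>x. (f x)\<^sup>2)"
  proof (rule Bochner_Integration.integrable_bound[where f="\<lambda>x. (norm b)\<^sup>2 * (indicator (ball c R) x *\<^sub>R (norm (u x))\<^sup>2)"])
    show "integrable lebesgue (\<lambda>x. (norm b)\<^sup>2 * (indicator (ball c R) x *\<^sub>R (norm (u x))\<^sup>2))"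
      using i by (rule integrable_mult_right)
    show "(\<lambda>x. (f x)\<^sup>2) \<in> borel_measurable lebesgue" by (intro measurable_completion) simp
    show "AE x in lebesgue. norm ((f x)\<^sup>2) \<le> norm ((norm b)\<^sup>2 * (indicator (ball c R) x *\<^sub>R (norm (u x))\<^sup>2))"
      using ae
    proof eventually_elim
      case (elim x)
      show ?case
      proof (cases "x \<in> ball c R")
        case True
        have "(u x \<bullet> b)\<^sup>2 \<le> (norm (u x) * norm b)\<^sup>2"
          using Cauchy_Schwarz_ineq2[of "u x" b] by (metis abs_ge_zero power2_abs power_mono)
        then show ?thesis using True elim by (simp add: power_mult_distrib mult.commute)
      qed (simp add: f_def)
    qed
  qed
  then have "integrable lborel (\<lambda>x. (f x)\<^sup>2)" by (subst (asm) integrable_completion) auto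
  then show ?thesis using that[of f] f ae by (simp add: f_def)
qed

lemma L2_norm_components:
  fixes u :: "'a::euclidean_space \<Rightarrow> 'b::euclidean_space" and f :: "'b \<Rightarrow> 'a \<Rightarrow> real"
  assumes f: "\<And>b. b \<in> Basis \<Longrightarrow> AE x in lebesgue. x \<in> ball c R \<longrightarrow> u x \<bullet> b = f b x"
    "\<And>b. b \<in> Basis \<Longrightarrow> integrable lborel (\<lambda>x. (f b x)\<^sup>2)" and r: "r \<le> R"
  shows "(L2_norm (ball c r) u)\<^sup>2 = (\<Sum>b\<in>Basis. bint (ball c r) (\<lambda>x. (f b x)\<^sup>2))"
proof -
  have o: "open (ball c r)" by simp
  have i: "integrable lborel (\<lambda>x. indicator (ball c r) x * (f b x)\<^sup>2)" if "b \<in> Basis" for b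
    by (rule integrable_indicator_mult[OF f(2)[OF that]]) simp
  have i': "integrable lebesgue (\<lambda>x. \<Sum>b\<in>Basis. indicator (ball c r) x * (f b x)\<^sup>2)"
    using i by (intro Bochner_Integration.integrable_sum) (auto simp: integrable_completion)
  have "AE x in lebesgue. \<forall>b\<in>Basis. x \<in> ball c R \<longrightarrow> u x \<bullet> b = f b x"
    using f(1) by (subst AE_ball_countable) (auto intro: countable_finite)
  then have ae: "AE x in lebesgue. (\<Sum>b\<in>Basis. indicator (ball c r) x * (f b x)\<^sup>2) = indicator (ball c r) x *\<^sub>R (norm (u x))\<^sup>2"
  proof eventually_elim
    case (elim x)
    show ?case
    proof (cases "x \<in> ball c r")
      case True
      then have "u x \<bullet> b = f b x" if "b \<in> Basis" for b using elim r that by auto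
      then have "(norm (u x))\<^sup>2 = (\<Sum>b\<in>Basis. (f b x)\<^sup>2)"
        unfolding power2_norm_eq_inner euclidean_inner[of "u x" "u x"] by (simp add: power2_eq_square)
      then show ?thesis using True by simp
    qed simp
  qed
  have "(L2_norm (ball c r) u)\<^sup>2 = (LINT x|lebesgue. (\<Sum>b\<in>Basis. indicator (ball c r) x * (f b x)\<^sup>2))"
    unfolding L2_norm_power2 lebesgue_on_simps[OF o] by (rule integrable_lebesgue_AE(2)[OF i' ae])
  also have "\<dots> = (LINT x|lborel. (\<Sum>b\<in>Basis. indicator (ball c r) x * (f b x)\<^sup>2))"
    using i by (intro integral_completion borel_measurable_sum) auto
  also have "\<dots> = (\<Sum>b\<in>Basis. bint (ball c r) (\<lambda>x. (f b x)\<^sup>2))"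
    unfolding bint_def using i by (rule Bochner_Integration.integral_sum)
  finally show ?thesis .
qed

text \<open>A ball is connected, so if it meets \<open>\<Omega>\<close> and misses the frontier it
  lies in \<open>\<Omega>\<close>. The strict inequality leaves room for a finite radius beyond
  \<open>r\<close>, also when the boundary distance is infinite.\<close>

lemma ball_subset_of_boundary_dist:
  fixes \<Omega> :: "'a::euclidean_space set"
  assumes x: "x \<in> \<Omega>" and r: "0 < r" "ereal r < boundary_dist \<Omega> x"
  obtains R where "r < R" "ball x R \<subseteq> \<Omega>"
proof -
  obtain s where s: "ereal r < s" "s < boundary_dist \<Omega> x" using dense r(2) by blast
  then have "s \<noteq> \<infinity>" "s \<noteq> - \<infinity>" by auto
  then obtain R where R: "s = ereal R" by (cases s) auto
  have "r < R" using s R by simp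
  have "ball x R \<inter> frontier \<Omega> = {}"
  proof (rule ccontr)
    assume "ball x R \<inter> frontier \<Omega> \<noteq> {}"
    then obtain y where y: "y \<in> frontier \<Omega>" "dist x y < R" by auto
    have "boundary_dist \<Omega> x \<le> ereal (dist x y)" unfolding boundary_dist_def by (rule INF_lower[OF y(1)])
    then show False using s(2) y(2) R by (meson ereal_less_eq(3) leD less_le_trans less_imp_le order_trans)
  qed
  moreover have "connected (ball x R)" by (rule connected_ball)
  moreover have "x \<in> ball x R \<inter> \<Omega>" using x r \<open>r < R\<close> by simp
  ultimately have "ball x R \<subseteq> \<Omega>"
    using connected_Int_frontier[of "ball x R" \<Omega>] by blast
  with \<open>r < R\<close> show ?thesis by (rule that)
qed

text \<open>As \<open>P\<close> is real and the test functions are real multiples of 1, pairing with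
  \<open>u\<close> commutes with taking the coordinates \<open>u x \<bullet> b\<close>. Each
  coordinate is a real function to which \<open>three_balls_L2\<close> applies with the same
  \<open>N\<close>, and the squared norms add up.\<close>

lemma three_balls_Hm2:
  fixes \<Omega> :: "'a::euclidean_space set" and x0 :: 'a
  assumes \<Omega>: "open \<Omega>" and x0: "x0 \<in> \<Omega>" and r: "0 < r1" "r1 < r2" "ereal r2 < boundary_dist \<Omega> x0"
  obtains a K where "a > 0" "K > 0"
    "\<And>P u. P \<in> Linf \<Omega> \<Longrightarrow> u \<in> (L2 \<Omega> :: ('a \<Rightarrow> 'b::{real_normed_field,euclidean_space}) set) \<Longrightarrow>
       L2_norm (ball x0 r2) u \<le> exp (K * (1 + Linf_norm \<Omega> P powr (2/3)))
         * (L2_norm (ball x0 r1) u + Hm2_norm \<Omega> (schroedinger \<Omega> P u)) powr (2 * a / (3 + 2 * a))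
         * (L2_norm \<Omega> u + Hm2_norm \<Omega> (schroedinger \<Omega> P u)) powr (1 - 2 * a / (3 + 2 * a))"
proof -
  have r2: "0 < r2" using r by simp
  obtain R where R: "r2 < R" "ball x0 R \<subseteq> \<Omega>" using ball_subset_of_boundary_dist[OF x0 r2 r(3)] by blast
  obtain a C t0 where C: "a > 0" "C \<ge> 0" "t0 \<ge> 1" and tb:
    "\<And>u P M N \<tau>. u \<in> borel_measurable borel \<Longrightarrow> integrable lborel (\<lambda>x. (u x)\<^sup>2) \<Longrightarrow>
       (\<And>x. x \<notin> ball x0 R \<Longrightarrow> u x = 0) \<Longrightarrow> P \<in> borel_measurable borel \<Longrightarrow> (\<And>x. \<bar>P x\<bar> \<le> M) \<Longrightarrow> N \<ge> 0 \<Longrightarrow>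
       (\<And>v. v \<in> test_functions (ball x0 R) \<Longrightarrow>
         \<bar>LINT x|lborel. u x * (P x * v x - laplacian v x)\<bar> \<le> N * sqrt (LINT x|lborel. (laplacian v x)\<^sup>2)) \<Longrightarrow>
       \<tau> \<ge> t0 * (1 + M powr (2/3)) \<Longrightarrow>
       bint (ball x0 r2) (\<lambda>x. (u x)\<^sup>2) \<le> C * (exp (3 * \<tau>) * (bint (ball x0 r1) (\<lambda>x. (u x)\<^sup>2) + N\<^sup>2)
         + exp (- 2 * a * \<tau>) * (LINT x|lborel. (u x)\<^sup>2))"
    using r(1,2) R(1) by (rule three_balls_L2[where c=x0]) blast
  \<comment> \<open>The square root of the constant in \<open>H2_estimate\<close>; it converts the
    H2 norm in the dual bound into the L2 norm of the Laplacian.\<close>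
  define L where "L = sqrt ((4 * R\<^sup>2)\<^sup>2 + 4 * R\<^sup>2 + 1)"
  have L: "L \<ge> 0" unfolding L_def by simp
  have Lsq: "H2_square v \<le> L\<^sup>2 * (LINT x|lborel. (laplacian v x)\<^sup>2)" if "v \<in> test_functions (ball x0 R)" for v
    using H2_estimate[OF that] R r2 unfolding H2_square_def L_def by simp
  define n where "n = real DIM('b)"
  have n: "n \<ge> 1" unfolding n_def by (simp add: DIM_ge_Suc0 Suc_leI)
  \<comment> \<open>Summing over the \<open>n\<close> coordinates yields
    \<open>n * N\<^sup>2\<close> with \<open>N = H * L\<close>; the factor
    \<open>n * (1 + L\<^sup>2)\<close> dominates both 1 and \<open>n * L\<^sup>2\<close>.\<close>
  define C' where "C' = C * (n * (1 + L\<^sup>2))"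
  have C': "C' \<ge> 0" unfolding C'_def using C n by simp
  have K: "C' + a * t0 > 0" using C C' by (intro add_nonneg_pos mult_pos_pos) auto
  show ?thesis
  proof (rule that[OF C(1) K])
    fix P and u :: "'a \<Rightarrow> 'b" assume P: "P \<in> Linf \<Omega>" and u: "u \<in> L2 \<Omega>"
    define M where "M = Linf_norm \<Omega> P"
    define H where "H = Hm2_norm \<Omega> (schroedinger \<Omega> P u)"
    have ne: "\<Omega> \<noteq> {}" using x0 by blast
    note PM = Linf_AE[OF \<Omega> ne P, folded M_def]
    have H0: "H \<ge> 0" unfolding H_def by (rule Hm2_norm_test(1)[OF \<Omega> ne P u])
    obtain Q where Q: "Q \<in> borel_measurable borel" "\<And>x. \<bar>Q x\<bar> \<le> M" "AE x in lebesgue. x \<in> \<Omega> \<longrightarrow> P x = Q x"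
      using exists_clipped_borel[OF \<Omega> _ PM(2) PM(1)] P unfolding Linf_def by blast
    have oR: "open (ball x0 R)" by simp
    have uR: "u \<in> L2 (ball x0 R)" by (rule L2_subset(1)[OF oR \<Omega> R(2) u])
    \<comment> \<open>The four properties are bundled so that a single choice gives representatives
      \<open>f b\<close> for all \<open>b\<close> at once.\<close>
    define \<Phi> where "\<Phi> b f \<longleftrightarrow> f \<in> borel_measurable borel \<and> (\<forall>x. x \<notin> ball x0 R \<longrightarrow> f x = 0) \<and>
      (AE x in lebesgue. x \<in> ball x0 R \<longrightarrow> u x \<bullet> b = f x) \<and> integrable lborel (\<lambda>x. (f x)\<^sup>2)" for b f
    define f where "f b = (SOME f. \<Phi> b f)" for b
    have "\<exists>f. \<Phi> b f" for b
      unfolding \<Phi>_def by (rule exists_borel_component[OF uR, of b]) blast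
    then have "\<Phi> b (f b)" for b
      unfolding f_def by (rule someI_ex)
    then have f: "\<And>b. f b \<in> borel_measurable borel" "\<And>b x. x \<notin> ball x0 R \<Longrightarrow> f b x = 0"
      "\<And>b. AE x in lebesgue. x \<in> ball x0 R \<longrightarrow> u x \<bullet> b = f b x" "\<And>b. integrable lborel (\<lambda>x. (f b x)\<^sup>2)"
      unfolding \<Phi>_def by blast+
    note [measurable] = Q(1) f(1)
    define N where "N = H * L"
    have N: "N \<ge> 0" using H0 L by (simp add: N_def)
    \<comment> \<open>\<open>Q\<close> and \<open>f b\<close> replace \<open>P\<close> and the
      coordinate of \<open>u\<close> inside the integral: they agree almost everywhere on
      \<open>ball x0 R\<close>, outside of which \<open>v\<close> and its Laplacian vanish. A
      coordinate of the vector-valued integral is then bounded by its norm.\<close>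
    have comp: "\<bar>LINT x|lborel. f b x * (Q x * v x - laplacian v x)\<bar> \<le> N * sqrt (LINT x|lborel. (laplacian v x)\<^sup>2)"
      if b: "b \<in> Basis" and v: "v \<in> test_functions (ball x0 R)" for b v
    proof -
      have v\<Omega>: "v \<in> test_functions \<Omega>" by (rule test_functions_mono[OF v R(2)])
      have cv: "continuous_on UNIV v" "continuous_on UNIV (laplacian v)"
        by (rule test_functions_continuous[OF v], rule laplacian_continuous[OF v])
      have zv: "v x = 0" "laplacian v x = 0" if "x \<notin> ball x0 R" for x
        using test_functions_zero[OF v that] laplacian_zero[OF v that] by auto
      have zv': "v x = 0" "laplacian v x = 0" if "x \<notin> cball x0 R" for x using zv[of x] that by auto
      obtain B1 where B1: "\<And>x. \<bar>v x\<bar> \<le> B1" using compact_support_bounded[OF cv(1) zv'(1)] by blast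
      obtain B2 where B2: "\<And>x. \<bar>laplacian v x\<bar> \<le> B2" using compact_support_bounded[OF cv(2) zv'(2)] by blast
      have [measurable]: "v \<in> borel_measurable borel" "laplacian v \<in> borel_measurable borel"
        using cv by (auto intro: borel_measurable_continuous_onI)
      define G where "G x = (P x * v x - laplacian v x) *\<^sub>R u x" for x
      have qb: "\<bar>Q x * v x - laplacian v x\<bar> \<le> M * B1 + B2" for x
      proof -
        have "\<bar>Q x * v x\<bar> \<le> M * B1" unfolding abs_mult using Q(2)[of x] B1[of x] PM(1) by (intro mult_mono) auto
        then show ?thesis using B2[of x] by linarith
      qed
      have ifb: "integrable lborel (\<lambda>x. f b x * (Q x * v x - laplacian v x))" for b
      proof -
        have "integrable lborel (f b)" by (rule square_integrable_imp_integrable[OF f(1,4,2)])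
        moreover have "(\<lambda>x. Q x * v x - laplacian v x) \<in> borel_measurable borel" by measurable
        ultimately show ?thesis using bounded_mult_integrable[OF _ _ qb, where f="f b" and x=0] by simp
      qed
      have ae: "AE x in lebesgue. (f b x * (Q x * v x - laplacian v x)) = (indicator \<Omega> x *\<^sub>R G x) \<bullet> b" for b
        using Q(3) f(3)[of b]
      proof eventually_elim
        case (elim x)
        show ?case
        proof (cases "x \<in> ball x0 R")
          case True
          then show ?thesis using elim R(2) by (auto simp: G_def)
        qed (simp add: zv G_def)
      qed
      have iG: "integrable lebesgue (\<lambda>x. indicator \<Omega> x *\<^sub>R G x)"
      proof -
        have "integrable lebesgue (\<lambda>x. (indicator \<Omega> x *\<^sub>R G x) \<bullet> b)" for b
          using integrable_lebesgue_AE(1)[OF _ ae[of b]] ifb[of b] by (simp add: integrable_completion)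
        then have "integrable lebesgue (\<lambda>x. \<Sum>b\<in>Basis. ((indicator \<Omega> x *\<^sub>R G x) \<bullet> b) *\<^sub>R b)"
          by (intro Bochner_Integration.integrable_sum integrable_scaleR_left)
        then show ?thesis by (simp only: euclidean_representation)
      qed
      have "(LINT x|lborel. f b x * (Q x * v x - laplacian v x)) = (LINT x|lebesgue. f b x * (Q x * v x - laplacian v x))"
        by (rule integral_completion[symmetric]) measurable
      also have "\<dots> = (LINT x|lebesgue. (indicator \<Omega> x *\<^sub>R G x) \<bullet> b)"
        by (rule integrable_lebesgue_AE(2)[OF _ ae, symmetric]) (use ifb[of b] in \<open>simp add: integrable_completion\<close>)
      also have "\<dots> = (LINT x|lebesgue_on \<Omega>. G x) \<bullet> b"
        unfolding lebesgue_on_simps[OF \<Omega>] using iG by (intro integral_inner_left)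
      finally have "\<bar>LINT x|lborel. f b x * (Q x * v x - laplacian v x)\<bar> \<le> norm (LINT x|lebesgue_on \<Omega>. G x)"
        using Basis_le_norm[OF b, of "LINT x|lebesgue_on \<Omega>. G x"] by simp
      also have "\<dots> \<le> H * sqrt (H2_square v)"
        unfolding G_def H_def by (rule Hm2_norm_test(2)[OF \<Omega> ne P u v\<Omega>])
      also have "\<dots> \<le> H * sqrt (L\<^sup>2 * (LINT x|lborel. (laplacian v x)\<^sup>2))"
        by (intro mult_left_mono real_sqrt_le_mono Lsq v H0)
      also have "\<dots> = N * sqrt (LINT x|lborel. (laplacian v x)\<^sup>2)"
        using L by (simp add: N_def real_sqrt_mult)
      finally show ?thesis .
    qed
    define x where "x = L2_norm (ball x0 r2) u"
    define \<alpha> where "\<alpha> = L2_norm (ball x0 r1) u + H"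
    define \<beta> where "\<beta> = L2_norm \<Omega> u + H"
    have nsq: "(L2_norm (ball x0 s) u)\<^sup>2 = (\<Sum>b\<in>Basis. bint (ball x0 s) (\<lambda>x. (f b x)\<^sup>2))" if "s \<le> R" for s
      by (rule L2_norm_components[where R=R]) (use f that in auto)
    have sub: "L2_norm (ball x0 s) u \<le> L2_norm \<Omega> u" if "s \<le> R" for s
    proof (rule L2_subset(2)[OF _ \<Omega> _ u])
      show "ball x0 s \<subseteq> \<Omega>" using R(2) that by (meson subset_ball order_trans)
    qed simp
    have "x \<le> exp ((C' + a * t0) * (1 + M powr (2/3))) * \<alpha> powr (2 * a / (3 + 2 * a)) * \<beta> powr (1 - 2 * a / (3 + 2 * a))"
    proof (rule powr_interpolation[OF C(1) C' C(3)])
      show "1 \<le> 1 + M powr (2/3)" by simp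
      show "0 \<le> x" "0 \<le> \<alpha>" using H0 by (auto simp: x_def \<alpha>_def L2_norm_nonneg)
      show "\<alpha> \<le> \<beta>" unfolding \<alpha>_def \<beta>_def using sub[of r1] r R by simp
      show "x \<le> \<beta>" unfolding x_def \<beta>_def using sub[of r2] R H0 by simp
      fix \<tau> assume \<tau>: "\<tau> \<ge> t0 * (1 + M powr (2/3))"
      define E D where "E = exp (3 * \<tau>)" and "D = exp (- 2 * a * \<tau>)"
      have ED: "E > 0" "D > 0" by (simp_all add: E_def D_def)
      have zR: "bint (ball x0 R) (\<lambda>x. (f b x)\<^sup>2) = (LINT x|lborel. (f b x)\<^sup>2)" for b
        unfolding bint_def using f(2)[of _ b] by (intro Bochner_Integration.integral_cong) (auto simp: indicator_def)
      have "x\<^sup>2 = (\<Sum>b\<in>Basis. bint (ball x0 r2) (\<lambda>x. (f b x)\<^sup>2))" unfolding x_def using R by (intro nsq) simp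
      also have "\<dots> \<le> (\<Sum>b\<in>Basis. C * (E * (bint (ball x0 r1) (\<lambda>x. (f b x)\<^sup>2) + N\<^sup>2) + D * (LINT x|lborel. (f b x)\<^sup>2)))"
        unfolding E_def D_def by (intro sum_mono tb[OF f(1,4,2) Q(1,2) N comp \<tau>])
      also have "\<dots> = C * (E * ((L2_norm (ball x0 r1) u)\<^sup>2 + n * N\<^sup>2) + D * (L2_norm (ball x0 R) u)\<^sup>2)"
      proof -
        have s1: "(L2_norm (ball x0 r1) u)\<^sup>2 = (\<Sum>b\<in>Basis. bint (ball x0 r1) (\<lambda>x. (f b x)\<^sup>2))" using r R by (intro nsq) simp
        have s2: "(L2_norm (ball x0 R) u)\<^sup>2 = (\<Sum>b\<in>Basis. (LINT x|lborel. (f b x)\<^sup>2))" using nsq[of R] zR by simp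
        show ?thesis unfolding s1 s2 n_def
          by (simp add: sum.distrib sum_distrib_left[symmetric] distrib_left)
      qed
      also have "\<dots> \<le> C * (E * ((n * (1 + L\<^sup>2)) * \<alpha>\<^sup>2) + D * ((n * (1 + L\<^sup>2)) * \<beta>\<^sup>2))"
      proof (intro mult_left_mono add_mono)
        have n1: "1 \<le> n * (1 + L\<^sup>2)" using mult_mono[of 1 n 1 "1 + L\<^sup>2"] n by simp
        have n2: "n * L\<^sup>2 \<le> n * (1 + L\<^sup>2)" using n by (intro mult_left_mono) auto
        have "(L2_norm (ball x0 r1) u)\<^sup>2 + n * N\<^sup>2 = 1 * (L2_norm (ball x0 r1) u)\<^sup>2 + n * L\<^sup>2 * H\<^sup>2"
          by (simp add: N_def power_mult_distrib)
        also have "\<dots> \<le> n * (1 + L\<^sup>2) * (L2_norm (ball x0 r1) u)\<^sup>2 + n * (1 + L\<^sup>2) * H\<^sup>2"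
          using n1 n2 by (intro add_mono mult_right_mono) auto
        also have "\<dots> \<le> n * (1 + L\<^sup>2) * \<alpha>\<^sup>2"
        proof -
          have "(L2_norm (ball x0 r1) u)\<^sup>2 + H\<^sup>2 \<le> \<alpha>\<^sup>2"
            unfolding \<alpha>_def power2_sum using L2_norm_nonneg[of "ball x0 r1" u] H0 by simp
          then have "n * (1 + L\<^sup>2) * ((L2_norm (ball x0 r1) u)\<^sup>2 + H\<^sup>2) \<le> n * (1 + L\<^sup>2) * \<alpha>\<^sup>2"
            using n1 by (intro mult_left_mono) auto
          then show ?thesis by (simp only: distrib_left)
        qed
        finally show "(L2_norm (ball x0 r1) u)\<^sup>2 + n * N\<^sup>2 \<le> n * (1 + L\<^sup>2) * \<alpha>\<^sup>2" .
        have "(L2_norm (ball x0 R) u)\<^sup>2 \<le> \<beta>\<^sup>2"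
          unfolding \<beta>_def using sub[of R] H0 L2_norm_nonneg[of "ball x0 R" u] by (intro power_mono) auto
        also have "1 * \<beta>\<^sup>2 \<le> n * (1 + L\<^sup>2) * \<beta>\<^sup>2" using n1 by (intro mult_right_mono) auto
        then have "\<beta>\<^sup>2 \<le> n * (1 + L\<^sup>2) * \<beta>\<^sup>2" by simp
        finally show "(L2_norm (ball x0 R) u)\<^sup>2 \<le> n * (1 + L\<^sup>2) * \<beta>\<^sup>2" .
      qed (use C ED in auto)
      also have "\<dots> = C' * (exp (3 * \<tau>) * \<alpha>\<^sup>2 + exp (- 2 * a * \<tau>) * \<beta>\<^sup>2)"
        unfolding C'_def E_def D_def by (simp add: algebra_simps)
      finally show "x\<^sup>2 \<le> C' * (exp (3 * \<tau>) * \<alpha>\<^sup>2 + exp (- 2 * a * \<tau>) * \<beta>\<^sup>2)" .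
    qed
    then show "L2_norm (ball x0 r2) u \<le> exp ((C' + a * t0) * (1 + Linf_norm \<Omega> P powr (2/3)))
         * (L2_norm (ball x0 r1) u + Hm2_norm \<Omega> (schroedinger \<Omega> P u)) powr (2 * a / (3 + 2 * a))
         * (L2_norm \<Omega> u + Hm2_norm \<Omega> (schroedinger \<Omega> P u)) powr (1 - 2 * a / (3 + 2 * a))"
      unfolding x_def \<alpha>_def \<beta>_def H_def M_def .
  qed
qed

theorem corollary2p7:
  fixes \<Omega> :: "'a::euclidean_space set" and x0 :: 'a and r1 r2 :: real
  assumes "open \<Omega>" and "connected \<Omega>" and "x0 \<in> \<Omega>"
    and "0 < r1" and "r1 < r2" and "ereal r2 < boundary_dist \<Omega> x0"
  shows "\<exists>\<kappa>::real. 0 < \<kappa> \<and> \<kappa> < 1 \<and>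
    (\<forall>P\<in>Linf \<Omega>. \<exists>C>0. \<forall>u\<in>(L2 \<Omega> :: ('a \<Rightarrow> 'b::{real_normed_field,euclidean_space}) set).
       L2_norm (ball x0 r2) u \<le>
         C * (L2_norm (ball x0 r1) u + Hm2_norm \<Omega> (schroedinger \<Omega> P u)) powr \<kappa>
           * (L2_norm \<Omega> u + Hm2_norm \<Omega> (schroedinger \<Omega> P u)) powr (1 - \<kappa>)) \<and>
    (\<forall>\<epsilon>::real. 0 < \<epsilon> \<and> \<epsilon> < 1 \<longrightarrow>
      (\<exists>C>0. \<forall>P\<in>Linf \<Omega>. (AE x in lebesgue_on \<Omega>. 0 \<le> P x) \<longrightarrow>
        (\<forall>u\<in>(L2 \<Omega> :: ('a \<Rightarrow> 'b) set).
           L2_norm (ball x0 r2) u \<le>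
             exp (C * \<kappa> powr (1 - \<epsilon>) * (Linf_norm \<Omega> P powr (2/3) + 1))
               * (L2_norm (ball x0 r1) u + Hm2_norm \<Omega> (schroedinger \<Omega> P u)) powr \<kappa>
               * (L2_norm \<Omega> u + Hm2_norm \<Omega> (schroedinger \<Omega> P u)) powr (1 - \<kappa>))))"
proof -
  obtain a K where aK: "a > 0" "K > 0" and main:
    "\<And>P u. P \<in> Linf \<Omega> \<Longrightarrow> u \<in> (L2 \<Omega> :: ('a \<Rightarrow> 'b) set) \<Longrightarrow>
       L2_norm (ball x0 r2) u \<le> exp (K * (1 + Linf_norm \<Omega> P powr (2/3)))
         * (L2_norm (ball x0 r1) u + Hm2_norm \<Omega> (schroedinger \<Omega> P u)) powr (2 * a / (3 + 2 * a))
         * (L2_norm \<Omega> u + Hm2_norm \<Omega> (schroedinger \<Omega> P u)) powr (1 - 2 * a / (3 + 2 * a))"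
    using assms(1,3-6) by (rule three_balls_Hm2) blast
  define \<kappa> where "\<kappa> = 2 * a / (3 + 2 * a)"
  have \<kappa>: "0 < \<kappa>" "\<kappa> < 1" using aK by (auto simp: \<kappa>_def field_simps)
  show ?thesis
  proof (rule exI[of _ \<kappa>], intro conjI \<kappa> ballI allI impI)
    fix P assume P: "P \<in> Linf \<Omega>"
    show "\<exists>C>0. \<forall>u\<in>(L2 \<Omega> :: ('a \<Rightarrow> 'b) set). L2_norm (ball x0 r2) u \<le>
         C * (L2_norm (ball x0 r1) u + Hm2_norm \<Omega> (schroedinger \<Omega> P u)) powr \<kappa>
           * (L2_norm \<Omega> u + Hm2_norm \<Omega> (schroedinger \<Omega> P u)) powr (1 - \<kappa>)"
      using main[OF P] unfolding \<kappa>_def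
      by (intro exI[of _ "exp (K * (1 + Linf_norm \<Omega> P powr (2/3)))"]) auto
  next
    fix \<epsilon> :: real assume "0 < \<epsilon> \<and> \<epsilon> < 1"
    define C where "C = K / \<kappa> powr (1 - \<epsilon>)"
    have C: "C > 0" "C * \<kappa> powr (1 - \<epsilon>) = K" using aK \<kappa> by (simp_all add: C_def)
    show "\<exists>C>0. \<forall>P\<in>Linf \<Omega>. (AE x in lebesgue_on \<Omega>. 0 \<le> P x) \<longrightarrow>
        (\<forall>u\<in>(L2 \<Omega> :: ('a \<Rightarrow> 'b) set).
           L2_norm (ball x0 r2) u \<le>
             exp (C * \<kappa> powr (1 - \<epsilon>) * (Linf_norm \<Omega> P powr (2/3) + 1))
               * (L2_norm (ball x0 r1) u + Hm2_norm \<Omega> (schroedinger \<Omega> P u)) powr \<kappa>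
               * (L2_norm \<Omega> u + Hm2_norm \<Omega> (schroedinger \<Omega> P u)) powr (1 - \<kappa>))"
      using main C(1) unfolding \<kappa>_def[symmetric]
      by (intro exI[of _ C]) (auto simp: C(2) add.commute)
  qed
qed

end
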